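(* Let $G$ be of type $G_2$. For $\gamma=m\alpha^\vee+n\beta^\vee\in Q^\vee$, \begin{align*} \mathbf m_1^{w_\gamma}&=1\\ \mathbf m_{s_0}^{w_\gamma}&=N_0+\tfrac12\Big(n(n-m)+\Big\lceil\frac m2\Big\rceil-\Big\lfloor\frac{n-m}2\Big\rfloor+\Big\lceil\frac n2\Big\rceil\Big)\\ \mathbf m_{s_1s_0}^{w_\gamma}&=\Big\lceil\frac m2\Big\rceil+N_0+N_1+n(n-m)\\ \mathbf m_{s_2s_1s_0}^{w_\gamma}&=\frac{m(m-1)}2+\tfrac12\Big(3n(n-m)+\Big\lceil\frac m2\Big\rceil-\Big\lfloor\frac{n-m}2\Big\rfloor-\Big\lceil\frac n2\Big\rceil\Big)\\ \mathbf m_{s_1s_2s_1s_0}^{w_\gamma}&=\frac{m(m-1)}2+N_2+2n(n-m)\\ \mathbf m_{s_0s_1s_2s_1s_0}^{w_\gamma}&=N_1+N_2+n(n-m)\\ \mathbf m_{s_2s_1s_2s_1s_0}^{w_\gamma}&=\frac{m(m-1)}2+\tfrac12\Big(3n(n-m)+\Big\lfloor\frac m2\Big\rfloor-\Big\lceil\frac{n-m}2\Big\rceil-\Big\lfloor\frac n2\Big\rfloor\Big)\\ \mathbf m_{s_1s_2s_1s_2s_1s_0}^{w_\gamma}&=\Big\lfloor\frac m2\Big\rfloor+N_0+N_1+n(n-m)\\ \mathbf m_{s_0s_1s_2s_1s_2s_1s_0}^{w_\gamma}&=N_0+\tfrac12\Big(n(n-m)+\Big\lfloor\frac m2\Big\rfloor-\Big\lceil\frac{n-m}2\Big\rceil+\Big\lfloor\frac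 n2\Big\rfloor\Big), \end{align*} where for $r\in\{0,1,2\}$ $$N_r=\Big\lfloor\frac{m+r}3\Big\rfloor(m+r)-\frac32\Big\lfloor\frac{m+r}3\Big\rfloor\Big(\Big\lfloor\frac{m+r}3\Big\rfloor+1\Big)$$ (which for $m\ge1$ equals $\sum_{1\le j\le m-1,\ j\equiv-r\bmod3}(m-j)$).
   Context: $Q^\vee$ is the coroot lattice of $G$, with simple coroots $\alpha^\vee$ (short) and $\beta^\vee$ (long), $(\alpha^\vee,\alpha^\vee)=2$, $(\alpha^\vee,\beta^\vee)=-3$, $(\beta^\vee,\beta^\vee)=6$; the highest short coroot is $\theta^\vee=2\alpha^\vee+\beta^\vee$. $W$ is the Weyl group, $\widehat W=Q^\vee\rtimes W$ the affine Weyl group with simple reflections $s_1=s_{\alpha^\vee}$, $s_2=s_{\beta^\vee}$, $s_0=t_{\theta^\vee}s_{\theta^\vee}$; $\epsilon(\cdot)$ is its sign character; $w_\gamma$ is the shortest element of $t_\gamma W$. The integers $\mathbf m_v^w$ are values at $q=1$ of inverse Kazhdan–Lusztig polynomials of $\widehat W$: with $C_v=\sum_{w\preccurlyeq v}P_{w,v}(1)w\in\mathbb Z[\widehat W]$ ($P_{w,v}$ the Kazhdan–Lusztig polynomials), $w=\sum_{v\preccurlyeq w}\epsilon(wv^{-1})\mathbf m_v^wC_v$. *)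

theory Defs
  imports
    Complex_Main
    "HOL-Library.Poly_Mapping"
    "HOL-Library.Product_Plus"
    "HOL-Computational_Algebra.Polynomial"
    "HOL-Algebra.Coset"
begin

section \<open>Kazhdan--Lusztig theory of a group with distinguished generators\<close>

text \<open>The definitions of this section are meant for a Coxeter system \<open>(G, S)\<close>, where \<open>S\<close> is the
  set of simple reflections in \<open>carrier G\<close>.\<close>

subsection \<open>Length, sign and Bruhat order\<close>

definition word_prod :: "('a, 'b) monoid_scheme \<Rightarrow> 'a list \<Rightarrow> 'a" where
  "word_prod G ws = foldr (\<lambda>s x. s \<otimes>\<^bsub>G\<^esub> x) ws \<one>\<^bsub>G\<^esub>"

definition word_for :: "('a, 'b) monoid_scheme \<Rightarrow> 'a set \<Rightarrow> 'a \<Rightarrow> 'a list \<Rightarrow> bool" where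
  "word_for G S w ws \<longleftrightarrow> set ws \<subseteq> S \<and> word_prod G ws = w"

definition cox_length :: "('a, 'b) monoid_scheme \<Rightarrow> 'a set \<Rightarrow> 'a \<Rightarrow> nat" where
  "cox_length G S w = (LEAST k. \<exists>ws. word_for G S w ws \<and> length ws = k)"

definition reduced_word :: "('a, 'b) monoid_scheme \<Rightarrow> 'a set \<Rightarrow> 'a \<Rightarrow> 'a list" where
  "reduced_word G S w = (SOME ws. word_for G S w ws \<and> length ws = cox_length G S w)"

definition cox_sign :: "('a, 'b) monoid_scheme \<Rightarrow> 'a set \<Rightarrow> 'a \<Rightarrow> int" where
  "cox_sign G S w = (- 1) ^ cox_length G S w"

definition reflections :: "('a, 'b) monoid_scheme \<Rightarrow> 'a set \<Rightarrow> 'a set" where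
  "reflections G S = {g \<otimes>\<^bsub>G\<^esub> s \<otimes>\<^bsub>G\<^esub> inv\<^bsub>G\<^esub> g | g s. g \<in> carrier G \<and> s \<in> S}"

definition bruhat_le :: "('a, 'b) monoid_scheme \<Rightarrow> 'a set \<Rightarrow> 'a \<Rightarrow> 'a \<Rightarrow> bool" where
  "bruhat_le G S u w \<longleftrightarrow> u \<in> carrier G \<and> w \<in> carrier G \<and>
     (u, w) \<in> {(x, x \<otimes>\<^bsub>G\<^esub> t) | x t. x \<in> carrier G \<and> t \<in> reflections G S \<and>
                 cox_length G S x < cox_length G S (x \<otimes>\<^bsub>G\<^esub> t)}\<^sup>*"

subsection \<open>The Hecke algebra and its bar involution\<close>

text \<open>Laurent polynomials \<open>\<int>[q\<^sup>1\<^sup>/\<^sup>2, q\<^sup>-\<^sup>1\<^sup>/\<^sup>2]\<close>, as the group ring of the additive group of integers: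
  \<open>qhalf k\<close> is the \<open>k\<close>-th power of the square root of \<open>q\<close>.\<close>

type_synonym laurent = "int \<Rightarrow>\<^sub>0 int"

definition qhalf :: "int \<Rightarrow> laurent" where
  "qhalf k = Poly_Mapping.single k 1"

abbreviation q_var :: laurent where
  "q_var \<equiv> qhalf 2"

abbreviation q_inv :: laurent where
  "q_inv \<equiv> qhalf (- 2)"

definition laurent_bar :: "laurent \<Rightarrow> laurent" where
  "laurent_bar f = Poly_Mapping.map_key uminus f"

definition poly_at_q :: "int poly \<Rightarrow> laurent" where
  "poly_at_q p = poly (map_poly of_int p) q_var"

text \<open>The free module with basis \<open>'a\<close> over a ring \<open>'r\<close> is \<open>'a \<Rightarrow>\<^sub>0 'r\<close>; in the Hecke algebra the basis
  element \<open>T\<^sub>w\<close> is \<open>Poly_Mapping.single w 1\<close>.\<close>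

definition scal :: "'r::mult_zero \<Rightarrow> ('a \<Rightarrow>\<^sub>0 'r) \<Rightarrow> ('a \<Rightarrow>\<^sub>0 'r)" where
  "scal c h = Poly_Mapping.map (\<lambda>x. c * x) h"

definition lin_ext :: "('r::comm_ring_1 \<Rightarrow> 'r) \<Rightarrow> ('a \<Rightarrow> ('b \<Rightarrow>\<^sub>0 'r)) \<Rightarrow> ('a \<Rightarrow>\<^sub>0 'r) \<Rightarrow> ('b \<Rightarrow>\<^sub>0 'r)" where
  "lin_ext \<phi> f h = (\<Sum>w\<in>Poly_Mapping.keys h. scal (\<phi> (Poly_Mapping.lookup h w)) (f w))"

text \<open>Left multiplication by \<open>T\<^sub>s\<close> for \<open>s \<in> S\<close>, in the normalization \<open>(T\<^sub>s + 1)(T\<^sub>s - q) = 0\<close>, and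
  left multiplication by its inverse \<open>T\<^sub>s\<^sup>-\<^sup>1 = q\<^sup>-\<^sup>1 T\<^sub>s - (1 - q\<^sup>-\<^sup>1)\<close>.\<close>

definition hecke_T :: "('a, 'b) monoid_scheme \<Rightarrow> 'a set \<Rightarrow> 'a \<Rightarrow> ('a \<Rightarrow>\<^sub>0 laurent) \<Rightarrow> ('a \<Rightarrow>\<^sub>0 laurent)" where
  "hecke_T G S s = lin_ext id (\<lambda>w.
     if cox_length G S w < cox_length G S (s \<otimes>\<^bsub>G\<^esub> w)
     then Poly_Mapping.single (s \<otimes>\<^bsub>G\<^esub> w) 1
     else Poly_Mapping.single (s \<otimes>\<^bsub>G\<^esub> w) q_var + Poly_Mapping.single w (q_var - 1))"

definition hecke_T_inv :: "('a, 'b) monoid_scheme \<Rightarrow> 'a set \<Rightarrow> 'a \<Rightarrow> ('a \<Rightarrow>\<^sub>0 laurent) \<Rightarrow> ('a \<Rightarrow>\<^sub>0 laurent)" where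
  "hecke_T_inv G S s h = scal q_inv (hecke_T G S s h) - scal (1 - q_inv) h"

text \<open>The bar involution is semilinear and sends \<open>T\<^sub>w\<close> to the inverse of \<open>T\<close> at \<open>w\<^sup>-\<^sup>1\<close>, which is
  \<open>T\<^sub>s\<^sup>-\<^sup>1 T\<^sub>t\<^sup>-\<^sup>1 \<cdots>\<close> for any reduced word \<open>s t \<cdots>\<close> of \<open>w\<close>.\<close>

definition hecke_bar :: "('a, 'b) monoid_scheme \<Rightarrow> 'a set \<Rightarrow> ('a \<Rightarrow>\<^sub>0 laurent) \<Rightarrow> ('a \<Rightarrow>\<^sub>0 laurent)" where
  "hecke_bar G S = lin_ext laurent_bar (\<lambda>w.
     foldr (hecke_T_inv G S) (reduced_word G S w) (Poly_Mapping.single \<one>\<^bsub>G\<^esub> 1))"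

subsection \<open>Kazhdan--Lusztig polynomials and inverse Kazhdan--Lusztig polynomials at 1\<close>

text \<open>\<open>kl_element G S w p\<close> is \<open>q\<^sup>-\<^sup>l\<^sup>(\<^sup>w\<^sup>)\<^sup>/\<^sup>2 \<Sum>\<^sub>y p\<^sub>y(q) T\<^sub>y\<close>, the sum being over \<open>y \<preceq> w\<close>.\<close>

definition kl_element ::
    "('a, 'b) monoid_scheme \<Rightarrow> 'a set \<Rightarrow> 'a \<Rightarrow> ('a \<Rightarrow> int poly) \<Rightarrow> ('a \<Rightarrow>\<^sub>0 laurent)" where
  "kl_element G S w p = scal (qhalf (- int (cox_length G S w)))
     (\<Sum>y | bruhat_le G S y w. Poly_Mapping.single y (poly_at_q (p y)))"

text \<open>The condition \<open>deg p\<^sub>y \<le> (l(w) - l(y) - 1) / 2\<close> for \<open>y \<prec> w\<close> is stated without division; it is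
  harmless for \<open>p\<^sub>y = 0\<close>, whose \<open>degree\<close> is \<open>0\<close>.\<close>

definition is_kl_family ::
    "('a, 'b) monoid_scheme \<Rightarrow> 'a set \<Rightarrow> 'a \<Rightarrow> ('a \<Rightarrow> int poly) \<Rightarrow> bool" where
  "is_kl_family G S w p \<longleftrightarrow>
     (\<forall>y. \<not> bruhat_le G S y w \<longrightarrow> p y = 0) \<and>
     p w = 1 \<and>
     (\<forall>y. bruhat_le G S y w \<and> y \<noteq> w \<longrightarrow>
        2 * degree (p y) + cox_length G S y + 1 \<le> cox_length G S w) \<and>
     hecke_bar G S (kl_element G S w p) = kl_element G S w p"

definition kl_poly :: "('a, 'b) monoid_scheme \<Rightarrow> 'a set \<Rightarrow> 'a \<Rightarrow> 'a \<Rightarrow> int poly" where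
  "kl_poly G S y w = (THE p. is_kl_family G S w p) y"

text \<open>\<open>C\<^sub>v = \<Sum>\<^sub>w P\<^sub>w\<^sub>,\<^sub>v(1) w\<close> in the integral group ring of \<open>G\<close>, of which only the additive structure is used.\<close>

definition kl_C :: "('a, 'b) monoid_scheme \<Rightarrow> 'a set \<Rightarrow> 'a \<Rightarrow> ('a \<Rightarrow>\<^sub>0 int)" where
  "kl_C G S v = (\<Sum>w | bruhat_le G S w v. Poly_Mapping.single w (poly (kl_poly G S w v) 1))"

text \<open>\<open>inv_kl G S v w\<close> is the integer \<open>\<^bold>m\<close> with lower index \<open>v\<close> and upper index \<open>w\<close>; it is
  set to \<open>0\<close> unless \<open>v \<preceq> w\<close>.\<close>

definition is_inv_kl_family ::
    "('a, 'b) monoid_scheme \<Rightarrow> 'a set \<Rightarrow> 'a \<Rightarrow> ('a \<Rightarrow> int) \<Rightarrow> bool" where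
  "is_inv_kl_family G S w m \<longleftrightarrow>
     (\<forall>v. \<not> bruhat_le G S v w \<longrightarrow> m v = 0) \<and>
     Poly_Mapping.single w 1 =
       (\<Sum>v | bruhat_le G S v w. scal (cox_sign G S (w \<otimes>\<^bsub>G\<^esub> inv\<^bsub>G\<^esub> v) * m v) (kl_C G S v))"

definition inv_kl :: "('a, 'b) monoid_scheme \<Rightarrow> 'a set \<Rightarrow> 'a \<Rightarrow> 'a \<Rightarrow> int" where
  "inv_kl G S v w = (THE m. is_inv_kl_family G S w m) v"


section \<open>The affine Weyl group of type \<open>G\<^sub>2\<close>\<close>

text \<open>The pair \<open>(m, n)\<close> stands for \<open>m \<alpha>\<^sup>\<or> + n \<beta>\<^sup>\<or>\<close>.\<close>

type_synonym coroot_lattice = "int \<times> int"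

fun coroot_form :: "coroot_lattice \<Rightarrow> coroot_lattice \<Rightarrow> int" where
  "coroot_form (a, b) (c, d) = 2 * (a * c) - 3 * (a * d) - 3 * (b * c) + 6 * (b * d)"

abbreviation alpha_ch :: coroot_lattice where "alpha_ch \<equiv> (1, 0)"
abbreviation beta_ch :: coroot_lattice where "beta_ch \<equiv> (0, 1)"
abbreviation theta_ch :: coroot_lattice where "theta_ch \<equiv> (2, 1)"

text \<open>The division is exact when \<open>d\<close> is a coroot.\<close>

definition coroot_refl :: "coroot_lattice \<Rightarrow> coroot_lattice \<Rightarrow> coroot_lattice" where
  "coroot_refl d x = (let k = 2 * coroot_form x d div coroot_form d d in x - (k * fst d, k * snd d))"

inductive_set weyl :: "(coroot_lattice \<Rightarrow> coroot_lattice) set" where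
  weyl_id: "id \<in> weyl"
| weyl_alpha: "w \<in> weyl \<Longrightarrow> coroot_refl alpha_ch \<circ> w \<in> weyl"
| weyl_beta: "w \<in> weyl \<Longrightarrow> coroot_refl beta_ch \<circ> w \<in> weyl"

text \<open>The semidirect product; \<open>(x, u)\<close> stands for \<open>t\<^sub>x u\<close>.\<close>

definition affine_weyl :: "(coroot_lattice \<times> (coroot_lattice \<Rightarrow> coroot_lattice)) monoid" where
  "affine_weyl = \<lparr>carrier = UNIV \<times> weyl,
     mult = (\<lambda>(x, u) (y, v). (x + u y, u \<circ> v)),
     one = (0, id)\<rparr>"

definition s0 :: "coroot_lattice \<times> (coroot_lattice \<Rightarrow> coroot_lattice)" where
  "s0 = (theta_ch, coroot_refl theta_ch)"

definition s1 :: "coroot_lattice \<times> (coroot_lattice \<Rightarrow> coroot_lattice)" where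
  "s1 = (0, coroot_refl alpha_ch)"

definition s2 :: "coroot_lattice \<times> (coroot_lattice \<Rightarrow> coroot_lattice)" where
  "s2 = (0, coroot_refl beta_ch)"

abbreviation simple_refls :: "(coroot_lattice \<times> (coroot_lattice \<Rightarrow> coroot_lattice)) set" where
  "simple_refls \<equiv> {s0, s1, s2}"

definition w_min :: "coroot_lattice \<Rightarrow> coroot_lattice \<times> (coroot_lattice \<Rightarrow> coroot_lattice)" where
  "w_min \<gamma> = (THE w. w \<in> (\<gamma>, id) <#\<^bsub>affine_weyl\<^esub> ({0} \<times> weyl) \<and>
     (\<forall>u \<in> (\<gamma>, id) <#\<^bsub>affine_weyl\<^esub> ({0} \<times> weyl).
        cox_length affine_weyl simple_refls w \<le> cox_length affine_weyl simple_refls u))"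

abbreviation m_coeff ::
    "(coroot_lattice \<times> (coroot_lattice \<Rightarrow> coroot_lattice)) list \<Rightarrow> coroot_lattice \<Rightarrow> int" where
  "m_coeff vs \<gamma> \<equiv> inv_kl affine_weyl simple_refls (word_prod affine_weyl vs) (w_min \<gamma>)"

definition N_term :: "int \<Rightarrow> int \<Rightarrow> real" where
  "N_term r m = \<lfloor>(m + r) / 3\<rfloor> * (m + r) - 3 / 2 * \<lfloor>(m + r) / 3\<rfloor> * (\<lfloor>(m + r) / 3\<rfloor> + 1)"


subsection \<open>Consistency of the encoding\<close>

lemma coroot_refl_simps [simp]:
  "coroot_refl alpha_ch (a, b) = (3 * b - a, b)"
  "coroot_refl beta_ch (a, b) = (a, a - b)"
  "coroot_refl theta_ch (a, b) = (- a, b - a)"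
  by (simp_all add: coroot_refl_def Let_def)

lemma coroot_refl_refl: "coroot_refl alpha_ch (coroot_refl alpha_ch x) = x" "coroot_refl beta_ch (coroot_refl beta_ch x) = x"
  by (cases x; simp)+

lemma weyl_comp: "u \<in> weyl \<Longrightarrow> v \<in> weyl \<Longrightarrow> u \<circ> v \<in> weyl"
  by (induction rule: weyl.induct) (auto simp: comp_assoc intro: weyl.intros)

lemma weyl_gens: "coroot_refl alpha_ch \<in> weyl" "coroot_refl beta_ch \<in> weyl" "coroot_refl theta_ch \<in> weyl"
proof -
  show a: "coroot_refl alpha_ch \<in> weyl" and b: "coroot_refl beta_ch \<in> weyl"
    using weyl_alpha[OF weyl_id] weyl_beta[OF weyl_id] by simp_all
  have "coroot_refl theta_ch = coroot_refl alpha_ch \<circ> (coroot_refl beta_ch \<circ> (coroot_refl alpha_ch \<circ> (coroot_refl beta_ch \<circ> coroot_refl alpha_ch)))"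
    by (auto simp: fun_eq_iff)
  then show "coroot_refl theta_ch \<in> weyl"
    using a b by (simp add: weyl_alpha weyl_beta)
qed

lemma weyl_add: "u \<in> weyl \<Longrightarrow> u (x + y) = u x + u y"
proof (induction rule: weyl.induct)
  case (weyl_alpha w)
  then show ?case by (cases "w x"; cases "w y") simp
next
  case (weyl_beta w)
  then show ?case by (cases "w x"; cases "w y") simp
qed simp

lemma weyl_inverse: "u \<in> weyl \<Longrightarrow> \<exists>v\<in>weyl. v \<circ> u = id"
proof (induction rule: weyl.induct)
  case (weyl_alpha w)
  then obtain v where v: "v \<in> weyl" "v \<circ> w = id" by blast
  have "(v \<circ> coroot_refl alpha_ch) \<circ> (coroot_refl alpha_ch \<circ> w) = id"
    using v(2) by (simp add: fun_eq_iff coroot_refl_refl)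
  then show ?case using v(1) weyl_comp weyl_gens by blast
next
  case (weyl_beta w)
  then obtain v where v: "v \<in> weyl" "v \<circ> w = id" by blast
  have "(v \<circ> coroot_refl beta_ch) \<circ> (coroot_refl beta_ch \<circ> w) = id"
    using v(2) by (simp add: fun_eq_iff coroot_refl_refl)
  then show ?case using v(1) weyl_comp weyl_gens by blast
qed (metis comp_id weyl_id)

lemma group_affine_weyl: "group affine_weyl"
proof (rule groupI)
  fix g assume "g \<in> carrier affine_weyl"
  then obtain x u where g: "g = (x, u)" "u \<in> weyl" by (auto simp: affine_weyl_def)
  obtain v where v: "v \<in> weyl" "v \<circ> u = id" using weyl_inverse g(2) by blast
  have "(- v x, v) \<otimes>\<^bsub>affine_weyl\<^esub> g = \<one>\<^bsub>affine_weyl\<^esub>"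
    using v g by (simp add: affine_weyl_def)
  then show "\<exists>h\<in>carrier affine_weyl. h \<otimes>\<^bsub>affine_weyl\<^esub> g = \<one>\<^bsub>affine_weyl\<^esub>"
    using v(1) by (intro bexI[of _ "(- v x, v)"]) (simp_all add: affine_weyl_def)
qed (auto simp: affine_weyl_def weyl_comp weyl_add weyl_id add.assoc comp_assoc)

lemma simple_refls_carrier: "simple_refls \<subseteq> carrier affine_weyl"
  using weyl_gens by (auto simp: affine_weyl_def s0_def s1_def s2_def)

end

theory Submission
  imports Defs "HOL-Algebra.Generated_Groups"
begin

text \<open>The elements \<open>C\<^sub>v\<close>, \<open>v\<close> outside the nine elements of the theorem, together span a left ideal
  of the group ring, and the quotient is a nine-dimensional module given by a \<open>W\<close>-graph which is a tree:
  every \<open>v \<noteq> 1\<close> of the nine has a unique left descent, so the coefficients \<open>\<mu>(x, v)\<close> that matter are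
  those with \<open>v = t x\<close> for a simple reflection \<open>t\<close>.  In this quotient
  \<open>t\<^sub>\<gamma> u e\<^sub>1 = det u \<cdot> t\<^sub>\<gamma> e\<^sub>1\<close> for \<open>u\<close> in the finite Weyl group, so the coordinates of
  \<open>w\<^sub>\<gamma> e\<^sub>1\<close> are, up to signs, functions of \<open>\<gamma>\<close> that are determined by their transformation under
  the three simple reflections of the coroot lattice.  The stated quasi-polynomials transform in the
  same way.

  That the affine Weyl group is a Coxeter group is used through the inversion cocycle: a reflection \<open>t\<close>
  is an inversion of \<open>w\<close> iff its hyperplane separates a point \<open>p\<close> of the base alcove from \<open>w\<^sup>-\<^sup>1 p\<close>.\<close>

section \<open>Coxeter groups\<close>

text \<open>The quotient module is never built. What is used of it is its orbit map in coordinates: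
  one real-valued function on the group for each of the nine \<open>x\<close>. Extended linearly to
  the group ring, it takes \<open>C_v\<close> to 1 if \<open>v = x\<close> and to 0 otherwise, so
  applying it to the expansion of \<open>w_\<gamma>\<close> isolates one coefficient. This duality
  concerns infinitely many \<open>v\<close>, most of whose Kazhdan-Lusztig polynomials are out of
  reach; but the recursion for \<open>C_v\<close>, tested on such a function, involves only the
  numbers \<mu>(x, v) with \<open>x\<close> among the nine.

  Apart from 1, the nine are the elements with a unique reduced word whose last letter is
  \<open>s0\<close>. Their graph is the affine diagram of type E7, and 1 is attached to it at
  \<open>s0\<close>.

  The finite part \<open>u\<close> of \<open>t_\<gamma> u\<close> enters a coordinate only through
  its determinant, which is also the sign of \<open>t_\<gamma> u\<close>. The two cancel, so the
  \<open>u\<close> that makes \<open>t_\<gamma> u\<close> shortest never has to be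
  determined.\<close>

text \<open>\<open>neg w t\<close> stands for ``\<open>w\<close> makes the positive root of the reflection \<open>t\<close> negative''; a group
  generated by involutions with such a cocycle is a Coxeter group.\<close>

locale coxeter_cocycle = group G for G (structure) +
  fixes S :: "'a set" and neg :: "'a \<Rightarrow> 'a \<Rightarrow> bool"
  assumes S_carrier: "S \<subseteq> carrier G"
    and finite_S: "finite S"
    and S_involution: "s \<in> S \<Longrightarrow> s \<otimes> s = \<one>"
    and S_generates: "w \<in> carrier G \<Longrightarrow> \<exists>ws. word_for G S w ws"
    and neg_one: "t \<in> reflections G S \<Longrightarrow> \<not> neg \<one> t"
    and neg_simple_mult: "s \<in> S \<Longrightarrow> w \<in> carrier G \<Longrightarrow> t \<in> reflections G S \<Longrightarrow>
          neg (s \<otimes> w) t \<longleftrightarrow> neg w t \<noteq> (w \<otimes> t \<otimes> inv w = s)"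
begin

abbreviation len :: "'a \<Rightarrow> nat" where "len \<equiv> cox_length G S"
abbreviation ble :: "'a \<Rightarrow> 'a \<Rightarrow> bool" where "ble \<equiv> bruhat_le G S"
abbreviation refls :: "'a set" where "refls \<equiv> reflections G S"

section \<open>Involutions and reflections\<close>

lemma S_closed [simp, intro]: "s \<in> S \<Longrightarrow> s \<in> carrier G"
  using S_carrier by blast

lemma inv_simple [simp]: "s \<in> S \<Longrightarrow> inv s = s"
  using S_involution inv_equality by blast

lemma simple_cancel_left [simp]: "s \<in> S \<Longrightarrow> w \<in> carrier G \<Longrightarrow> s \<otimes> (s \<otimes> w) = w"
  by (metis S_closed S_involution l_one m_assoc)

lemma simple_cancel_right [simp]: "s \<in> S \<Longrightarrow> w \<in> carrier G \<Longrightarrow> w \<otimes> s \<otimes> s = w"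
  by (simp add: m_assoc S_involution)

lemma refl_closed [simp]: "t \<in> refls \<Longrightarrow> t \<in> carrier G"
  by (auto simp: reflections_def)

lemma reflE:
  assumes "t \<in> refls"
  obtains g s where "g \<in> carrier G" "s \<in> S" "t = g \<otimes> s \<otimes> inv g"
  using assms unfolding reflections_def by blast

lemma inv_cancel [simp]: "x \<in> carrier G \<Longrightarrow> y \<in> carrier G \<Longrightarrow> x \<otimes> (inv x \<otimes> y) = y"
    "x \<in> carrier G \<Longrightarrow> y \<in> carrier G \<Longrightarrow> inv x \<otimes> (x \<otimes> y) = y"
  by (simp_all flip: m_assoc)

lemma refl_involution: "t \<in> refls \<Longrightarrow> t \<otimes> t = \<one>"
proof -
  assume "t \<in> refls"
  then show ?thesis by (auto elim!: reflE simp: m_assoc S_involution)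
qed

lemma refl_cancel [simp]: "t \<in> refls \<Longrightarrow> w \<in> carrier G \<Longrightarrow> w \<otimes> t \<otimes> t = w"
  by (simp add: m_assoc refl_involution)

lemma refl_conj: "t \<in> refls \<Longrightarrow> g \<in> carrier G \<Longrightarrow> g \<otimes> t \<otimes> inv g \<in> refls"
proof -
  assume t: "t \<in> refls" and g: "g \<in> carrier G"
  from t obtain h s where h: "h \<in> carrier G" "s \<in> S" "t = h \<otimes> s \<otimes> inv h"
    by (rule reflE)
  then have "g \<otimes> t \<otimes> inv g = (g \<otimes> h) \<otimes> s \<otimes> inv (g \<otimes> h)"
    using g by (simp add: m_assoc inv_mult_group)
  then show ?thesis unfolding reflections_def using g h by blast
qed

lemma simple_refl: "s \<in> S \<Longrightarrow> s \<in> refls"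
  unfolding reflections_def by (rule CollectI, rule exI[of _ \<one>], rule exI[of _ s]) simp

lemma refl_conj': "t \<in> refls \<Longrightarrow> g \<in> carrier G \<Longrightarrow> inv g \<otimes> t \<otimes> g \<in> refls"
  using refl_conj[of t "inv g"] by simp

lemma conj_cancel: "t \<in> carrier G \<Longrightarrow> g \<in> carrier G \<Longrightarrow> g \<otimes> (inv g \<otimes> t \<otimes> g) \<otimes> inv g = t"
  by (simp add: m_assoc)

lemma mult_conj: "s \<in> carrier G \<Longrightarrow> w \<in> carrier G \<Longrightarrow> w \<otimes> (inv w \<otimes> s \<otimes> w) = s \<otimes> w"
  by (simp add: m_assoc)

subsection \<open>Words and lengths\<close>

lemma word_prod_Nil [simp]: "word_prod G [] = \<one>"
  and word_prod_Cons [simp]: "word_prod G (s # ws) = s \<otimes> word_prod G ws"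
  by (simp_all add: word_prod_def)

lemma word_prod_closed [simp]: "set ws \<subseteq> S \<Longrightarrow> word_prod G ws \<in> carrier G"
  by (induction ws) auto

lemma word_prod_append [simp]: "set us \<subseteq> S \<Longrightarrow> set ws \<subseteq> S \<Longrightarrow>
    word_prod G (us @ ws) = word_prod G us \<otimes> word_prod G ws"
  by (induction us) (auto simp: m_assoc)

lemma word_prod_rev: "set ws \<subseteq> S \<Longrightarrow> word_prod G (rev ws) = inv (word_prod G ws)"
  by (induction ws) (auto simp: inv_mult_group)

lemma simple_induct [consumes 1, case_names one mult]:
  assumes "w \<in> carrier G" and "P \<one>"
    and "\<And>s w. s \<in> S \<Longrightarrow> w \<in> carrier G \<Longrightarrow> P w \<Longrightarrow> P (s \<otimes> w)"
  shows "P w"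
proof -
  obtain ws where ws: "set ws \<subseteq> S" "word_prod G ws = w"
    using S_generates[OF assms(1)] by (auto simp: word_for_def)
  from ws(1) have "P (word_prod G ws)"
    by (induction ws) (auto intro: assms)
  with ws(2) show ?thesis by simp
qed

lemma len_le: "set ws \<subseteq> S \<Longrightarrow> len (word_prod G ws) \<le> length ws"
  unfolding cox_length_def word_for_def by (rule Least_le) auto

lemma reduced_word:
  assumes "w \<in> carrier G"
  shows "set (reduced_word G S w) \<subseteq> S" "word_prod G (reduced_word G S w) = w"
    "length (reduced_word G S w) = len w"
proof -
  have "\<exists>ws. word_for G S w ws \<and> length ws = cox_length G S w"
    unfolding cox_length_def
    by (rule LeastI_ex) (use S_generates[OF assms] in blast)
  from someI_ex[OF this] show "set (reduced_word G S w) \<subseteq> S"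
    "word_prod G (reduced_word G S w) = w" "length (reduced_word G S w) = len w"
    by (auto simp: reduced_word_def word_for_def)
qed

lemma len_one [simp]: "len \<one> = 0"
  using len_le[of "[]"] by simp

lemma len_simple_mult_le: "s \<in> S \<Longrightarrow> w \<in> carrier G \<Longrightarrow> len (s \<otimes> w) \<le> Suc (len w)"
  using len_le[of "s # reduced_word G S w"] reduced_word[of w] by auto

lemma len_simple_mult_ge: "s \<in> S \<Longrightarrow> w \<in> carrier G \<Longrightarrow> len w \<le> Suc (len (s \<otimes> w))"
  using len_simple_mult_le[of s "s \<otimes> w"] by simp

section \<open>Inversions, deletion and exchange\<close>

lemma neg_deletion:
  assumes "set ws \<subseteq> S" "t \<in> refls" "neg (word_prod G ws) t"
  shows "\<exists>i<length ws. word_prod G ws \<otimes> t = word_prod G (take i ws @ drop (Suc i) ws)"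
  using assms
proof (induction ws)
  case Nil
  then show ?case using neg_one by simp
next
  case (Cons s ws)
  let ?w = "word_prod G ws"
  have w: "?w \<in> carrier G" and s: "s \<in> S" using Cons.prems by auto
  show ?case
  proof (cases "neg ?w t")
    case True
    with Cons obtain i where "i < length ws" "?w \<otimes> t = word_prod G (take i ws @ drop (Suc i) ws)"
      by auto
    then show ?thesis using w s Cons.prems by (intro exI[of _ "Suc i"]) (simp add: m_assoc)
  next
    \<comment> \<open>At this letter \<open>t\<close> becomes an inversion: conjugated by the
      product of the later letters, \<open>t\<close> is \<open>s\<close> itself, so multiplying by
      \<open>t\<close> deletes the letter. The word may be any word, reduced or not.\<close>
    case False
    then have e: "?w \<otimes> t \<otimes> inv ?w = s"
      using neg_simple_mult[OF s w] Cons.prems by auto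
    have "s \<otimes> ?w \<otimes> t = s \<otimes> (?w \<otimes> t \<otimes> inv ?w) \<otimes> ?w"
      using w s Cons.prems by (simp add: m_assoc)
    also have "\<dots> = ?w" unfolding e using s w by (simp add: S_involution)
    finally show ?thesis by (intro exI[of _ 0]) simp
  qed
qed

text \<open>Inverting twice cancels: \<open>y\<close> acts on \<open>t\<close>, and \<open>x\<close>
  then acts on the conjugate of \<open>t\<close> by \<open>y\<close>. The locale assumption is the
  case of a simple \<open>x\<close>; induction on words gives the rest.\<close>

lemma neg_mult:
  assumes "x \<in> carrier G" "y \<in> carrier G" "t \<in> refls"
  shows "neg (x \<otimes> y) t \<longleftrightarrow> neg y t \<noteq> neg x (y \<otimes> t \<otimes> inv y)"
  using assms(1)
proof (induction rule: simple_induct)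
  case one
  then show ?case using assms neg_one[OF refl_conj] by simp
next
  case (mult s x)
  let ?t = "y \<otimes> t \<otimes> inv y"
  have t: "?t \<in> refls" using assms refl_conj by simp
  have "neg (s \<otimes> x \<otimes> y) t \<longleftrightarrow> neg (x \<otimes> y) t \<noteq> ((x \<otimes> y) \<otimes> t \<otimes> inv (x \<otimes> y) = s)"
    using mult assms neg_simple_mult[of s "x \<otimes> y" t] by (simp add: m_assoc)
  also have "(x \<otimes> y) \<otimes> t \<otimes> inv (x \<otimes> y) = x \<otimes> ?t \<otimes> inv x"
    using mult assms by (simp add: m_assoc inv_mult_group)
  finally show ?case
    using mult neg_simple_mult[OF mult(1,2) t] by auto
qed

lemma neg_simple: "s \<in> S \<Longrightarrow> t \<in> refls \<Longrightarrow> neg s t \<longleftrightarrow> t = s"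
  using neg_simple_mult[of s \<one> t] neg_one by simp

lemma neg_inv: "w \<in> carrier G \<Longrightarrow> t \<in> refls \<Longrightarrow> neg (inv w) (w \<otimes> t \<otimes> inv w) \<longleftrightarrow> neg w t"
  using neg_mult[of "inv w" w t] neg_one[of t] by simp

text \<open>Write \<open>t = g s g^-1\<close> as the product of \<open>g s\<close> and
  \<open>g^-1\<close>. The cocycle rule then compares \<open>neg g s\<close> with its
  negation.\<close>

lemma neg_self: "t \<in> refls \<Longrightarrow> neg t t"
proof -
  assume t: "t \<in> refls"
  then obtain g s where g: "g \<in> carrier G" "s \<in> S" "t = g \<otimes> s \<otimes> inv g"
    by (rule reflE)
  have s: "s \<in> refls" using g simple_refl by simp
  have ts: "inv g \<otimes> t \<otimes> g = s" using g by (simp add: m_assoc)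
  have "neg t t \<longleftrightarrow> neg (inv g) t \<noteq> neg (g \<otimes> s) s"
    using neg_mult[of "g \<otimes> s" "inv g" t] g t ts by simp
  also have "neg (g \<otimes> s) s \<longleftrightarrow> \<not> neg g s"
    using neg_mult[of g s s] g s neg_simple[of s s] by (simp add: m_assoc S_involution)
  also have "neg (inv g) t \<longleftrightarrow> neg g s" using neg_inv[of g s] g s by simp
  finally show ?thesis by simp
qed

lemma neg_mult_self: "t \<in> refls \<Longrightarrow> w \<in> carrier G \<Longrightarrow> neg (w \<otimes> t) t \<longleftrightarrow> \<not> neg w t"
  using neg_mult[of w t t] neg_self[of t] inv_equality[OF refl_involution[of t]]
  by (simp add: m_assoc refl_involution)

lemma neg_imp_len: "t \<in> refls \<Longrightarrow> w \<in> carrier G \<Longrightarrow> neg w t \<Longrightarrow> len (w \<otimes> t) < len w"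
proof -
  assume t: "t \<in> refls" and w: "w \<in> carrier G" and n: "neg w t"
  let ?ws = "reduced_word G S w"
  note r = reduced_word[OF w]
  obtain i where i: "i < length ?ws" "w \<otimes> t = word_prod G (take i ?ws @ drop (Suc i) ?ws)"
    using neg_deletion[of ?ws t] r n t by auto
  have "set (take i ?ws @ drop (Suc i) ?ws) \<subseteq> S"
    using r(1) set_take_subset[of i ?ws] set_drop_subset[of "Suc i" ?ws] by auto
  from len_le[OF this] show ?thesis using i r(3) by simp
qed

text \<open>Right multiplication by \<open>t\<close> exchanges inversion and non-inversion of
  \<open>t\<close>, so \<open>neg_imp_len\<close> at \<open>w\<close> and at \<open>w t\<close>
  settles both directions.\<close>

lemma neg_iff_len: "t \<in> refls \<Longrightarrow> w \<in> carrier G \<Longrightarrow> neg w t \<longleftrightarrow> len (w \<otimes> t) < len w"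
  using neg_imp_len[of t w] neg_imp_len[of t "w \<otimes> t"] neg_mult_self[of t w] by fastforce

lemma not_neg_iff_len: "t \<in> refls \<Longrightarrow> w \<in> carrier G \<Longrightarrow> \<not> neg w t \<longleftrightarrow> len w < len (w \<otimes> t)"
  using neg_iff_len[of t "w \<otimes> t"] neg_mult_self[of t w] by simp

lemma len_refl_neq: "t \<in> refls \<Longrightarrow> w \<in> carrier G \<Longrightarrow> len (w \<otimes> t) \<noteq> len w"
  using neg_iff_len[of t w] not_neg_iff_len[of t w] by linarith

lemma left_as_refl: "s \<in> S \<Longrightarrow> w \<in> carrier G \<Longrightarrow>
    inv w \<otimes> s \<otimes> w \<in> refls \<and> w \<otimes> (inv w \<otimes> s \<otimes> w) = s \<otimes> w"
  using refl_conj'[OF simple_refl] mult_conj by simp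

lemma len_simple_cases:
  assumes "s \<in> S" "w \<in> carrier G"
  obtains "len (s \<otimes> w) = Suc (len w)" | "len w = Suc (len (s \<otimes> w))"
proof -
  have "len (s \<otimes> w) \<noteq> len w"
    using len_refl_neq[of "inv w \<otimes> s \<otimes> w" w] left_as_refl[OF assms] assms by auto
  then show ?thesis
    using that len_simple_mult_le[OF assms] len_simple_mult_ge[OF assms] by linarith
qed

text \<open>Left multiplication by \<open>s\<close> changes the inversion set of \<open>x\<close> in
  a single reflection, \<open>x^-1 s x\<close>.\<close>

lemma exchange:
  assumes "s \<in> S" "x \<in> carrier G" "t \<in> refls"
    and "(len x < len (x \<otimes> t)) \<noteq> (len (s \<otimes> x) < len (s \<otimes> x \<otimes> t))"
  shows "s \<otimes> x = x \<otimes> t"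
proof -
  have "neg x t \<noteq> neg (s \<otimes> x) t"
    using assms not_neg_iff_len by (metis S_closed m_closed)
  then have "x \<otimes> t \<otimes> inv x = s"
    using neg_simple_mult assms by blast
  then have "s \<otimes> x = x \<otimes> t \<otimes> (inv x \<otimes> x)"
    using assms by (metis inv_closed m_assoc m_closed refl_closed)
  then show ?thesis using assms by simp
qed

text \<open>This independence of left and right descents makes left and right Hecke operators
  commute. For the second claim the left factor \<open>s\<close> is rewritten as the reflection
  \<open>t r t\<close> on the right of \<open>w t\<close>, where the cocycle applies.\<close>

lemma left_right_descents:
  assumes "s \<in> S" "t \<in> S" "w \<in> carrier G" "s \<otimes> w \<noteq> w \<otimes> t"
  shows "(len (s \<otimes> w) < len (s \<otimes> w \<otimes> t)) \<longleftrightarrow> (len w < len (w \<otimes> t))"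
    and "(len (w \<otimes> t) < len (s \<otimes> (w \<otimes> t))) \<longleftrightarrow> (len w < len (s \<otimes> w))"
proof -
  show "(len (s \<otimes> w) < len (s \<otimes> w \<otimes> t)) \<longleftrightarrow> (len w < len (w \<otimes> t))"
    using exchange[OF assms(1,3) simple_refl[OF assms(2)]] assms(4) by blast
  let ?r = "inv w \<otimes> s \<otimes> w"
  have r: "?r \<in> refls" "w \<otimes> ?r = s \<otimes> w" using left_as_refl assms by auto
  have tr: "t \<otimes> ?r \<otimes> t \<in> refls" using refl_conj[OF r(1), of t] assms by simp
  have "w \<otimes> t \<otimes> (t \<otimes> ?r \<otimes> t) = s \<otimes> (w \<otimes> t)"
    using assms r by (simp add: m_assoc[symmetric])
  then have "\<not> neg (w \<otimes> t) (t \<otimes> ?r \<otimes> t) \<longleftrightarrow> len (w \<otimes> t) < len (s \<otimes> (w \<otimes> t))"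
    using not_neg_iff_len[OF tr, of "w \<otimes> t"] assms by simp
  moreover have "t \<otimes> (t \<otimes> ?r \<otimes> t) \<otimes> inv t = ?r"
    using assms by (simp add: m_assoc S_involution)
  then have "neg (w \<otimes> t) (t \<otimes> ?r \<otimes> t) \<longleftrightarrow> neg t (t \<otimes> ?r \<otimes> t) \<noteq> neg w ?r"
    using neg_mult[of w t "t \<otimes> ?r \<otimes> t"] assms tr by simp
  moreover have "t \<otimes> ?r \<otimes> t \<noteq> t"
  proof
    assume "t \<otimes> ?r \<otimes> t = t"
    then have "t \<otimes> (t \<otimes> ?r \<otimes> t) \<otimes> t = t \<otimes> t \<otimes> t" by simp
    then have "?r = t" using assms by (simp add: m_assoc S_involution)
    then show False using r assms by simp
  qed
  then have "\<not> neg t (t \<otimes> ?r \<otimes> t)" using neg_simple[OF assms(2) tr] by simp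
  moreover have "\<not> neg w ?r \<longleftrightarrow> len w < len (s \<otimes> w)"
    using not_neg_iff_len[OF r(1) assms(3)] r(2) by simp
  ultimately show "(len (w \<otimes> t) < len (s \<otimes> (w \<otimes> t))) \<longleftrightarrow> (len w < len (s \<otimes> w))"
    by simp
qed

lemma ex_left_descent:
  assumes "w \<in> carrier G" "w \<noteq> \<one>"
  obtains s where "s \<in> S" "len (s \<otimes> w) < len w"
proof -
  obtain s ws where ws: "reduced_word G S w = s # ws"
    using reduced_word[OF assms(1)] assms(2) by (cases "reduced_word G S w") auto
  have s: "s \<in> S" "set ws \<subseteq> S" using reduced_word(1)[OF assms(1)] ws by auto
  have "s \<otimes> w = word_prod G ws"
    using reduced_word(2)[OF assms(1)] ws s by (metis simple_cancel_left word_prod_Cons word_prod_closed)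
  then have "len (s \<otimes> w) < len w"
    using len_le[OF s(2)] reduced_word(3)[OF assms(1)] ws by simp
  then show ?thesis using that s by blast
qed

text \<open>The hypothesis covers all elements not longer than \<open>v\<close>, because the
  Kazhdan-Lusztig recursion for \<open>s v\<close> refers to \<open>v\<close> and to further,
  shorter elements.\<close>

lemma len_induct [consumes 1, case_names one mult]:
  assumes "w \<in> carrier G" and "P \<one>"
    and "\<And>s v. s \<in> S \<Longrightarrow> v \<in> carrier G \<Longrightarrow> len v < len (s \<otimes> v) \<Longrightarrow>
          (\<And>x. x \<in> carrier G \<Longrightarrow> len x \<le> len v \<Longrightarrow> P x) \<Longrightarrow> P (s \<otimes> v)"
  shows "P w"
  using assms(1)
proof (induction "len w" arbitrary: w rule: less_induct)
  case less
  show ?case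
  proof (cases "w = \<one>")
    case False
    then obtain s where s: "s \<in> S" "len (s \<otimes> w) < len w" using ex_left_descent less by metis
    then have "P (s \<otimes> (s \<otimes> w))"
      using less by (intro assms(3)) auto
    then show ?thesis using s less by simp
  qed (use assms in simp)
qed

lemma finite_len_le: "finite {w \<in> carrier G. len w \<le> k}"
proof (rule finite_surj)
  show "finite {ws. set ws \<subseteq> S \<and> length ws \<le> k}"
    using finite_lists_length_le[OF finite_S] by simp
  show "{w \<in> carrier G. len w \<le> k} \<subseteq> word_prod G ` {ws. set ws \<subseteq> S \<and> length ws \<le> k}"
  proof
    fix w assume "w \<in> {w \<in> carrier G. len w \<le> k}"
    then show "w \<in> word_prod G ` {ws. set ws \<subseteq> S \<and> length ws \<le> k}"
      using reduced_word[of w] by (intro image_eqI[of _ _ "reduced_word G S w"]) auto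
  qed
qed

subsection \<open>Signs\<close>

lemma cox_sign_simple_mult: "s \<in> S \<Longrightarrow> w \<in> carrier G \<Longrightarrow> cox_sign G S (s \<otimes> w) = - cox_sign G S w"
  by (cases rule: len_simple_cases[of s w]) (simp_all add: cox_sign_def)

lemma cox_sign_mult: "x \<in> carrier G \<Longrightarrow> y \<in> carrier G \<Longrightarrow>
    cox_sign G S (x \<otimes> y) = cox_sign G S x * cox_sign G S y"
proof (induction rule: simple_induct)
  case one
  then show ?case by (simp add: cox_sign_def)
next
  case (mult s w)
  then show ?case by (simp add: cox_sign_simple_mult m_assoc)
qed

lemma cox_sign_square: "cox_sign G S w * cox_sign G S w = 1"
  by (simp add: cox_sign_def flip: power_mult_distrib)

lemma cox_sign_inv: "w \<in> carrier G \<Longrightarrow> cox_sign G S (inv w) = cox_sign G S w"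
proof -
  assume w: "w \<in> carrier G"
  have "cox_sign G S (inv w) * cox_sign G S w = 1"
    using cox_sign_mult[of "inv w" w] w by (simp add: cox_sign_def)
  then show ?thesis
    using cox_sign_square[of w] by (metis mult.assoc mult.commute mult_1)
qed

subsection \<open>The Bruhat order\<close>

lemma ble_refl [simp]: "w \<in> carrier G \<Longrightarrow> ble w w"
  by (simp add: bruhat_le_def)

lemma ble_trans [trans]: "ble x y \<Longrightarrow> ble y z \<Longrightarrow> ble x z"
  unfolding bruhat_le_def by (meson rtrancl_trans)

lemma ble_closed: "ble x y \<Longrightarrow> x \<in> carrier G" "ble x y \<Longrightarrow> y \<in> carrier G"
  by (simp_all add: bruhat_le_def)

lemma ble_step: "x \<in> carrier G \<Longrightarrow> t \<in> refls \<Longrightarrow> len x < len (x \<otimes> t) \<Longrightarrow> ble x (x \<otimes> t)"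
  unfolding bruhat_le_def by (auto intro!: r_into_rtrancl)

lemma ble_induct [consumes 1, case_names refl step]:
  assumes "ble x w" and "w \<in> carrier G \<Longrightarrow> P w"
    and "\<And>x t. x \<in> carrier G \<Longrightarrow> t \<in> refls \<Longrightarrow> len x < len (x \<otimes> t) \<Longrightarrow>
           ble (x \<otimes> t) w \<Longrightarrow> P (x \<otimes> t) \<Longrightarrow> P x"
  shows "P x"
proof -
  let ?R = "{(x, x \<otimes> t) | x t. x \<in> carrier G \<and> t \<in> refls \<and> len x < len (x \<otimes> t)}"
  have w: "w \<in> carrier G" and "(x, w) \<in> ?R\<^sup>*" using assms(1) by (auto simp: bruhat_le_def)
  from this(2) have "P x \<and> (x, w) \<in> ?R\<^sup>*"
  proof (induction rule: converse_rtrancl_induct)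
    case base
    then show ?case using assms(2) w by simp
  next
    case (step y z)
    then obtain t where t: "y \<in> carrier G" "t \<in> refls" "len y < len (y \<otimes> t)" "z = y \<otimes> t" by auto
    have "ble z w" using step w t by (simp add: bruhat_le_def)
    then show ?case using assms(3)[OF t(1-3)] t step by (auto intro: converse_rtrancl_into_rtrancl)
  qed
  then show ?thesis by simp
qed

lemma ble_len_less: "ble x w \<Longrightarrow> x \<noteq> w \<Longrightarrow> len x < len w"
proof (induction rule: ble_induct)
  case (step x t)
  then show ?case by (cases "x \<otimes> t = w") auto
qed simp

lemma ble_len_le: "ble x w \<Longrightarrow> len x \<le> len w"
  using ble_len_less by (cases "x = w") (auto simp: less_imp_le)

lemma finite_ble [simp]: "finite {y. ble y w}"
  by (rule finite_subset[OF _ finite_len_le[of "len w"]]) (auto dest: ble_len_le ble_closed)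

lemma ble_simple: "s \<in> S \<Longrightarrow> w \<in> carrier G \<Longrightarrow> len w < len (s \<otimes> w) \<Longrightarrow> ble w (s \<otimes> w)"
  using left_as_refl[of s w] ble_step[of w "inv w \<otimes> s \<otimes> w"] by simp

text \<open>Each step of a chain of reflections from \<open>x\<close> to \<open>w\<close> either
  survives left multiplication by \<open>s\<close> or satisfies \<open>s x = x t\<close>, and then
  \<open>s x\<close> is itself a member of the chain.\<close>

lemma ble_lift:
  assumes "ble x w" "s \<in> S" "len w < len (s \<otimes> w)"
  shows "ble (s \<otimes> x) (s \<otimes> w)"
  using assms(1)
proof (induction rule: ble_induct)
  case refl
  then show ?case using assms by simp
next
  case (step x t)
  show ?case
  proof (cases "s \<otimes> x = x \<otimes> t")
    case True
    then show ?thesis using step ble_simple[of s w] assms ble_trans ble_closed by metis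
  next
    case False
    then have "len (s \<otimes> x) < len (s \<otimes> x \<otimes> t)" using exchange[of s x t] step assms by blast
    then have "ble (s \<otimes> x) (s \<otimes> x \<otimes> t)" using step assms by (intro ble_step) auto
    then show ?thesis using step assms ble_trans by (simp add: m_assoc)
  qed
qed

lemma ble_lift': "ble x w \<Longrightarrow> s \<in> S \<Longrightarrow> len w < len (s \<otimes> w) \<Longrightarrow> ble x (s \<otimes> w)"
  using ble_trans ble_simple ble_closed by metis

subsection \<open>Minimal coset representatives\<close>

text \<open>Suppose \<open>w\<close> and \<open>w y\<close> are both minimal. The last letter
  \<open>s\<close> of a shortest word for a nontrivial \<open>y\<close> is inverted by
  \<open>y\<close> but not by \<open>w y\<close>, so by the cocycle rule \<open>w\<close> inverts
  \<open>y s y^-1\<close>, which leads to a shorter element of the same coset.\<close>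

lemma min_coset_rep_unique:
  assumes J: "J \<subseteq> S" and w: "w \<in> carrier G" and ys: "set ys \<subseteq> J"
    and min: "\<And>zs. set zs \<subseteq> J \<Longrightarrow> len w \<le> len (w \<otimes> word_prod G zs)"
    and min': "\<And>zs. set zs \<subseteq> J \<Longrightarrow>
      len (w \<otimes> word_prod G ys) \<le> len (w \<otimes> word_prod G ys \<otimes> word_prod G zs)"
  shows "word_prod G ys = \<one>"
proof -
  \<comment> \<open>Minimality is meant among words in \<open>J\<close>; deletion produces such
    words again.\<close>
  have "\<exists>zs. (set zs \<subseteq> J \<and> word_prod G zs = word_prod G ys) \<and>
      (\<forall>us. set us \<subseteq> J \<and> word_prod G us = word_prod G ys \<longrightarrow> length zs \<le> length us)"
    using ys ex_has_least_nat[of "\<lambda>us. set us \<subseteq> J \<and> word_prod G us = word_prod G ys" ys length] by blast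
  then obtain zs where zs: "set zs \<subseteq> J" "word_prod G zs = word_prod G ys"
    and short: "\<And>us. set us \<subseteq> J \<Longrightarrow> word_prod G us = word_prod G ys \<Longrightarrow> length zs \<le> length us"
    by blast
  show ?thesis
  proof (cases zs rule: rev_cases)
    case Nil
    then show ?thesis using zs by simp
  next
    case (snoc us s)
    let ?u = "word_prod G us" and ?y = "word_prod G ys"
    have us: "set us \<subseteq> J" "s \<in> J" "set us \<subseteq> S" "s \<in> S" using snoc zs J by auto
    have y: "?y = ?u \<otimes> s" using zs(2) snoc us by simp
    have yc: "?y \<in> carrier G" "?u \<in> carrier G" using us y by auto
    have s: "s \<in> refls" using us simple_refl by simp
    have "\<not> neg ?u s"
    proof
      assume "neg ?u s"
      then obtain i where i: "i < length us" "?y = word_prod G (take i us @ drop (Suc i) us)"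
        using neg_deletion[OF us(3) s] y by auto
      have "set (take i us @ drop (Suc i) us) \<subseteq> J"
        using us(1) set_take_subset[of i us] set_drop_subset[of "Suc i" us] by auto
      from short[OF this] i snoc show False by simp
    qed
    then have n: "neg ?y s" using y neg_mult_self[OF s, of ?u] us by simp
    have "\<not> neg (w \<otimes> ?y) s"
      using min'[of "[s]"] us neg_iff_len[OF s, of "w \<otimes> ?y"] w yc by simp
    then have "neg w (?y \<otimes> s \<otimes> inv ?y)"
      using n neg_mult[OF w yc(1) s] by simp
    then have "len (w \<otimes> (?y \<otimes> s \<otimes> inv ?y)) < len w"
      using neg_iff_len[OF refl_conj[OF s yc(1)] w] by simp
    moreover have "?y \<otimes> s \<otimes> inv ?y = word_prod G (zs @ s # rev zs)"
    proof -
      have "set zs \<subseteq> S" using zs J by blast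
      then show ?thesis using us yc zs(2) word_prod_rev[of zs] by (simp add: m_assoc)
    qed
    ultimately show ?thesis using min[of "zs @ s # rev zs"] zs us by simp
  qed
qed

end

section \<open>Hecke algebras and Kazhdan--Lusztig bases\<close>

subsection \<open>Free modules and Laurent polynomials\<close>

abbreviation (input) lu :: "('a \<Rightarrow>\<^sub>0 'b::zero) \<Rightarrow> 'a \<Rightarrow> 'b" where
  "lu \<equiv> Poly_Mapping.lookup"

abbreviation (input) sg :: "'a \<Rightarrow> 'b::zero \<Rightarrow> 'a \<Rightarrow>\<^sub>0 'b" where
  "sg \<equiv> Poly_Mapping.single"

lemma lookup_not_key: "Poly_Mapping.keys h \<subseteq> C \<Longrightarrow> y \<notin> C \<Longrightarrow> lu h y = 0"
  by (auto simp: in_keys_iff)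

lemma keys_subsetI: "(\<And>y. y \<notin> C \<Longrightarrow> lu h y = 0) \<Longrightarrow> Poly_Mapping.keys h \<subseteq> C"
  by (auto simp: in_keys_iff)

lemma poly_mapping_sum_singles: "h = (\<Sum>w\<in>Poly_Mapping.keys h. sg w (lu h w))"
  by (rule poly_mapping_eqI)
     (simp add: lookup_sum lookup_single when_def in_keys_iff)

text \<open>Additivity instead of linearity lets this serve the semilinear bar involution and the
  evaluation at 1 as well. The set \<open>C\<close> is there because the group is only a part of its
  type.\<close>

lemma additive_ext:
  fixes F F' :: "('a \<Rightarrow>\<^sub>0 'r::comm_monoid_add) \<Rightarrow> 'm::ab_group_add"
  assumes "\<And>h g. F (h + g) = F h + F g" "\<And>h g. F' (h + g) = F' h + F' g"
    and "\<And>w c. w \<in> C \<Longrightarrow> F (sg w c) = F' (sg w c)" "Poly_Mapping.keys h \<subseteq> C"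
  shows "F h = F' h"
proof -
  have sum: "P (sum g A) = (\<Sum>x\<in>A. P (g x))"
    if P: "\<And>h g. P (h + g) = P h + P g" and "finite A"
    for P :: "('a \<Rightarrow>\<^sub>0 'r) \<Rightarrow> 'm" and g :: "'a \<Rightarrow> ('a \<Rightarrow>\<^sub>0 'r)" and A
  proof -
    have "P 0 = 0" using P[of 0 0] by simp
    with \<open>finite A\<close> show ?thesis by (induction A rule: finite_induct) (simp_all add: P)
  qed
  have "F (\<Sum>w\<in>Poly_Mapping.keys h. sg w (lu h w)) = F' (\<Sum>w\<in>Poly_Mapping.keys h. sg w (lu h w))"
    unfolding sum[of F, OF assms(1) finite_keys] sum[of F', OF assms(2) finite_keys]
    by (rule sum.cong) (use assms(3,4) in auto)
  then show ?thesis using poly_mapping_sum_singles[of h] by simp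
qed

lemma lookup_scal [simp]: "lu (scal c h) w = c * lu h w"
  by (simp add: scal_def Poly_Mapping.map.rep_eq when_def)

lemma scal_simps [simp]:
  fixes h :: "'a \<Rightarrow>\<^sub>0 'r::comm_ring_1"
  shows "scal 1 h = h" "scal 0 h = 0" "scal c (0 :: 'a \<Rightarrow>\<^sub>0 'r) = 0"
    "scal c (scal d h) = scal (c * d) h" "scal c (sg w d) = sg w (c * d)"
  by (auto intro!: poly_mapping_eqI simp: mult.assoc lookup_single when_def)

lemma scal_distrib:
  fixes h g :: "'a \<Rightarrow>\<^sub>0 'r::comm_ring_1"
  shows "scal c (h + g) = scal c h + scal c g" "scal c (h - g) = scal c h - scal c g"
    "scal (c + d) h = scal c h + scal d h" "scal (c - d) h = scal c h - scal d h"
    "scal c (- h) = - scal c h" "scal (- c) h = - scal c h"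
  by (auto intro!: poly_mapping_eqI simp: algebra_simps lookup_add lookup_minus)

lemma scal_sum:
  fixes h :: "'b \<Rightarrow> ('a \<Rightarrow>\<^sub>0 'r::comm_ring_1)"
  shows "scal c (sum h A) = (\<Sum>x\<in>A. scal c (h x))"
  by (rule poly_mapping_eqI) (simp add: lookup_sum sum_distrib_left)

lemma keys_scal: "Poly_Mapping.keys (scal c h) \<subseteq> Poly_Mapping.keys (h :: 'a \<Rightarrow>\<^sub>0 'r::comm_ring_1)"
  by (auto simp: in_keys_iff)

lemma lin_ext_superset:
  assumes "\<phi> 0 = 0" "finite K" "Poly_Mapping.keys h \<subseteq> K"
  shows "lin_ext \<phi> f h = (\<Sum>w\<in>K. scal (\<phi> (lu h w)) (f w))"
  unfolding lin_ext_def
  by (rule sum.mono_neutral_left) (use assms in \<open>auto simp: in_keys_iff\<close>)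

lemma lin_ext_add:
  assumes "\<And>a b. \<phi> (a + b) = \<phi> a + \<phi> b"
  shows "lin_ext \<phi> f (h + g) = lin_ext \<phi> f h + lin_ext \<phi> f g"
proof -
  let ?K = "Poly_Mapping.keys h \<union> Poly_Mapping.keys g"
  have "\<phi> 0 = 0" using assms[of 0 0] by simp
  from lin_ext_superset[of \<phi> ?K _ f, OF this] show ?thesis
    using keys_add[of h g] by (simp add: lookup_add assms scal_distrib sum.distrib)
qed

lemma lin_ext_single:
  assumes "\<phi> 0 = 0"
  shows "lin_ext \<phi> f (sg w c) = scal (\<phi> c) (f w)"
  using lin_ext_superset[of \<phi> "{w}" "sg w c" f] assms by auto

lemma lin_ext_scal:
  assumes "\<phi> 0 = 0" "\<And>a b. \<phi> (a * b) = \<phi> a * \<phi> b"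
  shows "lin_ext \<phi> f (scal c h) = scal (\<phi> c) (lin_ext \<phi> f h)"
  using lin_ext_superset[of \<phi> "Poly_Mapping.keys h" "scal c h" f] keys_scal[of c h] assms
  by (simp add: scal_sum lin_ext_def)

lemma qhalf_mult [simp]: "qhalf j * qhalf k = qhalf (j + k)"
  by (simp add: qhalf_def mult_single)

lemma qhalf_0 [simp]: "qhalf 0 = 1"
  by (simp add: qhalf_def)

lemma qhalf_mult_left [simp]: "qhalf j * (qhalf k * f) = qhalf (j + k) * f"
  by (simp flip: mult.assoc)

lemma lookup_qhalf_mult [simp]: "lu (qhalf k * f) j = lu f (j - k)"
proof -
  have "(\<lambda>f. lu (qhalf k * f) j) f = (\<lambda>f. lu f (j - k)) f"
    by (rule additive_ext[where C = UNIV])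
       (auto simp: lookup_add algebra_simps qhalf_def mult_single lookup_single when_def)
  then show ?thesis .
qed

lemma lookup_of_int_mult [simp]: "lu (of_int c * f) j = c * lu (f :: laurent) j"
proof -
  have "(\<lambda>f. lu (of_int c * f) j) f = (\<lambda>f. c * lu f j) f"
    by (rule additive_ext[where C = UNIV])
       (auto simp: lookup_add algebra_simps mult_single lookup_single when_def
         simp flip: single_of_int)
  then show ?thesis .
qed

lemma lookup_laurent_bar [simp]: "lu (laurent_bar f) k = lu f (- k)"
  by (simp add: laurent_bar_def Poly_Mapping.map_key.rep_eq)

lemma laurent_bar_simps [simp]:
  "laurent_bar (f + g) = laurent_bar f + laurent_bar g"
  "laurent_bar (f - g) = laurent_bar f - laurent_bar g"
  "laurent_bar (qhalf k * f) = qhalf (- k) * laurent_bar f"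
  "laurent_bar (of_int c * f) = of_int c * laurent_bar f"
  "laurent_bar 0 = 0" "laurent_bar 1 = 1"
  by (auto intro!: poly_mapping_eqI simp: lookup_add lookup_minus lookup_one when_def minus_add_distrib)

subsection \<open>The Hecke algebra\<close>

text \<open>Length and involution are parameters so that left and right multiplication by a simple
  reflection are two instances; the right operators serve to prove facts about the left
  ones.\<close>

definition hecke_op :: "('a \<Rightarrow> nat) \<Rightarrow> ('a \<Rightarrow> 'a) \<Rightarrow> ('a \<Rightarrow>\<^sub>0 laurent) \<Rightarrow> ('a \<Rightarrow>\<^sub>0 laurent)" where
  "hecke_op l \<sigma> = lin_ext id (\<lambda>w. if l w < l (\<sigma> w) then sg (\<sigma> w) 1
     else sg (\<sigma> w) q_var + sg w (q_var - 1))"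

definition hecke_op_inv :: "('a \<Rightarrow> nat) \<Rightarrow> ('a \<Rightarrow> 'a) \<Rightarrow> ('a \<Rightarrow>\<^sub>0 laurent) \<Rightarrow> ('a \<Rightarrow>\<^sub>0 laurent)" where
  "hecke_op_inv l \<sigma> h = scal q_inv (hecke_op l \<sigma> h) - scal (1 - q_inv) h"

lemma hecke_op_add: "hecke_op l \<sigma> (h + g) = hecke_op l \<sigma> h + hecke_op l \<sigma> g"
  by (simp add: hecke_op_def lin_ext_add)

lemma hecke_op_scal: "hecke_op l \<sigma> (scal c h) = scal c (hecke_op l \<sigma> h)"
  by (simp add: hecke_op_def lin_ext_scal)

lemma hecke_op_diff: "hecke_op l \<sigma> (h - g) = hecke_op l \<sigma> h - hecke_op l \<sigma> g"
  using hecke_op_add[of l \<sigma> "h - g" g] by simp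

lemma hecke_op_inv_add: "hecke_op_inv l \<sigma> (h + g) = hecke_op_inv l \<sigma> h + hecke_op_inv l \<sigma> g"
  by (simp add: hecke_op_inv_def hecke_op_add scal_distrib)

lemma hecke_op_inv_scal: "hecke_op_inv l \<sigma> (scal c h) = scal c (hecke_op_inv l \<sigma> h)"
  by (rule poly_mapping_eqI) (simp add: hecke_op_inv_def hecke_op_scal lookup_minus algebra_simps)

lemma hecke_op_inv_diff: "hecke_op_inv l \<sigma> (h - g) = hecke_op_inv l \<sigma> h - hecke_op_inv l \<sigma> g"
  using hecke_op_inv_add[of l \<sigma> "h - g" g] by simp

lemma hecke_op_single: "hecke_op l \<sigma> (sg w c) = (if l w < l (\<sigma> w) then sg (\<sigma> w) c
     else sg (\<sigma> w) (c * q_var) + sg w (c * (q_var - 1)))"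
  by (simp add: hecke_op_def lin_ext_single scal_distrib)

text \<open>The operator preserves the span of each pair \<open>w\<close>,
  \<open>\<sigma> w\<close>, so everything reduces to 2 by 2 matrices; \<open>len_neq\<close> tells
  which member of the pair is the upper one.\<close>

locale length_involution =
  fixes C :: "'a set" and l :: "'a \<Rightarrow> nat" and \<sigma> :: "'a \<Rightarrow> 'a"
  assumes closed [simp]: "w \<in> C \<Longrightarrow> \<sigma> w \<in> C"
    and invol [simp]: "w \<in> C \<Longrightarrow> \<sigma> (\<sigma> w) = w"
    and len_neq: "w \<in> C \<Longrightarrow> l (\<sigma> w) \<noteq> l w"
begin

lemma lookup_op:
  assumes h: "Poly_Mapping.keys h \<subseteq> C" and y: "y \<in> C"
  shows "lu (hecke_op l \<sigma> h) y =
    (if l y < l (\<sigma> y) then q_var * lu h (\<sigma> y) else lu h (\<sigma> y) + (q_var - 1) * lu h y)"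
proof -
  let ?K = "Poly_Mapping.keys h \<union> {y, \<sigma> y}"
  let ?a = "if l y < l (\<sigma> y) then q_var else 1"
  let ?b = "if l y < l (\<sigma> y) then 0 else q_var - 1"
  have K: "finite ?K" "Poly_Mapping.keys h \<subseteq> ?K" "?K \<subseteq> C" using h y by auto
  have "lu (hecke_op l \<sigma> h) y = (\<Sum>w\<in>?K. lu h w * lu (if l w < l (\<sigma> w) then sg (\<sigma> w) 1
     else sg (\<sigma> w) q_var + sg w (q_var - 1)) y)"
    unfolding hecke_op_def by (subst lin_ext_superset[OF _ K(1,2)]) (simp_all add: lookup_sum)
  also have "\<dots> = (\<Sum>w\<in>?K. (if w = \<sigma> y then lu h w * ?a else 0) + (if w = y then lu h w * ?b else 0))"
  proof (rule sum.cong)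
    fix w assume "w \<in> ?K"
    then have w: "w \<in> C" using K by blast
    then have "\<sigma> w = y \<longleftrightarrow> w = \<sigma> y" using y invol by metis
    moreover have "l (\<sigma> y) \<noteq> l y" "w = \<sigma> y \<Longrightarrow> \<sigma> w = y" "\<sigma> y \<noteq> y" using len_neq[of y] y by auto
    ultimately show "lu h w * lu (if l w < l (\<sigma> w) then sg (\<sigma> w) 1
       else sg (\<sigma> w) q_var + sg w (q_var - 1)) y =
      (if w = \<sigma> y then lu h w * ?a else 0) + (if w = y then lu h w * ?b else 0)"
      by (auto simp: lookup_add lookup_single when_def)
  qed simp
  also have "\<dots> = lu h (\<sigma> y) * ?a + lu h y * ?b"
    using K(1) by (simp add: sum.distrib)
  finally show ?thesis by (simp add: mult.commute)
qed

lemma keys_op: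
  assumes "Poly_Mapping.keys h \<subseteq> C"
  shows "Poly_Mapping.keys (hecke_op l \<sigma> h) \<subseteq> C"
proof (rule keys_subsetI)
  fix y assume y: "y \<notin> C"
  have "w \<noteq> y \<and> \<sigma> w \<noteq> y" if "w \<in> Poly_Mapping.keys h" for w
    using that assms y closed by blast
  then show "lu (hecke_op l \<sigma> h) y = 0"
    unfolding hecke_op_def lin_ext_def lookup_sum
    by (intro sum.neutral) (auto simp: lookup_add lookup_single when_def)
qed

lemma keys_op_inv:
  assumes "Poly_Mapping.keys h \<subseteq> C"
  shows "Poly_Mapping.keys (hecke_op_inv l \<sigma> h) \<subseteq> C"
  using keys_op[OF assms] assms
  by (intro keys_subsetI) (simp add: hecke_op_inv_def lookup_minus lookup_not_key)

lemma lookup_op_inv: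
  assumes h: "Poly_Mapping.keys h \<subseteq> C" and y: "y \<in> C"
  shows "lu (hecke_op_inv l \<sigma> h) y =
    (if l y < l (\<sigma> y) then lu h (\<sigma> y) - (1 - q_inv) * lu h y else q_inv * lu h (\<sigma> y))"
  using lookup_op[OF assms] by (simp add: hecke_op_inv_def lookup_minus algebra_simps)

lemma op_op_inv [simp]:
  assumes h: "Poly_Mapping.keys h \<subseteq> C"
  shows "hecke_op l \<sigma> (hecke_op_inv l \<sigma> h) = h" "hecke_op_inv l \<sigma> (hecke_op l \<sigma> h) = h"
proof -
  show "hecke_op l \<sigma> (hecke_op_inv l \<sigma> h) = h"
  proof (rule poly_mapping_eqI)
    fix y show "lu (hecke_op l \<sigma> (hecke_op_inv l \<sigma> h)) y = lu h y"
      using len_neq[of y] lookup_not_key[OF h, of y] lookup_not_key[OF keys_op, OF keys_op_inv, OF h]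
      by (cases "y \<in> C")
        (auto simp: lookup_op lookup_op_inv keys_op_inv h algebra_simps not_less)
  qed
  show "hecke_op_inv l \<sigma> (hecke_op l \<sigma> h) = h"
  proof (rule poly_mapping_eqI)
    fix y show "lu (hecke_op_inv l \<sigma> (hecke_op l \<sigma> h)) y = lu h y"
      using len_neq[of y] lookup_not_key[OF h, of y] lookup_not_key[OF keys_op_inv, OF keys_op, OF h]
      by (cases "y \<in> C")
        (auto simp: lookup_op lookup_op_inv keys_op h algebra_simps not_less)
  qed
qed

end

lemma hecke_T_eq: "hecke_T G S s = hecke_op (cox_length G S) (\<lambda>w. s \<otimes>\<^bsub>G\<^esub> w)"
  by (simp add: hecke_T_def hecke_op_def)

lemma hecke_T_inv_eq: "hecke_T_inv G S s = hecke_op_inv (cox_length G S) (\<lambda>w. s \<otimes>\<^bsub>G\<^esub> w)"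
  by (rule ext) (simp add: hecke_T_inv_def hecke_op_inv_def hecke_T_eq)

context coxeter_cocycle
begin

section \<open>Commuting left and right operators\<close>

abbreviation "carr h \<equiv> Poly_Mapping.keys (h :: 'a \<Rightarrow>\<^sub>0 laurent) \<subseteq> carrier G"
abbreviation "T \<equiv> hecke_T G S"
abbreviation "Ti \<equiv> hecke_T_inv G S"
abbreviation "R t \<equiv> hecke_op len (\<lambda>w. w \<otimes> t)"
abbreviation "Ri t \<equiv> hecke_op_inv len (\<lambda>w. w \<otimes> t)"

lemma left_involution: "s \<in> S \<Longrightarrow> length_involution (carrier G) len (\<lambda>w. s \<otimes> w)"
proof
  show "len (s \<otimes> w) \<noteq> len w" if "s \<in> S" "w \<in> carrier G" for w
    using that by (cases rule: len_simple_cases[of s w]) auto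
qed auto

lemma right_involution: "s \<in> S \<Longrightarrow> length_involution (carrier G) len (\<lambda>w. w \<otimes> s)"
  by unfold_locales (auto simp: simple_refl len_refl_neq)

lemmas lookup_T = length_involution.lookup_op[OF left_involution, folded hecke_T_eq]
lemmas lookup_R = length_involution.lookup_op[OF right_involution]
lemmas keys_T [simp] = length_involution.keys_op[OF left_involution, folded hecke_T_eq]
lemmas keys_Ti [simp] = length_involution.keys_op_inv[OF left_involution, folded hecke_T_inv_eq]
lemmas keys_R [simp] = length_involution.keys_op[OF right_involution]
lemmas keys_Ri [simp] = length_involution.keys_op_inv[OF right_involution]
lemmas T_Ti [simp] = length_involution.op_op_inv[OF left_involution, folded hecke_T_eq hecke_T_inv_eq]

text \<open>If \<open>s y = y t\<close>, both operators act on the pair \<open>y\<close>,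
  \<open>s y\<close> by the same matrix. Otherwise \<open>y\<close>, \<open>s y\<close>,
  \<open>y t\<close>, \<open>s y t\<close> are distinct with independent left and right descents,
  and the operators act on separate factors.\<close>

lemma T_R_commute:
  assumes s: "s \<in> S" and t: "t \<in> S" and h: "carr h"
  shows "T s (R t h) = R t (T s h)"
proof (rule poly_mapping_eqI)
  fix y
  show "lu (T s (R t h)) y = lu (R t (T s h)) y"
  proof (cases "y \<in> carrier G")
    case False
    then show ?thesis
      using lookup_not_key[OF keys_T[OF s keys_R[OF t h]]] lookup_not_key[OF keys_R[OF t keys_T[OF s h]]]
      by simp
  next
    case y: True
    note lk = lookup_T[OF s] lookup_R[OF t] keys_T[OF s] keys_R[OF t] h s t y
    show ?thesis
    proof (cases "s \<otimes> y = y \<otimes> t")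
      case True
      have yt: "y \<otimes> t = s \<otimes> y" "s \<otimes> y \<otimes> t = y" using True t y by simp_all
      show ?thesis by (simp add: lk yt)
    next
      case False
      have a: "s \<otimes> y \<otimes> t = s \<otimes> (y \<otimes> t)" using s t y by (simp add: m_assoc)
      note d = left_right_descents[OF s t y False]
      show ?thesis using d by (simp add: lk a algebra_simps)
    qed
  qed
qed

lemma T_Ri_commute: "s \<in> S \<Longrightarrow> t \<in> S \<Longrightarrow> carr h \<Longrightarrow> T s (Ri t h) = Ri t (T s h)"
  using T_R_commute[of s t h]
  by (simp add: hecke_op_inv_def hecke_T_eq hecke_op_scal hecke_op_diff)

lemma Ti_Ri_commute: "s \<in> S \<Longrightarrow> t \<in> S \<Longrightarrow> carr h \<Longrightarrow> Ti s (Ri t h) = Ri t (Ti s h)"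
  using T_Ri_commute[of s t h]
  by (simp add: hecke_T_inv_def hecke_op_inv_diff hecke_op_inv_scal)

lemma keys_fold_T: "set ws \<subseteq> S \<Longrightarrow> carr h \<Longrightarrow> carr (fold T ws h)"
  by (induction ws arbitrary: h) auto

lemma keys_foldr_Ti: "set ws \<subseteq> S \<Longrightarrow> carr h \<Longrightarrow> carr (foldr Ti ws h)"
  by (induction ws arbitrary: h) auto

lemma T_fold_Ri: "set ws \<subseteq> S \<Longrightarrow> s \<in> S \<Longrightarrow> carr h \<Longrightarrow> T s (fold Ri ws h) = fold Ri ws (T s h)"
  by (induction ws arbitrary: h) (auto simp: T_Ri_commute)

lemma Ti_fold_Ri: "set ws \<subseteq> S \<Longrightarrow> s \<in> S \<Longrightarrow> carr h \<Longrightarrow> Ti s (fold Ri ws h) = fold Ri ws (Ti s h)"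
  by (induction ws arbitrary: h) (auto simp: Ti_Ri_commute)

lemma fold_T_fold_Ri: "set us \<subseteq> S \<Longrightarrow> set ws \<subseteq> S \<Longrightarrow> carr h \<Longrightarrow>
    fold T us (fold Ri ws h) = fold Ri ws (fold T us h)"
  by (induction us arbitrary: h) (auto simp: T_fold_Ri)

lemma fold_T_foldr_Ti: "set ws \<subseteq> S \<Longrightarrow> carr h \<Longrightarrow> fold T ws (foldr Ti ws h) = h"
  by (induction ws arbitrary: h) (auto simp: keys_foldr_Ti)

lemma foldr_Ti_fold_T: "set ws \<subseteq> S \<Longrightarrow> carr h \<Longrightarrow> foldr Ti ws (fold T ws h) = h"
  by (induction ws arbitrary: h) (auto simp: keys_fold_T)

lemma T_single_up: "len w < len (s \<otimes> w) \<Longrightarrow> T s (sg w c) = sg (s \<otimes> w) c"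
  by (simp add: hecke_T_eq hecke_op_single)

lemma Ti_one: "s \<in> S \<Longrightarrow> Ti s (sg \<one> 1) = Ri s (sg \<one> 1)"
  by (simp add: hecke_T_inv_eq hecke_op_inv_def hecke_op_single)

lemma foldr_Ti_one: "set ws \<subseteq> S \<Longrightarrow> foldr Ti ws (sg \<one> 1) = fold Ri ws (sg \<one> 1)"
  by (induction ws) (auto simp: Ti_fold_Ri Ti_one)

lemma foldr_T_reduced: "set ws \<subseteq> S \<Longrightarrow> len (word_prod G ws) = length ws \<Longrightarrow>
    foldr T ws (sg \<one> 1) = sg (word_prod G ws) 1"
proof (induction ws)
  case (Cons s ws)
  then have "len (word_prod G ws) = length ws"
    using len_simple_mult_le[of s "word_prod G ws"] len_le[of ws] by auto
  then show ?case using Cons by (simp add: T_single_up)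
qed simp

lemma len_inv: "w \<in> carrier G \<Longrightarrow> len (inv w) = len w"
proof -
  have le: "len (inv w) \<le> len w" if "w \<in> carrier G" for w
    using len_le[of "rev (reduced_word G S w)"] reduced_word[OF that] word_prod_rev by simp
  assume "w \<in> carrier G"
  then show ?thesis using le[of w] le[of "inv w"] by simp
qed

text \<open>Applied to the unit, the left inverses along \<open>us\<close> become right inverses,
  which commute with every \<open>T\<close>. The operators \<open>T\<close> along \<open>us\<close>
  and along \<open>ws\<close> both take the unit to the basis element of the inverse, hence agree on
  \<open>?x\<close>. Along \<open>us\<close> they return the unit, so along \<open>ws\<close> they
  do too, and \<open>Ti\<close> along \<open>ws\<close> undoes this.\<close>

lemma foldr_Ti_reduced_unique:
  assumes us: "set us \<subseteq> S" and ws: "set ws \<subseteq> S" and eq: "word_prod G us = word_prod G ws"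
    and red: "length us = len (word_prod G ws)" "length ws = len (word_prod G ws)"
  shows "foldr Ti us (sg \<one> 1) = foldr Ti ws (sg \<one> 1)"
proof -
  let ?e = "sg \<one> 1 :: 'a \<Rightarrow>\<^sub>0 laurent" and ?w = "word_prod G ws"
  let ?x = "foldr Ti us ?e"
  have e: "carr ?e" by simp
  have inv_T: "fold T vs ?e = sg (inv ?w) 1"
    if "set vs \<subseteq> S" "word_prod G vs = ?w" "length vs = len ?w" for vs
    using foldr_T_reduced[of "rev vs"] that word_prod_rev[of vs] ws
    by (simp add: foldr_conv_fold len_inv)
  have "fold T vs ?x = fold Ri us (sg (inv ?w) 1)"
    if "set vs \<subseteq> S" "word_prod G vs = ?w" "length vs = len ?w" for vs
    using that us e inv_T[of vs] by (simp add: foldr_Ti_one fold_T_fold_Ri)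
  from this[of us] this[of ws] have "fold T ws ?x = fold T us ?x"
    using us ws eq red by simp
  also have "\<dots> = ?e" using fold_T_foldr_Ti[OF us e] .
  finally have "foldr Ti ws (fold T ws ?x) = foldr Ti ws ?e" by simp
  then show ?thesis
    using foldr_Ti_fold_T[OF ws keys_foldr_Ti[OF us e]] by simp
qed

section \<open>The bar involution\<close>

definition bar_T :: "'a \<Rightarrow> ('a \<Rightarrow>\<^sub>0 laurent)" where
  "bar_T w = foldr Ti (reduced_word G S w) (sg \<one> 1)"

lemma keys_bar_T [simp]: "w \<in> carrier G \<Longrightarrow> carr (bar_T w)"
  using reduced_word[of w] by (simp add: bar_T_def keys_foldr_Ti)

lemma bar_T_one: "bar_T \<one> = sg \<one> 1"
  using reduced_word[of \<one>] by (simp add: bar_T_def)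

lemma bar_T_up:
  assumes s: "s \<in> S" and w: "w \<in> carrier G" and l: "len w < len (s \<otimes> w)"
  shows "bar_T (s \<otimes> w) = Ti s (bar_T w)"
proof -
  have "len (s \<otimes> w) = Suc (len w)" using len_simple_mult_le[OF s w] l by simp
  then have "foldr Ti (reduced_word G S (s \<otimes> w)) (sg \<one> 1) =
      foldr Ti (s # reduced_word G S w) (sg \<one> 1)"
    using s w reduced_word[OF w] reduced_word[of "s \<otimes> w"]
    by (intro foldr_Ti_reduced_unique) auto
  then show ?thesis by (simp add: bar_T_def)
qed

lemma hecke_bar_eq: "hecke_bar G S = lin_ext laurent_bar bar_T"
  by (simp add: hecke_bar_def bar_T_def[abs_def])

lemma hecke_bar_add: "hecke_bar G S (h + g) = hecke_bar G S h + hecke_bar G S g"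
  by (simp add: hecke_bar_eq lin_ext_add)

lemma hecke_bar_diff: "hecke_bar G S (h - g) = hecke_bar G S h - hecke_bar G S g"
  using hecke_bar_add[of "h - g" g] by simp

lemma hecke_bar_single: "hecke_bar G S (sg w c) = scal (laurent_bar c) (bar_T w)"
  by (simp add: hecke_bar_eq lin_ext_single)

lemma hecke_bar_sum: "hecke_bar G S (sum h A) = (\<Sum>x\<in>A. hecke_bar G S (h x))"
proof (cases "finite A")
  case True
  have "hecke_bar G S 0 = 0" using hecke_bar_add[of 0 0] by simp
  with True show ?thesis by (induction A rule: finite_induct) (auto simp: hecke_bar_add)
qed (use hecke_bar_add[of 0 0] in simp)

lemma hecke_bar_scal_aux:
  assumes "\<And>f. laurent_bar (c * f) = d * laurent_bar f"
  shows "hecke_bar G S (scal c h) = scal d (hecke_bar G S h)"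
  unfolding hecke_bar_eq
  using lin_ext_superset[of laurent_bar "Poly_Mapping.keys h" "scal c h" bar_T] keys_scal[of c h] assms
  by (simp add: scal_sum lin_ext_def)

lemma hecke_bar_scal:
  "hecke_bar G S (scal (qhalf k) h) = scal (qhalf (- k)) (hecke_bar G S h)"
  "hecke_bar G S (scal (of_int c) h) = scal (of_int c) (hecke_bar G S h)"
  by (rule hecke_bar_scal_aux, simp)+

text \<open>On basis elements going up this is the recursion for \<open>bar_T\<close>; going down,
  the bar of the quadratic relation is the formula for the inverse of \<open>T\<close>.\<close>

lemma hecke_bar_T:
  assumes s: "s \<in> S" and h: "carr h"
  shows "hecke_bar G S (T s h) = Ti s (hecke_bar G S h)"
proof -
  have "(\<lambda>h. hecke_bar G S (T s h)) h = (\<lambda>h. Ti s (hecke_bar G S h)) h"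
  proof (rule additive_ext[OF _ _ _ h])
    fix w c assume w: "w \<in> carrier G"
    show "hecke_bar G S (T s (sg w c)) = Ti s (hecke_bar G S (sg w c))"
    proof (cases rule: len_simple_cases[OF s w])
      case 1
      then show ?thesis
        by (simp add: T_single_up hecke_bar_single bar_T_up[OF s w] hecke_T_inv_eq hecke_op_inv_scal)
    next
      case 2
      have "bar_T w = Ti s (bar_T (s \<otimes> w))" using bar_T_up[of s "s \<otimes> w"] 2 s w by simp
      then have Tw: "T s (bar_T w) = bar_T (s \<otimes> w)" using s w by simp
      have "T s (sg w c) = sg (s \<otimes> w) (c * q_var) + sg w (c * (q_var - 1))"
        using 2 by (simp add: hecke_T_eq hecke_op_single)
      moreover have "laurent_bar (c * q_var) = q_inv * laurent_bar c"
        "laurent_bar (c * (q_var - 1)) = (q_inv - 1) * laurent_bar c"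
        using laurent_bar_simps(3)[of 2 c] by (simp_all add: mult.commute right_diff_distrib left_diff_distrib)
      ultimately have "hecke_bar G S (T s (sg w c)) =
          scal (q_inv * laurent_bar c) (bar_T (s \<otimes> w)) + scal ((q_inv - 1) * laurent_bar c) (bar_T w)"
        by (simp add: hecke_bar_add hecke_bar_single)
      also have "\<dots> = scal (laurent_bar c) (Ti s (bar_T w))"
        using Tw by (simp add: hecke_T_inv_def algebra_simps scal_distrib)
      also have "\<dots> = Ti s (hecke_bar G S (sg w c))"
        by (simp add: hecke_bar_single hecke_T_inv_eq hecke_op_inv_scal)
      finally show ?thesis .
    qed
  qed (simp_all add: hecke_T_eq hecke_T_inv_eq hecke_op_add hecke_op_inv_add hecke_bar_add)
  then show ?thesis .
qed

text \<open>Left multiplication by the Kazhdan-Lusztig element of the simple reflection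
  \<open>s\<close>.\<close>

definition kl_mult :: "'a \<Rightarrow> ('a \<Rightarrow>\<^sub>0 laurent) \<Rightarrow> ('a \<Rightarrow>\<^sub>0 laurent)" where
  "kl_mult s h = scal (qhalf (- 1)) (h + T s h)"

lemma lookup_kl_mult:
  assumes "s \<in> S" "carr h" "y \<in> carrier G"
  shows "lu (kl_mult s h) y = (if len y < len (s \<otimes> y)
    then qhalf (- 1) * lu h y + qhalf 1 * lu h (s \<otimes> y)
    else qhalf (- 1) * lu h (s \<otimes> y) + qhalf 1 * lu h y)"
  using lookup_T[OF assms] by (simp add: kl_mult_def lookup_add algebra_simps)

lemma keys_kl_mult: "s \<in> S \<Longrightarrow> carr h \<Longrightarrow> carr (kl_mult s h)"
  using lookup_not_key[OF keys_T] by (intro keys_subsetI) (auto simp: kl_mult_def lookup_add lookup_not_key)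

lemma hecke_bar_kl_mult:
  assumes "s \<in> S" "carr h" "hecke_bar G S h = h"
  shows "hecke_bar G S (kl_mult s h) = kl_mult s h"
proof -
  have "hecke_bar G S (kl_mult s h) = scal (qhalf 1) (h + Ti s h)"
    using assms by (simp add: kl_mult_def hecke_bar_scal hecke_bar_add hecke_bar_T)
  also have "\<dots> = kl_mult s h"
    by (simp add: kl_mult_def hecke_T_inv_def scal_distrib algebra_simps)
  finally show ?thesis .
qed

text \<open>Triangularity of the bar involution with respect to length, the input for the uniqueness
  of Kazhdan-Lusztig elements.\<close>

lemma lookup_bar_T:
  assumes "w \<in> carrier G"
  shows "y \<noteq> w \<Longrightarrow> len w \<le> len y \<Longrightarrow> lu (bar_T w) y = 0"
    and "lu (bar_T w) w = qhalf (- 2 * int (len w))"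
proof -
  have "lu (bar_T w) w = qhalf (- 2 * int (len w)) \<and>
    (\<forall>y. y \<noteq> w \<longrightarrow> len w \<le> len y \<longrightarrow> lu (bar_T w) y = 0)"
    using assms
  proof (induction rule: len_induct)
    case one
    then show ?case by (auto simp: bar_T_one lookup_single when_def)
  next
    case (mult s v)
    have IH: "lu (bar_T v) v = qhalf (- 2 * int (len v))"
      "\<And>y. y \<noteq> v \<Longrightarrow> len v \<le> len y \<Longrightarrow> lu (bar_T v) y = 0"
      using mult.IH[of v] mult by auto
    have l: "len (s \<otimes> v) = Suc (len v)"
      using len_simple_mult_le[of s v] mult by simp
    note lk = length_involution.lookup_op_inv[OF left_involution[OF mult(1)] keys_bar_T[OF mult(2)],
        folded hecke_T_inv_eq]
    have b: "bar_T (s \<otimes> v) = Ti s (bar_T v)" using bar_T_up mult by simp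
    have "lu (bar_T (s \<otimes> v)) y = 0" if y: "y \<noteq> s \<otimes> v" "Suc (len v) \<le> len y" for y
    proof (cases "y \<in> carrier G")
      case True
      have "s \<otimes> y \<noteq> v" using y mult True by auto
      moreover have "len v \<le> len (s \<otimes> y)" "y \<noteq> v"
        using y len_simple_mult_ge[of s y] mult True by auto
      ultimately have "lu (bar_T v) (s \<otimes> y) = 0" "lu (bar_T v) y = 0"
        using IH(2) y by auto
      then show ?thesis using b lk[OF True] by simp
    next
      case False
      then show ?thesis using lookup_not_key[OF keys_bar_T[of "s \<otimes> v"]] mult by simp
    qed
    then show ?case using b lk[of "s \<otimes> v"] mult IH l by simp
  qed
  then show "y \<noteq> w \<Longrightarrow> len w \<le> len y \<Longrightarrow> lu (bar_T w) y = 0"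
    and "lu (bar_T w) w = qhalf (- 2 * int (len w))" by auto
qed

end

subsection \<open>Specialization at \<open>q = 1\<close>\<close>

lemma ex_max_on_finite:
  fixes f :: "'a \<Rightarrow> 'b::linorder"
  assumes "finite A" "A \<noteq> {}"
  shows "\<exists>x\<in>A. \<forall>y\<in>A. f y \<le> f x"
proof -
  have "Max (f ` A) \<in> f ` A" using assms by (intro Max_in) auto
  then obtain x where "x \<in> A" "f x = Max (f ` A)" by auto
  then show ?thesis using assms by (metis Max_ge finite_imageI imageI)
qed

definition eval1 :: "laurent \<Rightarrow> int" where
  "eval1 f = (\<Sum>k\<in>Poly_Mapping.keys f. lu f k)"

text \<open>A function on the group as a linear functional on the group ring;
  \<open>lpairing\<close> is its counterpart on the Hecke algebra at \<open>q = 1\<close>. The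
  values are real because the formulas to be inserted contain halves and thirds.\<close>

definition pairing :: "('a \<Rightarrow> real) \<Rightarrow> ('a \<Rightarrow>\<^sub>0 int) \<Rightarrow> real" where
  "pairing g h = (\<Sum>w\<in>Poly_Mapping.keys h. real_of_int (lu h w) * g w)"

definition lpairing :: "('a \<Rightarrow> real) \<Rightarrow> ('a \<Rightarrow>\<^sub>0 laurent) \<Rightarrow> real" where
  "lpairing g h = (\<Sum>w\<in>Poly_Mapping.keys h. real_of_int (eval1 (lu h w)) * g w)"

lemma eval1_superset: "finite K \<Longrightarrow> Poly_Mapping.keys f \<subseteq> K \<Longrightarrow> eval1 f = (\<Sum>k\<in>K. lu f k)"
  unfolding eval1_def by (rule sum.mono_neutral_left) (auto simp: in_keys_iff)

lemma eval1_add [simp]: "eval1 (f + g) = eval1 f + eval1 g"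
  using keys_add[of f g]
    eval1_superset[of "Poly_Mapping.keys f \<union> Poly_Mapping.keys g"]
  by (simp add: lookup_add sum.distrib)

lemma eval1_single [simp]: "eval1 (sg k c) = c"
  using eval1_superset[of "{k}" "sg k c"] by simp

lemma eval1_0 [simp]: "eval1 0 = 0"
  by (simp add: eval1_def)

lemma eval1_1 [simp]: "eval1 1 = 1"
  using eval1_single[of 0 1] by (simp only: single_one)

lemma eval1_qhalf_mult [simp]: "eval1 (qhalf k * f) = eval1 f"
proof -
  have "(\<lambda>f. eval1 (qhalf k * f)) f = eval1 f"
    by (rule additive_ext[where C = UNIV]) (auto simp: qhalf_def mult_single algebra_simps)
  then show ?thesis .
qed

lemma eval1_of_int_mult [simp]: "eval1 (of_int c * f) = c * eval1 f"
proof -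
  have "(\<lambda>f. eval1 (of_int c * f)) f = (\<lambda>f. c * eval1 f) f"
    by (rule additive_ext[where C = UNIV])
       (auto simp: mult_single algebra_simps simp flip: single_of_int)
  then show ?thesis .
qed

lemma pairing_superset:
  "finite K \<Longrightarrow> Poly_Mapping.keys h \<subseteq> K \<Longrightarrow> pairing g h = (\<Sum>w\<in>K. real_of_int (lu h w) * g w)"
  unfolding pairing_def by (rule sum.mono_neutral_left) (auto simp: in_keys_iff)

lemma lpairing_superset:
  "finite K \<Longrightarrow> Poly_Mapping.keys h \<subseteq> K \<Longrightarrow> lpairing g h = (\<Sum>w\<in>K. real_of_int (eval1 (lu h w)) * g w)"
  unfolding lpairing_def by (rule sum.mono_neutral_left) (auto simp: in_keys_iff)

lemma lpairing_add: "lpairing g (h + h') = lpairing g h + lpairing g h'"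
  using keys_add[of h h']
    lpairing_superset[of "Poly_Mapping.keys h \<union> Poly_Mapping.keys h'"]
  by (simp add: lookup_add sum.distrib algebra_simps)

lemma lpairing_single: "lpairing g (sg w c) = real_of_int (eval1 c) * g w"
  using lpairing_superset[of "{w}" "sg w c"] by simp

lemma lpairing_diff: "lpairing g (h - h') = lpairing g h - lpairing g h'"
  using lpairing_add[of g "h - h'" h'] by simp

lemma lpairing_sum: "lpairing g (sum h A) = (\<Sum>x\<in>A. lpairing g (h x))"
proof (cases "finite A")
  case True
  then show ?thesis
    by (induction A rule: finite_induct) (auto simp: lpairing_add, simp add: lpairing_def)
qed (simp add: lpairing_def)

lemma lpairing_scal_of_int: "lpairing g (scal (of_int c) h) = real_of_int c * lpairing g h"
  by (subst lpairing_superset[OF finite_keys keys_scal])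
     (simp add: lpairing_def sum_distrib_left mult.assoc)

lemma lpairing_cong:
  "(\<And>w. w \<in> Poly_Mapping.keys h \<Longrightarrow> g w = g' w) \<Longrightarrow> lpairing g h = lpairing g' h"
  by (simp add: lpairing_def cong: sum.cong)

lemma lpairing_fun:
  "lpairing (\<lambda>w. g w + g' w) h = lpairing g h + lpairing g' h"
  "lpairing (\<lambda>w. r * g w) h = r * lpairing g h"
  "lpairing (\<lambda>w. \<Sum>i\<in>I. f i w) h = (\<Sum>i\<in>I. lpairing (f i) h)"
  by (simp_all add: lpairing_def sum.distrib algebra_simps sum_distrib_left sum.swap[of _ I])

lemma pairing_add: "pairing g (h + h') = pairing g h + pairing g h'"
  using keys_add[of h h']
    pairing_superset[of "Poly_Mapping.keys h \<union> Poly_Mapping.keys h'"]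
  by (simp add: lookup_add sum.distrib algebra_simps)

lemma pairing_single: "pairing g (sg w c) = real_of_int c * g w"
  using pairing_superset[of "{w}" "sg w c"] by simp

lemma pairing_sum: "pairing g (sum h A) = (\<Sum>x\<in>A. pairing g (h x))"
proof (cases "finite A")
  case True
  then show ?thesis
    by (induction A rule: finite_induct) (auto simp: pairing_add, simp add: pairing_def)
qed (simp add: pairing_def)

lemma pairing_scal: "pairing g (scal c h) = real_of_int c * pairing g h"
  by (subst pairing_superset[OF finite_keys keys_scal])
     (simp add: pairing_def sum_distrib_left mult.assoc)

lemma poly_at_q_pCons: "poly_at_q (pCons a p) = of_int a + q_var * poly_at_q p"
  by (simp add: poly_at_q_def map_poly_pCons)

lemma poly_at_q_0: "poly_at_q 0 = 0"
  by (simp add: poly_at_q_def)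

lemma eval1_poly_at_q: "eval1 (poly_at_q p) = poly p 1"
proof (induction p)
  case (pCons a p)
  then show ?case using eval1_of_int_mult[of a 1] by (simp add: poly_at_q_pCons)
qed (simp add: poly_at_q_0)

lemma lookup_poly_at_q:
  "lu (poly_at_q p) k = (if 0 \<le> k \<and> even k then coeff p (nat (k div 2)) else 0)"
proof (induction p arbitrary: k)
  case (pCons a p)
  have "nat (k div 2) = Suc (nat ((k - 2) div 2))" if "k \<ge> 2"
    using that by (subst Suc_nat_eq_nat_zadd1) auto
  moreover have "k < 2 \<Longrightarrow> 0 \<le> k \<Longrightarrow> even k \<Longrightarrow> k = 0" by presburger
  ultimately show ?case
    by (cases "k \<ge> 2") (auto simp: poly_at_q_pCons lookup_add pCons.IH lookup_of_int when_def)
qed (simp add: poly_at_q_0)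

lemma poly_at_q_inj: "poly_at_q p = poly_at_q p' \<Longrightarrow> p = p'"
proof (rule poly_eqI)
  fix i assume "poly_at_q p = poly_at_q p'"
  then have "lu (poly_at_q p) (2 * int i) = lu (poly_at_q p') (2 * int i)" by simp
  then show "coeff p i = coeff p' i" by (simp add: lookup_poly_at_q)
qed

subsection \<open>The Kazhdan--Lusztig basis\<close>

context coxeter_cocycle
begin

text \<open>The condition on the powers \<open>k\<close> of the square root of \<open>q\<close> says that, after multiplication by
  \<open>q\<^bsup>len w / 2\<^esup>\<close>, the coefficient of \<open>T\<^sub>y\<close> is a polynomial in \<open>q\<close> of degree at most
  \<open>(len w - len y - 1) / 2\<close>.\<close>

definition kl_good :: "'a \<Rightarrow> ('a \<Rightarrow>\<^sub>0 laurent) \<Rightarrow> bool" where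
  "kl_good w h \<longleftrightarrow> Poly_Mapping.keys h \<subseteq> {y. ble y w} \<and> lu h w = qhalf (- int (len w)) \<and>
     (\<forall>y k. y \<noteq> w \<longrightarrow> lu (lu h y) k \<noteq> 0 \<longrightarrow>
        - int (len w) \<le> k \<and> k < - int (len y) \<and> even (k + int (len w))) \<and>
     hecke_bar G S h = h"

lemma kl_goodD:
  assumes "kl_good w h"
  shows "\<not> ble y w \<Longrightarrow> lu h y = 0" "lu h w = qhalf (- int (len w))"
    "y \<noteq> w \<Longrightarrow> lu (lu h y) k \<noteq> 0 \<Longrightarrow>
        - int (len w) \<le> k \<and> k < - int (len y) \<and> even (k + int (len w))"
    "hecke_bar G S h = h" "carr h"
  using assms ble_closed unfolding kl_good_def by (auto simp: in_keys_iff)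

lemma kl_good_coeff:
  assumes "kl_good w h" "lu (lu h y) k \<noteq> 0"
  shows "- int (len w) \<le> k" "k \<le> - int (len y)" "even (k + int (len w))"
  using kl_goodD(2)[OF assms(1)] kl_goodD(3)[OF assms(1), of y k] assms(2)
  by (cases "y = w"; auto simp: qhalf_def lookup_single when_def split: if_splits)+

text \<open>At an element \<open>y\<close> of maximal length in the support of a difference, bar
  invariance and triangularity make the coefficient symmetric about the exponent
  \<open>- len y\<close>, while all its exponents lie strictly below.\<close>

lemma kl_good_unique:
  assumes h: "kl_good w h" and g: "kl_good w g"
  shows "h = g"
proof (rule ccontr)
  assume "h \<noteq> g"
  let ?d = "h - g"
  have neg_powers: "k < - int (len y)" if "lu (lu ?d y) k \<noteq> 0" for y k
  proof (cases "y = w")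
    case True
    then show ?thesis using that kl_goodD(2)[OF h] kl_goodD(2)[OF g] by (simp add: lookup_minus)
  next
    case False
    then have "lu (lu h y) k \<noteq> 0 \<or> lu (lu g y) k \<noteq> 0" using that by (auto simp: lookup_minus)
    then show ?thesis using kl_goodD(3)[OF h False] kl_goodD(3)[OF g False] by blast
  qed
  have d: "hecke_bar G S ?d = ?d" using kl_goodD(4) h g by (simp add: hecke_bar_diff)
  have cd: "carr ?d" using kl_goodD(5)[OF h] kl_goodD(5)[OF g] keys_diff[of h g] by blast
  have "Poly_Mapping.keys ?d \<noteq> {}" using \<open>h \<noteq> g\<close> by (simp add: keys_eq_empty)
  then obtain y where y: "y \<in> Poly_Mapping.keys ?d"
    and ymax: "\<And>x. x \<in> Poly_Mapping.keys ?d \<Longrightarrow> len x \<le> len y"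
    using ex_max_on_finite[OF finite_keys, of ?d len] by blast
  have "lu ?d y = (\<Sum>x\<in>Poly_Mapping.keys ?d. laurent_bar (lu ?d x) * lu (bar_T x) y)"
    by (subst d[symmetric]) (simp add: hecke_bar_eq lin_ext_def lookup_sum)
  also have "\<dots> = (\<Sum>x\<in>{y}. laurent_bar (lu ?d x) * lu (bar_T x) y)"
    using y ymax lookup_bar_T(1)[of _ y] cd by (intro sum.mono_neutral_right) auto
  also have "\<dots> = qhalf (- 2 * int (len y)) * laurent_bar (lu ?d y)"
    using lookup_bar_T(2)[of y] y cd by (auto simp: mult.commute)
  finally have eq: "lu ?d y = qhalf (- 2 * int (len y)) * laurent_bar (lu ?d y)" .
  obtain k where k: "lu (lu ?d y) k \<noteq> 0"
    using y by (metis in_keys_iff lookup_zero poly_mapping_eqI)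
  then have "lu (lu ?d y) (- (k + 2 * int (len y))) \<noteq> 0"
    by (subst (asm) eq) simp
  from neg_powers[OF this] neg_powers[OF k] show False by simp
qed

text \<open>For the Kazhdan-Lusztig element \<open>h\<close> of \<open>w\<close> this is \<mu>(z,
  w): the exponent corresponds to the largest degree \<open>(len w - len z - 1) / 2\<close> allowed
  for the polynomial at \<open>z\<close>.\<close>

definition kl_mu :: "'a \<Rightarrow> ('a \<Rightarrow>\<^sub>0 laurent) \<Rightarrow> int" where
  "kl_mu z h = lu (lu h z) (- int (len z) - 1)"

abbreviation mu_set :: "'a \<Rightarrow> 'a \<Rightarrow> 'a set" where
  "mu_set s v \<equiv> {z. ble z v \<and> z \<noteq> v \<and> len (s \<otimes> z) < len z}"

lemma finite_mu_set [simp]: "finite (mu_set s v)"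
  by (rule finite_subset[OF _ finite_ble[of v]]) auto

text \<open>The Kazhdan-Lusztig recursion. The \<open>B z\<close> are any elements with the required
  properties, since the lemma has to yield existence before \<open>kl_basis\<close> is known to be
  meaningful.\<close>

lemma kl_good_step:
  assumes s: "s \<in> S" and v: "v \<in> carrier G" and up: "len v < len (s \<otimes> v)"
    and h: "kl_good v h" and B: "\<And>z. z \<in> mu_set s v \<Longrightarrow> kl_good z (B z)"
  shows "kl_good (s \<otimes> v) (kl_mult s h - (\<Sum>z\<in>mu_set s v. scal (of_int (kl_mu z h)) (B z)))"
    (is "kl_good ?w ?h")
proof -
  have lw: "len ?w = Suc (len v)" using len_simple_mult_le[OF s v] up by simp
  have w: "?w \<in> carrier G" "\<not> ble ?w v" using s v up ble_len_le[of ?w v] by auto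
  note ch = kl_goodD(5)[OF h]
  have lk: "lu ?h y = lu (kl_mult s h) y - (\<Sum>z\<in>mu_set s v. of_int (kl_mu z h) * lu (B z) y)" for y
    by (simp add: lookup_minus lookup_sum)
  have lk2: "lu (lu ?h y) k = lu (lu (kl_mult s h) y) k -
      (\<Sum>z\<in>mu_set s v. kl_mu z h * lu (lu (B z) y) k)" for y k
    by (simp add: lk lookup_minus lookup_sum)
  have supp: "lu ?h y = 0" if "\<not> ble y ?w" for y
  proof -
    have "lu (B z) y = 0" if "z \<in> mu_set s v" for z
    proof -
      have "\<not> ble y z" using \<open>\<not> ble y ?w\<close> that ble_lift'[OF _ s up] ble_trans by blast
      then show ?thesis using kl_goodD(1)[OF B[OF that]] by simp
    qed
    moreover have "lu (kl_mult s h) y = 0"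
    proof (cases "y \<in> carrier G")
      case True
      have "\<not> ble y v" using that ble_lift'[OF _ s up] by blast
      moreover have "\<not> ble (s \<otimes> y) v" using that ble_lift[OF _ s up, of "s \<otimes> y"] s True by auto
      ultimately show ?thesis
        using kl_goodD(1)[OF h] by (simp add: lookup_kl_mult[OF s ch True])
    next
      case False
      then show ?thesis using lookup_not_key[OF keys_kl_mult[OF s ch]] by simp
    qed
    ultimately show ?thesis by (simp add: lk)
  qed
  have top: "lu ?h ?w = qhalf (- int (len ?w))"
  proof -
    have "lu (B z) ?w = 0" if "z \<in> mu_set s v" for z
      using kl_goodD(1)[OF B[OF that], of ?w] w(2) that ble_trans by blast
    then show ?thesis
      using kl_goodD(1)[OF h w(2)] kl_goodD(2)[OF h] up lw s v
      by (simp add: lk lookup_kl_mult[OF s ch w(1)])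
  qed
  have bound: "- int (len ?w) \<le> k \<and> k < - int (len y) \<and> even (k + int (len ?w))"
    if y: "y \<noteq> ?w" and nz: "lu (lu ?h y) k \<noteq> 0" for y k
  proof -
    have "lu ?h y \<noteq> 0" using nz by (metis lookup_zero)
    then have yc: "y \<in> carrier G" using supp[of y] ble_closed(1) by blast
    have yv: "s \<otimes> y \<noteq> v" using y s yc by auto
    note lkm = lookup_kl_mult[OF s ch yc]
    have hz: "lu (lu h x) j = 0"
      if "j < - int (len v) \<or> - int (len x) < j \<or> odd (j + int (len v)) \<or>
          (x \<noteq> v \<and> - int (len x) \<le> j)" for x j
      using that kl_good_coeff[OF h, of x j] kl_goodD(3)[OF h, of x j] by force
    have "- int (len ?w) \<le> k \<and> even (k + int (len ?w))"
    proof (rule ccontr)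
      assume neg: "\<not> ?thesis"
      then have "lu (lu h x) (k + 1) = 0 \<and> lu (lu h x) (k - 1) = 0" for x
        using hz[of "k + 1" x] hz[of "k - 1" x] lw by auto
      then have "lu (lu (kl_mult s h) y) k = 0"
        by (simp add: lkm lookup_add)
      \<comment> \<open>If \<mu>(z) is nonzero, its exponent forces \<open>len z\<close> to have the
        parity of \<open>len v + 1\<close>, hence that of the length of \<open>s v\<close>; so the
        corrections respect the parity condition.\<close>
      moreover have "kl_mu z h * lu (lu (B z) y) k = 0" if "z \<in> mu_set s v" for z
      proof (rule ccontr)
        assume "kl_mu z h * lu (lu (B z) y) k \<noteq> 0"
        then have a: "lu (lu h z) (- int (len z) - 1) \<noteq> 0" and b: "lu (lu (B z) y) k \<noteq> 0"
          by (auto simp: kl_mu_def)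
        have "len z < len v" using that ble_len_less by auto
        then have "- int (len ?w) \<le> k" using kl_good_coeff(1)[OF B[OF that] b] lw by simp
        moreover have "even (k + int (len ?w))"
          using kl_good_coeff(3)[OF B[OF that] b] kl_good_coeff(3)[OF h a] lw by presburger
        ultimately show False using neg by simp
      qed
      then have "(\<Sum>z\<in>mu_set s v. kl_mu z h * lu (lu (B z) y) k) = 0"
        by (intro sum.neutral) auto
      ultimately show False using nz by (simp add: lk2)
    qed
    moreover have "k < - int (len y)"
    proof (rule ccontr)
      \<comment> \<open>From the exponent \<open>- len y\<close> upwards only one term of the
        product can survive: \<mu>(y) at \<open>- len y\<close> itself, when \<open>s\<close> is a
        descent of \<open>y\<close>. The sum over \<open>mu_set\<close> removes exactly
        this.\<close>
      assume k: "\<not> ?thesis"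
      have Bz: "lu (lu (B z) y) k = 0" if "z \<in> mu_set s v" "z \<noteq> y" for z
        using kl_goodD(3)[OF B[OF that(1)], of y k] that k by auto
      show False
      proof (cases rule: len_simple_cases[OF s yc])
        case 1
        have "lu (lu h y) (k + 1) = 0" "lu (lu h (s \<otimes> y)) (k - 1) = 0"
          using hz[of "k + 1" y] hz[of "k - 1" "s \<otimes> y"] k yv 1 by auto
        moreover have "(\<Sum>z\<in>mu_set s v. kl_mu z h * lu (lu (B z) y) k) = 0"
          using Bz 1 by (intro sum.neutral) (auto, metis not_less_iff_gr_or_eq lessI)
        ultimately show False
          using nz 1 by (simp add: lk2 lkm lookup_add)
      next
        case 2
        have a: "lu (lu h (s \<otimes> y)) (k + 1) = 0"
          using hz[of "k + 1" "s \<otimes> y"] k yv 2 by auto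
        have "y \<noteq> v" using 2 up by auto
        then have b: "lu (lu h y) (k - 1) = (if k = - int (len y) then kl_mu y h else 0)"
          using hz[of "k - 1" y] k by (auto simp: kl_mu_def)
        have "(\<Sum>z\<in>mu_set s v. kl_mu z h * lu (lu (B z) y) k) =
            (if k = - int (len y) then kl_mu y h else 0)"
        proof (cases "ble y v")
          case True
          then have y: "y \<in> mu_set s v" using \<open>y \<noteq> v\<close> 2 by simp
          then have "(\<Sum>z\<in>mu_set s v. kl_mu z h * lu (lu (B z) y) k) =
              (\<Sum>z\<in>{y}. kl_mu z h * lu (lu (B z) y) k)"
            using Bz by (intro sum.mono_neutral_right) auto
          then show ?thesis
            using kl_goodD(2)[OF B[OF y]] by (auto simp: qhalf_def lookup_single when_def)
        next
          case False
          then have "(\<Sum>z\<in>mu_set s v. kl_mu z h * lu (lu (B z) y) k) = 0"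
            using Bz by (intro sum.neutral) auto
          then show ?thesis using kl_goodD(1)[OF h False] by (simp add: kl_mu_def)
        qed
        then show False using nz a b 2 by (simp add: lk2 lkm lookup_add)
      qed
    qed
    ultimately show ?thesis by simp
  qed
  have bar: "hecke_bar G S ?h = ?h"
    using hecke_bar_kl_mult[OF s ch kl_goodD(4)[OF h]] kl_goodD(4)[OF B]
    by (simp add: hecke_bar_diff hecke_bar_sum hecke_bar_scal)
  show ?thesis
    unfolding kl_good_def using supp top bound bar by (auto simp: in_keys_iff)
qed

lemma kl_good_one: "kl_good \<one> (sg \<one> 1)"
  by (auto simp: kl_good_def hecke_bar_single bar_T_one lookup_single when_def)

lemma kl_good_exists: "w \<in> carrier G \<Longrightarrow> \<exists>h. kl_good w h"
proof (induction rule: len_induct)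
  case one
  then show ?case using kl_good_one by blast
next
  case (mult s v)
  define B where "B z = (SOME h. kl_good z h)" for z
  have B: "kl_good z (B z)" if "z \<in> carrier G" "len z \<le> len v" for z
    unfolding B_def using someI_ex[OF mult.IH[OF that]] .
  show ?case
    using kl_good_step[OF mult(1-3) B[OF mult(2) order_refl], of B] B ble_closed ble_len_le by blast
qed

definition kl_basis :: "'a \<Rightarrow> ('a \<Rightarrow>\<^sub>0 laurent)" where
  "kl_basis w = (THE h. kl_good w h)"

lemma kl_basis_eqI: "kl_good w h \<Longrightarrow> kl_basis w = h"
  unfolding kl_basis_def by (blast intro: the_equality kl_good_unique)

lemma kl_good_basis: "w \<in> carrier G \<Longrightarrow> kl_good w (kl_basis w)"
  using kl_good_exists kl_basis_eqI by metis

lemma kl_basis_mult: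
  assumes "s \<in> S" "v \<in> carrier G" "len v < len (s \<otimes> v)"
  shows "kl_basis (s \<otimes> v) = kl_mult s (kl_basis v) -
    (\<Sum>z\<in>mu_set s v. scal (of_int (kl_mu z (kl_basis v))) (kl_basis z))"
  using assms kl_good_basis ble_closed by (intro kl_basis_eqI kl_good_step) auto

text \<open>Everything in the image of \<open>kl_mult s\<close> has equal coefficients at
  \<open>y\<close> and \<open>s y\<close>, and the corrections of the recursion have the descent
  \<open>s\<close> as well.\<close>

lemma kl_basis_descent:
  assumes "s \<in> S" "w \<in> carrier G" "len (s \<otimes> w) < len w" "y \<in> carrier G"
  shows "lu (kl_basis w) (s \<otimes> y) = lu (kl_basis w) y"
  using assms(2,3)
proof (induction "len w" arbitrary: w rule: less_induct)
  case less
  let ?v = "s \<otimes> w"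
  note s = assms(1) and y = assms(4)
  have v: "?v \<in> carrier G" "s \<otimes> ?v = w" "len ?v < len (s \<otimes> ?v)" using s less by auto
  have "lu (kl_basis z) (s \<otimes> y) = lu (kl_basis z) y" if "z \<in> mu_set s ?v" for z
    using less.hyps[of z] that ble_closed less.prems ble_len_le[of z ?v] by auto
  moreover have "lu (kl_mult s (kl_basis ?v)) (s \<otimes> y) = lu (kl_mult s (kl_basis ?v)) y"
    using kl_goodD(5)[OF kl_good_basis[OF v(1)]] s y
    by (cases rule: len_simple_cases[OF s y]) (simp_all add: lookup_kl_mult)
  ultimately have "lu (kl_basis (s \<otimes> ?v)) (s \<otimes> y) = lu (kl_basis (s \<otimes> ?v)) y"
    by (subst (1 2) kl_basis_mult[OF s v(1,3)]) (simp add: lookup_minus lookup_sum)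
  then show ?case using v by simp
qed

text \<open>By descent invariance the power that defines \<mu>(z, w) also occurs at
  \<open>t z\<close>, where its exponent \<open>- len (t z)\<close> violates the degree bound unless
  \<open>t z = w\<close>.\<close>

lemma kl_mu_nonzero:
  assumes "t \<in> S" "w \<in> carrier G" "len (t \<otimes> w) < len w"
    and "z \<in> carrier G" "z \<noteq> w" "len z < len (t \<otimes> z)" "kl_mu z (kl_basis w) \<noteq> 0"
  shows "w = t \<otimes> z"
proof (rule ccontr)
  assume "w \<noteq> t \<otimes> z"
  moreover have "lu (lu (kl_basis w) (t \<otimes> z)) (- int (len z) - 1) \<noteq> 0"
    using assms kl_basis_descent by (simp add: kl_mu_def)
  ultimately have "- int (len z) - 1 < - int (len (t \<otimes> z))"
    using kl_goodD(3)[OF kl_good_basis[OF assms(2)], of "t \<otimes> z"] by blast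
  then show False using assms(6) by simp
qed

lemma kl_mu_simple:
  assumes "t \<in> S" "z \<in> carrier G" "len z < len (t \<otimes> z)"
  shows "kl_mu z (kl_basis (t \<otimes> z)) = 1"
proof -
  have "lu (kl_basis (t \<otimes> z)) (t \<otimes> z) = lu (kl_basis (t \<otimes> z)) z"
    using assms by (intro kl_basis_descent) auto
  moreover have "len (t \<otimes> z) = Suc (len z)" using assms len_simple_mult_le[of t z] by simp
  ultimately have "lu (kl_basis (t \<otimes> z)) z = qhalf (- 1 - int (len z))"
    using kl_goodD(2)[OF kl_good_basis[of "t \<otimes> z"]] assms by simp
  then show ?thesis by (simp add: kl_mu_def qhalf_def lookup_single when_def)
qed

subsection \<open>Kazhdan--Lusztig polynomials\<close>

lemma lookup_kl_element:
  "lu (kl_element G S w p) y = (if ble y w then qhalf (- int (len w)) * poly_at_q (p y) else 0)"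
  by (simp add: kl_element_def lookup_sum lookup_single when_def if_distrib[of "\<lambda>x. _ * x"] cong: if_cong)

lemma kl_family_good:
  assumes w: "w \<in> carrier G" and p: "is_kl_family G S w p"
  shows "kl_good w (kl_element G S w p)"
proof -
  have "- int (len w) \<le> k \<and> k < - int (len y) \<and> even (k + int (len w))"
    if y: "y \<noteq> w" and nz: "lu (lu (kl_element G S w p) y) k \<noteq> 0" for y k
  proof -
    have yw: "ble y w" using nz by (auto simp: lookup_kl_element split: if_splits)
    then have a: "0 \<le> k + int (len w)" "even (k + int (len w))"
      and c: "coeff (p y) (nat ((k + int (len w)) div 2)) \<noteq> 0"
      using nz by (auto simp: lookup_kl_element lookup_poly_at_q split: if_splits)
    have "nat ((k + int (len w)) div 2) \<le> degree (p y)" using le_degree[OF c] .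
    moreover have "2 * degree (p y) + len y + 1 \<le> len w"
      using p y yw by (auto simp: is_kl_family_def)
    moreover obtain j where "k + int (len w) = 2 * j" using a(2) by (rule evenE)
    ultimately show ?thesis using a by simp
  qed
  moreover have "lu (kl_element G S w p) w = qhalf (- int (len w))"
    using p w by (simp add: lookup_kl_element is_kl_family_def poly_at_q_def)
  ultimately show ?thesis
    using p unfolding kl_good_def is_kl_family_def
    by (auto simp: in_keys_iff lookup_kl_element split: if_splits)
qed

lemma kl_good_family:
  assumes w: "w \<in> carrier G" and h: "kl_good w h"
  shows "\<exists>p. is_kl_family G S w p \<and> kl_element G S w p = h"
proof -
  \<comment> \<open>\<open>kl_element\<close> contains the factor \<open>q^(- len w / 2)\<close>, so
    degree \<open>i\<close> sits at exponent \<open>2 i - len w\<close>; \<open>len w\<close> is a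
    generous bound for the degree.\<close>
  define p where "p y = (\<Sum>i\<le>len w. monom (lu (lu h y) (2 * int i - int (len w))) i)" for y
  have cp: "coeff (p y) i = (if i \<le> len w then lu (lu h y) (2 * int i - int (len w)) else 0)" for y i
    by (simp add: p_def coeff_sum sum.delta)
  have elt: "kl_element G S w p = h"
  proof (intro poly_mapping_eqI)
    fix y k
    show "lu (lu (kl_element G S w p) y) k = lu (lu h y) k"
    proof (cases "ble y w")
      case True
      have "lu (lu h y) k = 0" if "k + int (len w) < 0 \<or> odd (k + int (len w)) \<or> k > 0"
        using that kl_good_coeff[OF h, of y k] by force
      moreover have "2 * ((k + int (len w)) div 2) = k + int (len w)" if "even (k + int (len w))"
        using that by simp
      moreover have "nat ((k + int (len w)) div 2) \<le> len w \<or> k > 0" by linarith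
      ultimately show ?thesis
        using True by (force simp: lookup_kl_element lookup_poly_at_q cp)
    qed (simp add: lookup_kl_element kl_goodD(1)[OF h])
  qed
  have pw: "p w = 1"
    by (rule poly_eqI) (auto simp: cp kl_goodD(2)[OF h] qhalf_def lookup_single when_def)
  have "2 * degree (p y) + len y + 1 \<le> len w" if y: "ble y w" "y \<noteq> w" for y
  proof (cases "p y = 0")
    case True
    then show ?thesis using ble_len_less[OF y] by simp
  next
    case False
    then have "coeff (p y) (degree (p y)) \<noteq> 0" by simp
    then have "lu (lu h y) (2 * int (degree (p y)) - int (len w)) \<noteq> 0"
      by (auto simp: cp split: if_splits)
    then show ?thesis using kl_goodD(3)[OF h y(2)] by fastforce
  qed
  moreover have "p y = 0" if "\<not> ble y w" for y
    using kl_goodD(1)[OF h that] by (simp add: p_def)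
  ultimately show ?thesis
    using pw elt kl_goodD(4)[OF h] unfolding is_kl_family_def by blast
qed

lemma kl_family_unique:
  assumes w: "w \<in> carrier G" and p: "is_kl_family G S w p" "is_kl_family G S w p'"
  shows "p = p'"
proof
  fix y
  have eq: "kl_element G S w p = kl_element G S w p'"
    using kl_family_good[OF w] p kl_good_unique by blast
  show "p y = p' y"
  proof (cases "ble y w")
    case True
    then have "poly_at_q (r y) = qhalf (int (len w)) * lu (kl_element G S w r) y" for r
      by (simp add: lookup_kl_element)
    then show ?thesis using eq by (simp add: poly_at_q_inj)
  qed (use p in \<open>auto simp: is_kl_family_def\<close>)
qed

lemma kl_element_kl_poly:
  assumes w: "w \<in> carrier G"
  shows "kl_element G S w (\<lambda>y. kl_poly G S y w) = kl_basis w"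
proof -
  obtain p where p: "is_kl_family G S w p" "kl_element G S w p = kl_basis w"
    using kl_good_family[OF w kl_good_basis[OF w]] by blast
  then have "(THE p. is_kl_family G S w p) = p"
    using kl_family_unique[OF w] by blast
  then show ?thesis using p by (simp add: kl_poly_def)
qed

lemma lookup_kl_C:
  assumes v: "v \<in> carrier G"
  shows "lu (kl_C G S v) w = eval1 (lu (kl_basis v) w)"
  unfolding kl_element_kl_poly[OF v, symmetric]
  by (simp add: kl_C_def lookup_sum lookup_single when_def lookup_kl_element eval1_poly_at_q cong: if_cong)

lemma pairing_kl_C:
  assumes v: "v \<in> carrier G"
  shows "pairing g (kl_C G S v) = lpairing g (kl_basis v)"
proof -
  have "Poly_Mapping.keys (kl_C G S v) \<subseteq> {y. ble y v}" "Poly_Mapping.keys (kl_basis v) \<subseteq> {y. ble y v}"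
    using kl_goodD(1)[OF kl_good_basis[OF v]]
    by (intro keys_subsetI; simp add: lookup_kl_C[OF v])+
  then show ?thesis
    by (simp add: pairing_superset[OF finite_ble] lpairing_superset[OF finite_ble] lookup_kl_C[OF v])
qed

lemma lookup_kl_C_self: "v \<in> carrier G \<Longrightarrow> lu (kl_C G S v) v = 1"
  using kl_goodD(2)[OF kl_good_basis, of v] by (simp add: lookup_kl_C qhalf_def)

lemma lookup_kl_C_not_le: "v \<in> carrier G \<Longrightarrow> \<not> ble w v \<Longrightarrow> lu (kl_C G S v) w = 0"
  using kl_goodD(1)[OF kl_good_basis, of v w] by (simp add: lookup_kl_C)

subsection \<open>Inverse Kazhdan--Lusztig polynomials at 1\<close>

lemma kl_C_independent:
  assumes supp: "\<And>v. \<not> ble v w \<Longrightarrow> c v = 0"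
    and zero: "(\<Sum>v | ble v w. scal (c v) (kl_C G S v)) = 0"
  shows "c v = (0 :: int)"
proof (rule ccontr)
  assume "c v \<noteq> 0"
  define N where "N = {v. c v \<noteq> 0}"
  have "N \<subseteq> {v. ble v w}" using supp by (auto simp: N_def)
  then have fin: "finite N" using finite_subset finite_ble by blast
  have "v \<in> N" using \<open>c v \<noteq> 0\<close> by (simp add: N_def)
  then obtain x where x: "x \<in> N" and xmax: "\<And>u. u \<in> N \<Longrightarrow> len u \<le> len x"
    using ex_max_on_finite[OF fin, of len] by blast
  have xw: "ble x w" "x \<in> carrier G" using x \<open>N \<subseteq> _\<close> ble_closed by auto
  have "(\<Sum>u | ble u w. c u * lu (kl_C G S u) x) = 0"
    using arg_cong[OF zero, of "\<lambda>h. lu h x"] by (simp add: lookup_sum)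
  moreover have "(\<Sum>u | ble u w. c u * lu (kl_C G S u) x) = (\<Sum>u\<in>{x}. c u * lu (kl_C G S u) x)"
  proof (rule sum.mono_neutral_right)
    show "\<forall>u\<in>{u. ble u w} - {x}. c u * lu (kl_C G S u) x = 0"
    proof
      fix u assume u: "u \<in> {u. ble u w} - {x}"
      then have "u \<in> carrier G" "x \<noteq> u" using ble_closed by auto
      show "c u * lu (kl_C G S u) x = 0"
      proof (cases "ble x u")
        case True
        then have "len x < len u" using ble_len_less \<open>x \<noteq> u\<close> by blast
        then have "u \<notin> N" using xmax by force
        then show ?thesis by (simp add: N_def)
      qed (simp add: lookup_kl_C_not_le \<open>u \<in> carrier G\<close>)
    qed
  qed (use xw in auto)
  ultimately have "c x = 0" using lookup_kl_C_self xw by simp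
  then show False using x by (simp add: N_def)
qed

text \<open>The \<open>C_v\<close> are unitriangular in the Bruhat order: \<open>w\<close> is
  \<open>C_w\<close> minus multiples of smaller elements, which are expanded by induction.\<close>

lemma kl_C_spans:
  assumes "w \<in> carrier G"
  shows "\<exists>c. (\<forall>v. \<not> ble v w \<longrightarrow> c v = 0) \<and> sg w (1 :: int) = (\<Sum>v | ble v w. scal (c v) (kl_C G S v))"
  using assms
proof (induction "len w" arbitrary: w rule: less_induct)
  case less
  let ?Y = "{y. ble y w \<and> y \<noteq> w}"
  have fY: "finite ?Y" using finite_subset[OF _ finite_ble[of w]] by auto
  have "\<forall>y\<in>?Y. \<exists>c. (\<forall>v. \<not> ble v y \<longrightarrow> c v = 0) \<and> sg y (1 :: int) = (\<Sum>v | ble v y. scal (c v) (kl_C G S v))"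
    using less.hyps ble_len_less ble_closed by blast
  from bchoice[OF this] obtain c where
    "\<forall>y\<in>?Y. (\<forall>v. \<not> ble v y \<longrightarrow> c y v = 0) \<and> sg y (1 :: int) = (\<Sum>v | ble v y. scal (c y v) (kl_C G S v))"
    by (rule exE)
  then have c: "\<And>y v. y \<in> ?Y \<Longrightarrow> \<not> ble v y \<Longrightarrow> c y v = 0"
    "\<And>y. y \<in> ?Y \<Longrightarrow> sg y (1 :: int) = (\<Sum>v | ble v y. scal (c y v) (kl_C G S v))"
    by simp_all
  let ?P = "\<lambda>y. lu (kl_C G S w) y"
  define d where "d v = (if v = w then 1 else 0) - (\<Sum>y\<in>?Y. ?P y * c y v)" for v
  have d0: "d v = 0" if "\<not> ble v w" for v
  proof -
    have "c y v = 0" if "y \<in> ?Y" for y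
      using c(1)[OF that, of v] \<open>\<not> ble v w\<close> that ble_trans by blast
    then show ?thesis using that less.prems by (auto simp: d_def)
  qed
  have sgy: "(\<Sum>v | ble v w. scal (c y v) (kl_C G S v)) = sg y 1" if "y \<in> ?Y" for y
    unfolding c(2)[OF that]
    by (rule sum.mono_neutral_right) (use that c(1)[OF that] ble_trans in auto)
  have "kl_C G S w = sg w 1 + (\<Sum>y\<in>?Y. sg y (?P y))"
  proof (rule poly_mapping_eqI)
    fix x show "?P x = lu (sg w 1 + (\<Sum>y\<in>?Y. sg y (?P y))) x"
      using fY lookup_kl_C_self[OF less.prems] lookup_kl_C_not_le[OF less.prems, of x] less.prems
      by (auto simp: lookup_add lookup_sum lookup_single when_def)
  qed
  moreover have "(\<Sum>v | ble v w. scal (d v) (kl_C G S v)) =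
      kl_C G S w - (\<Sum>y\<in>?Y. scal (?P y) (\<Sum>v | ble v w. scal (c y v) (kl_C G S v)))"
  proof -
    have "(\<Sum>v | ble v w. scal (d v) (kl_C G S v)) = (\<Sum>v | ble v w. (if v = w then kl_C G S w else 0)) -
        (\<Sum>v | ble v w. \<Sum>y\<in>?Y. scal (?P y * c y v) (kl_C G S v))"
      unfolding sum_subtractf[symmetric]
      by (rule sum.cong)
         (auto intro!: poly_mapping_eqI simp: d_def lookup_minus lookup_sum left_diff_distrib sum_distrib_right)
    also have "(\<Sum>v | ble v w. (if v = w then kl_C G S w else 0)) = kl_C G S w"
      using less.prems by simp
    finally show ?thesis by (simp add: scal_sum sum.swap[of _ ?Y])
  qed
  moreover have "(\<Sum>y\<in>?Y. scal (?P y) (\<Sum>v | ble v w. scal (c y v) (kl_C G S v))) =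
      (\<Sum>y\<in>?Y. sg y (?P y))"
    by (rule sum.cong) (simp_all add: sgy)
  ultimately have "sg w 1 = (\<Sum>v | ble v w. scal (d v) (kl_C G S v))"
    by (metis (no_types, lifting) add_diff_cancel_right')
  then show ?case using d0 by blast
qed

text \<open>Expansions in the \<open>C_v\<close> exist and are unique, which gives
  \<open>THE\<close> its meaning; the signs square to 1 and can be moved across.\<close>

lemma inv_kl_family:
  assumes w: "w \<in> carrier G"
  shows "is_inv_kl_family G S w (\<lambda>v. inv_kl G S v w)"
proof -
  let ?e = "\<lambda>v. cox_sign G S (w \<otimes> inv v)"
  have e: "?e v * ?e v = 1" for v by (rule cox_sign_square)
  obtain c where c: "\<And>v. \<not> ble v w \<Longrightarrow> c v = 0"
    "sg w (1 :: int) = (\<Sum>v | ble v w. scal (c v) (kl_C G S v))"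
    using kl_C_spans[OF w] by blast
  define m where "m v = ?e v * c v" for v
  have em: "?e v * m v = c v" for v using e[of v] by (simp add: m_def flip: mult.assoc)
  have "m v = 0" if "\<not> ble v w" for v using c(1)[OF that] by (simp add: m_def)
  then have m: "is_inv_kl_family G S w m"
    unfolding is_inv_kl_family_def em using c(2) by blast
  have "m' = m" if m': "is_inv_kl_family G S w m'" for m'
  proof
    fix v
    have "?e v * m' v - ?e v * m v = 0"
    proof (rule kl_C_independent[of w])
      show "?e v * m' v - ?e v * m v = 0" if "\<not> ble v w" for v
        using m m' that by (simp add: is_inv_kl_family_def)
      show "(\<Sum>v | ble v w. scal (?e v * m' v - ?e v * m v) (kl_C G S v)) = 0"
        using m m' by (simp add: is_inv_kl_family_def scal_distrib sum_subtractf)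
    qed
    then have "?e v * (?e v * m' v) = ?e v * (?e v * m v)" by simp
    then show "m' v = m v" using e[of v] by (simp flip: mult.assoc)
  qed
  then have "(THE m. is_inv_kl_family G S w m) = m" using m by blast
  then show ?thesis using m by (simp add: inv_kl_def)
qed

subsection \<open>\<open>W\<close>-graphs with single descents\<close>

text \<open>At \<open>q = 1\<close> the operator \<open>T s\<close> becomes left multiplication by
  \<open>s\<close>, so the Kazhdan-Lusztig element of \<open>s\<close> acts as
  \<open>s + 1\<close>.\<close>

lemma lpairing_kl_mult:
  assumes "carr h" "s \<in> S"
  shows "lpairing g (kl_mult s h) = lpairing (\<lambda>w. g (s \<otimes> w) + g w) h"
proof -
  have "(\<lambda>h. lpairing g (kl_mult s h)) h = lpairing (\<lambda>w. g (s \<otimes> w) + g w) h"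
  proof (rule additive_ext[OF _ _ _ assms(1)])
    fix w c assume "w \<in> carrier G"
    show "lpairing g (kl_mult s (sg w c)) = lpairing (\<lambda>w. g (s \<otimes> w) + g w) (sg w c)"
    proof (cases "len w < len (s \<otimes> w)")
      case True
      then show ?thesis
        by (simp add: kl_mult_def T_single_up scal_distrib lpairing_add lpairing_single ring_distribs)
    next
      case False
      have "sg w c + T s (sg w c) = sg (s \<otimes> w) (q_var * c) + sg w (q_var * c)"
        by (rule poly_mapping_eqI)
           (use False in \<open>simp add: hecke_T_eq hecke_op_single lookup_add lookup_single when_def algebra_simps\<close>)
      then show ?thesis
        by (simp add: kl_mult_def scal_distrib lpairing_add lpairing_single ring_distribs)
    qed
  qed (simp_all add: kl_mult_def hecke_T_eq hecke_op_add scal_distrib lpairing_add)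
  then show ?thesis .
qed

text \<open>\<open>\<phi> _ x\<close> is meant to be the coordinate at \<open>x\<close> of the orbit map \<open>w \<mapsto> w e\<^sub>1\<close> of a module with basis
  \<open>\<Gamma>\<close>.  The multiplication formula for \<open>C\<^sub>s C\<^sub>v\<close> only involves \<open>\<mu>(z, v)\<close> with \<open>z\<close> having
  the descent \<open>s\<close>; for \<open>z \<in> \<Gamma>\<close> this is its only descent, so that \<open>\<mu>(z, v) \<noteq> 0\<close> forces
  \<open>v = t z\<close> for every descent \<open>t\<close> of \<open>v\<close>.\<close>

lemma lpairing_kl_basis:
  fixes \<phi> :: "'a \<Rightarrow> 'a \<Rightarrow> real"
  assumes \<Gamma>: "\<Gamma> \<subseteq> carrier G"
    and one: "\<And>x. x \<in> \<Gamma> \<Longrightarrow> \<phi> \<one> x = (if x = \<one> then 1 else 0)"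
    and ascent: "\<And>s x w. s \<in> S \<Longrightarrow> x \<in> \<Gamma> \<Longrightarrow> w \<in> carrier G \<Longrightarrow> len x < len (s \<otimes> x) \<Longrightarrow>
        \<phi> (s \<otimes> w) x = - \<phi> w x"
    and descent: "\<And>s x w. s \<in> S \<Longrightarrow> x \<in> \<Gamma> \<Longrightarrow> w \<in> carrier G \<Longrightarrow> len (s \<otimes> x) < len x \<Longrightarrow>
        \<phi> (s \<otimes> w) x = \<phi> w x + (\<Sum>r | r \<in> S \<and> r \<otimes> x \<in> \<Gamma>. \<phi> w (r \<otimes> x))"
    and single: "\<And>s t x. s \<in> S \<Longrightarrow> t \<in> S \<Longrightarrow> x \<in> \<Gamma> \<Longrightarrow> len (s \<otimes> x) < len x \<Longrightarrow>
        len (t \<otimes> x) < len x \<Longrightarrow> s = t"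
    and down: "\<And>s x. s \<in> S \<Longrightarrow> x \<in> \<Gamma> \<Longrightarrow> len (s \<otimes> x) < len x \<Longrightarrow> s \<otimes> x \<in> \<Gamma>"
    and up: "\<And>s t x. s \<in> S \<Longrightarrow> t \<in> S \<Longrightarrow> x \<in> \<Gamma> \<Longrightarrow> len (s \<otimes> x) < len x \<Longrightarrow>
        len x < len (t \<otimes> x) \<Longrightarrow> len (t \<otimes> x) < len (s \<otimes> (t \<otimes> x)) \<Longrightarrow> t \<otimes> x \<in> \<Gamma>"
  shows "u \<in> carrier G \<Longrightarrow> x \<in> \<Gamma> \<Longrightarrow> lpairing (\<lambda>w. \<phi> w x) (kl_basis u) = (if x = u then 1 else 0)"
proof (induction arbitrary: x rule: len_induct)
  case one
  then show ?case
    using assms(2) by (simp add: kl_basis_eqI[OF kl_good_one] lpairing_single)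
next
  case (mult s v)
  note s = mult(1) and v = mult(2) and sv = mult(3) and IH = mult(4) and x = mult(5)
  have cB: "carr (kl_basis v)" using kl_goodD(5)[OF kl_good_basis[OF v]] .
  have xc: "x \<in> carrier G" using x \<Gamma> by blast
  let ?M = "if x \<in> mu_set s v then real_of_int (kl_mu x (kl_basis v)) else 0"
  \<comment> \<open>By induction only \<open>z = x\<close> contributes to the corrections.\<close>
  have "(\<Sum>z\<in>mu_set s v. real_of_int (kl_mu z (kl_basis v)) * lpairing (\<lambda>w. \<phi> w x) (kl_basis z)) =
      (\<Sum>z\<in>mu_set s v. if z = x then real_of_int (kl_mu x (kl_basis v)) else 0)"
    using IH[OF _ _ x] ble_closed ble_len_le by (intro sum.cong) auto
  also have "\<dots> = ?M" by (simp only: sum.delta[OF finite_mu_set])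
  finally have eq: "lpairing (\<lambda>w. \<phi> w x) (kl_basis (s \<otimes> v)) =
      lpairing (\<lambda>w. \<phi> (s \<otimes> w) x + \<phi> w x) (kl_basis v) - ?M"
    by (simp add: kl_basis_mult[OF s v sv] lpairing_diff lpairing_sum lpairing_scal_of_int
        lpairing_kl_mult[OF cB s])
  show ?case
  proof (cases rule: len_simple_cases[OF s xc])
    case 1
    have "lpairing (\<lambda>w. \<phi> (s \<otimes> w) x + \<phi> w x) (kl_basis v) = lpairing (\<lambda>w. 0 * 0) (kl_basis v)"
      using ascent[OF s x] cB 1 by (intro lpairing_cong) auto
    moreover have "x \<noteq> s \<otimes> v" using 1 sv s v by auto
    ultimately show ?thesis using eq 1 by (simp add: lpairing_def)
  next
    case 2
    let ?R = "{r. r \<in> S \<and> r \<otimes> x \<in> \<Gamma>}"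
    have fR: "finite ?R" using finite_S by simp
    have xv: "x \<noteq> v" using 2 sv by auto
    have "lpairing (\<lambda>w. \<phi> (s \<otimes> w) x + \<phi> w x) (kl_basis v) =
        lpairing (\<lambda>w. 2 * \<phi> w x + (\<Sum>r\<in>?R. \<phi> w (r \<otimes> x))) (kl_basis v)"
      using descent[OF s x] cB 2 by (intro lpairing_cong) auto
    also have "\<dots> = 2 * (if x = v then 1 else 0) + (\<Sum>r\<in>?R. if r \<otimes> x = v then 1 else 0)"
      using IH[OF v order_refl] x by (simp add: lpairing_fun)
    also have "(\<Sum>r\<in>?R. if r \<otimes> x = v then 1 else 0) =
        (if v \<in> \<Gamma> \<and> v \<otimes> inv x \<in> S then 1 else (0 :: real))"
    proof -
      have "r \<otimes> x = v \<longleftrightarrow> r = v \<otimes> inv x" if "r \<in> S" for r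
        using that xc v by (metis S_closed inv_closed inv_solve_right m_closed)
      then have "(\<Sum>r\<in>?R. if r \<otimes> x = v then 1 else (0 :: real)) =
          (\<Sum>r\<in>?R. if r = v \<otimes> inv x then 1 else 0)"
        by (intro sum.cong) auto
      also have "\<dots> = (if v \<otimes> inv x \<in> ?R then 1 else 0)" using fR by simp
      finally show ?thesis using xc v by (simp add: m_assoc)
    qed
    finally have N: "lpairing (\<lambda>w. \<phi> (s \<otimes> w) x + \<phi> w x) (kl_basis v) =
        (if v \<in> \<Gamma> \<and> v \<otimes> inv x \<in> S then 1 else 0)" using xv by simp
    show ?thesis
    proof (cases "\<exists>t\<in>S. v = t \<otimes> x \<and> len x < len (t \<otimes> x)")
      \<comment> \<open>Here \<open>v\<close> is an upper neighbour of \<open>x\<close> and lies in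
        \<Gamma> by \<open>up\<close>; the 1 from the neighbour sum cancels against \<mu>(x, v) =
        1.\<close>
      case True
      then obtain t where t: "t \<in> S" "v = t \<otimes> x" "len x < len (t \<otimes> x)" by blast
      have "v \<in> \<Gamma>" using up[OF s t(1) x] 2 t sv by simp
      moreover have "v \<otimes> inv x = t" using t xc by (simp add: m_assoc)
      moreover have "x \<in> mu_set s v" using ble_simple[OF t(1) xc t(3)] t 2 by auto
      moreover have "x \<noteq> s \<otimes> v" using t sv by auto
      ultimately show ?thesis using eq N t kl_mu_simple[OF t(1) xc t(3)] by simp
    next
      \<comment> \<open>Now \<mu>(x, v) vanishes: if not, \<open>v\<close> has a descent
        \<open>t\<close>, different from \<open>s\<close>, the only descent of \<open>x\<close>, and
        \<open>kl_mu_nonzero\<close> gives \<open>v = t x\<close>. What is left is the lower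
        neighbour \<open>s x\<close> of \<open>x\<close>, which equals \<open>v\<close> exactly when
        \<open>x = s v\<close>.\<close>
      case False
      have "?M = 0"
      proof (rule ccontr)
        assume "?M \<noteq> 0"
        then have m: "x \<in> mu_set s v" "kl_mu x (kl_basis v) \<noteq> 0" by (auto split: if_splits)
        then have "len x < len v" using ble_len_less by blast
        then have "v \<noteq> \<one>" by auto
        then obtain t where t: "t \<in> S" "len (t \<otimes> v) < len v" using ex_left_descent v by metis
        then have "t \<noteq> s" using sv by auto
        then have "\<not> len (t \<otimes> x) < len x" using single[OF s t(1) x] 2 by auto
        then have "len x < len (t \<otimes> x)" by (cases rule: len_simple_cases[OF t(1) xc]) auto
        then show False using False kl_mu_nonzero[OF t(1) v t(2) xc] m t by auto
      qed
      moreover have "v \<in> \<Gamma> \<and> v \<otimes> inv x \<in> S \<longleftrightarrow> x = s \<otimes> v"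
      proof
        assume a: "v \<in> \<Gamma> \<and> v \<otimes> inv x \<in> S"
        let ?r = "v \<otimes> inv x"
        have r: "?r \<in> S" "v = ?r \<otimes> x" using a v xc by (auto simp: m_assoc)
        then have "\<not> len x < len (?r \<otimes> x)" using False by auto
        then have "len (?r \<otimes> x) < len x" by (cases rule: len_simple_cases[OF r(1) xc]) auto
        then have "?r = s" using single[OF s r(1) x] 2 by auto
        then show "x = s \<otimes> v" using r s xc by simp
      next
        assume a: "x = s \<otimes> v"
        then have "v = s \<otimes> x" using s v by simp
        then show "v \<in> \<Gamma> \<and> v \<otimes> inv x \<in> S"
          using down[OF s x] 2 s xc by (auto simp: m_assoc)
      qed
      ultimately show ?thesis using eq N by simp
    qed
  qed
qed

text \<open>Apply the functional \<open>g\<close> to the expansion of \<open>w\<close> in the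
  \<open>C_v\<close>: duality leaves the term of \<open>x\<close>, and the signs are multiplicative
  and square to 1.\<close>

lemma inv_kl_dual:
  assumes dual: "\<And>v. v \<in> carrier G \<Longrightarrow> lpairing g (kl_basis v) = (if x = v then 1 else 0)"
    and w: "w \<in> carrier G" and x: "x \<in> carrier G"
  shows "real_of_int (inv_kl G S x w) = real_of_int (cox_sign G S w * cox_sign G S x) * g w"
proof -
  let ?e = "\<lambda>v. cox_sign G S (w \<otimes> inv v)" and ?m = "\<lambda>v. inv_kl G S v w"
  note fam = inv_kl_family[OF w, unfolded is_inv_kl_family_def]
  have "g w = pairing g (sg w 1)" by (simp add: pairing_single)
  also have "\<dots> = pairing g (\<Sum>v | ble v w. scal (?e v * ?m v) (kl_C G S v))"
    using fam by simp
  also have "\<dots> = (\<Sum>v | ble v w. real_of_int (?e v * ?m v) * (if v = x then 1 else 0))"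
    using dual ble_closed by (auto simp: pairing_sum pairing_scal pairing_kl_C intro!: sum.cong)
  also have "\<dots> = real_of_int (?e x * ?m x)"
    using fam by (simp add: if_distrib[of "\<lambda>y. _ * y"] cong: if_cong)
  also have "?e x = cox_sign G S w * cox_sign G S x"
    using w x by (simp add: cox_sign_mult cox_sign_inv)
  finally have "real_of_int (cox_sign G S w * cox_sign G S x) * g w =
      real_of_int ((cox_sign G S w * cox_sign G S w) * (cox_sign G S x * cox_sign G S x)) * ?m x"
    by (simp add: algebra_simps)
  then show ?thesis by (simp add: cox_sign_square)
qed

end

section \<open>The affine Weyl group of type \<open>G\<^sub>2\<close>\<close>

subsection \<open>Generation\<close>

lemma (in group) word_prod_append_closed:
  "set us \<subseteq> carrier G \<Longrightarrow> set ws \<subseteq> carrier G \<Longrightarrow>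
    word_prod G us \<in> carrier G \<and> word_prod G (us @ ws) = word_prod G us \<otimes> word_prod G ws"
proof -
  have "set vs \<subseteq> carrier G \<Longrightarrow> word_prod G vs \<in> carrier G" for vs
    by (induction vs) (auto simp: word_prod_def)
  then show "set us \<subseteq> carrier G \<Longrightarrow> set ws \<subseteq> carrier G \<Longrightarrow> ?thesis"
    by (induction us) (auto simp: word_prod_def m_assoc)
qed

lemma (in group) generate_involutions_word:
  assumes S: "S \<subseteq> carrier G" "\<And>s. s \<in> S \<Longrightarrow> s \<otimes> s = \<one>" and w: "w \<in> generate G S"
  shows "\<exists>ws. word_for G S w ws"
  using w
proof induction
  case one
  show ?case by (rule exI[of _ "[]"]) (simp add: word_for_def word_prod_def)
next
  case (incl h)
  then show ?case using S by (intro exI[of _ "[h]"]) (auto simp: word_for_def word_prod_def)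
next
  case (inv h)
  then have "inv h = h" using S inv_equality by blast
  then show ?case using S inv by (intro exI[of _ "[h]"]) (auto simp: word_for_def word_prod_def)
next
  case (eng h1 h2)
  then obtain us ws where "word_for G S h1 us" "word_for G S h2 ws" by blast
  then show ?case using S word_prod_append_closed[of us ws]
    by (intro exI[of _ "us @ ws"]) (auto simp: word_for_def)
qed

abbreviation (input) AW :: "(coroot_lattice \<times> (coroot_lattice \<Rightarrow> coroot_lattice)) monoid" where
  "AW \<equiv> affine_weyl"

lemma AW_carrier [simp]: "(x, u) \<in> carrier AW \<longleftrightarrow> u \<in> weyl"
  and AW_mult [simp]: "(x, u) \<otimes>\<^bsub>AW\<^esub> (y, v) = (x + u y, u \<circ> v)"
  and AW_one: "\<one>\<^bsub>AW\<^esub> = (0, id)"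
  by (simp_all add: affine_weyl_def)

lemma snd_AW [simp]: "w \<in> carrier AW \<Longrightarrow> snd w \<in> weyl"
  by (auto simp: affine_weyl_def)

interpretation AW: group affine_weyl
  by (rule group_affine_weyl)

lemma simple_refls_involution: "s \<in> simple_refls \<Longrightarrow> s \<otimes>\<^bsub>AW\<^esub> s = \<one>\<^bsub>AW\<^esub>"
  by (auto simp: AW_one s0_def s1_def s2_def fun_eq_iff coroot_refl_refl zero_prod_def)

lemma weyl_zero: "u \<in> weyl \<Longrightarrow> u 0 = 0"
  using weyl_add[of u 0 0] by simp

lemma weyl_uminus: "u \<in> weyl \<Longrightarrow> u (- x) = - u x"
  using weyl_add[of u x "- x"] weyl_zero[of u] by (simp add: eq_neg_iff_add_eq_0 add.commute)

lemma weyl_diff: "u \<in> weyl \<Longrightarrow> u (x - y) = u x - u y"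
  using weyl_add[of u x "- y"] weyl_uminus[of u y] by simp

lemma inv_AW: "u \<in> weyl \<Longrightarrow> \<exists>v\<in>weyl. v \<circ> u = id \<and> u \<circ> v = id \<and> inv\<^bsub>AW\<^esub> (x, u) = (- v x, v)"
proof -
  assume u: "u \<in> weyl"
  then obtain v where v: "v \<in> weyl" "v \<circ> u = id" using weyl_inverse by blast
  have i: "inv\<^bsub>AW\<^esub> (x, u) = (- v x, v)"
    using u v by (intro AW.inv_equality) (auto simp: AW_one)
  have "(x, u) \<otimes>\<^bsub>AW\<^esub> (- v x, v) = \<one>\<^bsub>AW\<^esub>"
    using AW.r_inv[of "(x, u)"] u by (simp add: i del: AW_mult)
  then have "u \<circ> v = id" by (simp add: AW_one)
  then show ?thesis using v i by blast
qed

lemma weyl_word: "u \<in> weyl \<Longrightarrow> \<exists>ws. set ws \<subseteq> {s1, s2} \<and> word_prod AW ws = (0, u)"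
proof (induction rule: weyl.induct)
  case weyl_id
  show "\<exists>ws. set ws \<subseteq> {s1, s2} \<and> word_prod AW ws = (0, id)"
    by (rule exI[of _ "[]"]) (simp add: word_prod_def AW_one)
next
  case (weyl_alpha w)
  then obtain ws where "set ws \<subseteq> {s1, s2}" "word_prod AW ws = (0, w)" by blast
  then show "\<exists>ws. set ws \<subseteq> {s1, s2} \<and> word_prod AW ws = (0, coroot_refl alpha_ch \<circ> w)"
    by (intro exI[of _ "s1 # ws"]) (simp add: word_prod_def s1_def weyl_zero weyl_gens)
next
  case (weyl_beta w)
  then obtain ws where "set ws \<subseteq> {s1, s2}" "word_prod AW ws = (0, w)" by blast
  then show "\<exists>ws. set ws \<subseteq> {s1, s2} \<and> word_prod AW ws = (0, coroot_refl beta_ch \<circ> w)"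
    by (intro exI[of _ "s2 # ws"]) (simp add: word_prod_def s2_def weyl_zero weyl_gens)
qed

lemma word_weyl: "set ws \<subseteq> {s1, s2} \<Longrightarrow> word_prod AW ws \<in> {0} \<times> weyl"
proof (induction ws)
  case (Cons s ws)
  then obtain u where "word_prod AW ws = (0, u)" "u \<in> weyl" by auto
  then show ?case using Cons.prems weyl_gens
    by (auto simp: word_prod_def s1_def s2_def weyl_zero intro: weyl.intros)
qed (simp add: word_prod_def weyl_id AW_one)

definition smul :: "int \<Rightarrow> coroot_lattice \<Rightarrow> coroot_lattice" where
  "smul k d = (k * fst d, k * snd d)"

lemma smul_simps: "smul k (x + y) = smul k x + smul k y" "smul k (x - y) = smul k x - smul k y"
  "smul k (smul l x) = smul (k * l) x" "smul k 0 = 0" "smul (k + l) x = smul k x + smul l x"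
  "smul (- k) x = - smul k x" "smul 1 x = x"
  by (auto simp: smul_def algebra_simps zero_prod_def prod_eq_iff)

lemma smul_0: "smul 0 x = 0"
  by (simp add: smul_def zero_prod_def)

lemma generate_AW: "w \<in> carrier AW \<Longrightarrow> w \<in> generate AW simple_refls"
proof -
  let ?H = "generate AW simple_refls"
  have H: "subgroup ?H AW" using AW.generate_is_subgroup simple_refls_carrier by blast
  note mult = subgroup.m_closed[OF H] and inv = subgroup.m_inv_closed[OF H]
  have gen: "s \<in> simple_refls \<Longrightarrow> s \<in> ?H" for s by (rule generate.incl)
  have weyl: "(0, u) \<in> ?H" if "u \<in> weyl" for u
    using that
  proof (induction rule: weyl.induct)
    case weyl_id
    show "(0, id) \<in> ?H" using generate.one[of AW simple_refls] by (simp only: AW_one)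
  next
    case (weyl_alpha w)
    then show "(0, coroot_refl alpha_ch \<circ> w) \<in> ?H" using mult[OF gen[of s1] weyl_alpha.IH] by (simp add: s1_def weyl_zero weyl_gens)
  next
    case (weyl_beta w)
    then show "(0, coroot_refl beta_ch \<circ> w) \<in> ?H" using mult[OF gen[of s2] weyl_beta.IH] by (simp add: s2_def weyl_zero weyl_gens)
  qed
  have theta: "(theta_ch, id) \<in> ?H"
  proof -
    have "coroot_refl theta_ch \<circ> coroot_refl theta_ch = id" by (auto simp: fun_eq_iff)
    then show ?thesis
      using mult[OF gen[of s0] weyl[OF weyl_gens(3)]] by (simp add: s0_def weyl_zero weyl_gens)
  qed
  have conj: "(u x, id) \<in> ?H" if x: "(x, id) \<in> ?H" and u: "u \<in> weyl" for u x
  proof -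
    obtain v where v: "v \<in> weyl" "v \<circ> u = id" "u \<circ> v = id" using inv_AW[OF u] by blast
    show ?thesis
      using mult[OF mult[OF weyl[OF u] x] weyl[OF v(1)]] v u by (simp add: weyl_zero)
  qed
  \<comment> \<open>The reflections in \<alpha> and \<beta> carry the highest short coroot to (1, 1)
    and then to (1, 0); the difference of these is the other simple coroot.\<close>
  have "((1, 1), id) \<in> ?H" using conj[OF theta weyl_gens(1)] by simp
  moreover from conj[OF this weyl_gens(2)] have a: "((1, 0), id) \<in> ?H" by simp
  moreover have inv_tr: "(- x, id) \<in> ?H" if "(x, id) \<in> ?H" for x
  proof -
    have "inv\<^bsub>AW\<^esub> (x, id) = (- x, id)" using weyl_id by (intro AW.inv_equality) (auto simp: AW_one)
    then show ?thesis using inv[OF that] by simp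
  qed
  moreover have add: "(x + y, id) \<in> ?H" if "(x, id) \<in> ?H" "(y, id) \<in> ?H" for x y
    using mult[OF that] by simp
  ultimately have b: "((0, 1), id) \<in> ?H"
    using add[of "(1, 1)" "- (1, 0)"] inv_tr[of "(1, 0)"] by simp
  define Tr where "Tr x \<longleftrightarrow> (x, id) \<in> ?H" for x
  have Tr: "Tr (x + y)" "Tr (x - y)" if "Tr x" "Tr y" for x y
    using that add[of x y] add[of x "- y"] inv_tr[of y] by (simp_all add: Tr_def)
  have Tr0: "Tr 0" using weyl[OF weyl_id] by (simp add: Tr_def)
  have "Tr (smul m d)" if "Tr d" for m d
  proof (induction m rule: int_induct[of _ 0])
    case base
    then show ?case using Tr0 by (simp add: smul_0)
  next
    case (step1 i)
    then show ?case using Tr(1)[OF _ that] by (simp add: smul_simps)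
  next
    case (step2 i)
    have "smul (i - 1) d = smul i d - d"
      using smul_simps(5)[of i "- 1" d] by (simp add: smul_simps)
    then show ?case using Tr(2)[OF _ that] step2 by simp
  qed
  then have "Tr (smul (fst x) (1, 0) + smul (snd x) (0, 1))" for x
    using a b by (intro Tr) (simp_all add: Tr_def)
  then have tr: "(x, id) \<in> ?H" for x by (simp add: Tr_def smul_def)
  assume "w \<in> carrier AW"
  then show ?thesis using mult[OF tr[of "fst w"] weyl[of "snd w"]] by (cases w) auto
qed

subsection \<open>Separation by reflection hyperplanes\<close>

definition pos_coroots :: "coroot_lattice set" where
  "pos_coroots = {(1, 0), (0, 1), (1, 1), (2, 1), (3, 1), (3, 2)}"

text \<open>Pairing of \<open>z\<close> with the root whose coroot is \<open>d\<close>; for coroots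
  \<open>d\<close> the division is exact.\<close>

definition cpair :: "coroot_lattice \<Rightarrow> coroot_lattice \<Rightarrow> int" where
  "cpair z d = 2 * coroot_form z d div coroot_form d d"

lemma coroot_refl_cpair: "coroot_refl d z = z - smul (cpair z d) d"
  by (simp add: coroot_refl_def cpair_def smul_def Let_def)

lemma cpair_eqI: "coroot_form d d \<noteq> 0 \<Longrightarrow> 2 * coroot_form z d = c * coroot_form d d \<Longrightarrow> cpair z d = c"
  by (simp add: cpair_def)

lemma cpair_0: "cpair 0 d = 0"
  by (cases d) (simp add: cpair_def zero_prod_def)

lemma cpair_simps [simp]:
  "cpair (a, b) (1, 0) = 2 * a - 3 * b" "cpair (a, b) (0, 1) = 2 * b - a"
  "cpair (a, b) (1, 1) = 3 * b - a" "cpair (a, b) (2, 1) = a"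
  "cpair (a, b) (3, 1) = a - b" "cpair (a, b) (3, 2) = b"
  by (rule cpair_eqI; simp)+

text \<open>The group acts on the coroot lattice scaled by the Coxeter number \<open>6\<close>, so that the alcove
  defined by \<open>s0\<close>, \<open>s1\<close>, \<open>s2\<close> contains the lattice point \<open>(5, 3)\<close> in its interior.\<close>

definition act :: "coroot_lattice \<times> (coroot_lattice \<Rightarrow> coroot_lattice) \<Rightarrow> coroot_lattice \<Rightarrow> coroot_lattice" where
  "act w z = smul 6 (fst w) + snd w z"

abbreviation base_pt :: coroot_lattice where "base_pt \<equiv> (5, 3)"

text \<open>\<open>t\<close> displaces a point along its coroot, proportionally to the signed
  distance from the hyperplane, so a negative product of displacements means opposite sides. Stated
  without naming the coroot, this is compatible with conjugation.\<close>

definition sep :: "coroot_lattice \<times> (coroot_lattice \<Rightarrow> coroot_lattice) \<Rightarrow> coroot_lattice \<Rightarrow> coroot_lattice \<Rightarrow> bool" where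
  "sep t z z' \<longleftrightarrow> coroot_form (act t z - z) (act t z' - z') < 0"

definition aneg where
  "aneg w t \<longleftrightarrow> sep t base_pt (act (inv\<^bsub>AW\<^esub> w) base_pt)"

lemma weyl_smul: "u \<in> weyl \<Longrightarrow> u (smul k x) = smul k (u x)"
proof (induction rule: weyl.induct)
  case (weyl_alpha w)
  then show ?case by (cases "w x") (simp add: smul_def algebra_simps)
next
  case (weyl_beta w)
  then show ?case by (cases "w x") (simp add: smul_def algebra_simps)
qed simp

lemma form_smul: "coroot_form (smul k x) (smul l y) = k * l * coroot_form x y"
  by (cases x; cases y) (simp add: smul_def algebra_simps)

lemma form_weyl: "u \<in> weyl \<Longrightarrow> coroot_form (u x) (u y) = coroot_form x y"
proof (induction rule: weyl.induct)
  case (weyl_alpha w)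
  then show ?case by (cases "w x"; cases "w y") (simp add: algebra_simps)
next
  case (weyl_beta w)
  then show ?case by (cases "w x"; cases "w y") (simp add: algebra_simps)
qed simp

lemma act_mult: "w \<in> carrier AW \<Longrightarrow> act (w \<otimes>\<^bsub>AW\<^esub> v) z = act w (act v z)"
  by (cases w; cases v) (simp add: act_def weyl_add weyl_smul smul_simps add.assoc)

lemma act_one: "act \<one>\<^bsub>AW\<^esub> z = z"
  by (simp add: act_def smul_simps AW_one)

lemma act_diff: "w \<in> carrier AW \<Longrightarrow> act w z - act w z' = snd w (z - z')"
  by (cases w) (simp add: act_def weyl_diff)

lemma sep_conj:
  assumes "w \<in> carrier AW" "t \<in> carrier AW"
  shows "sep (w \<otimes>\<^bsub>AW\<^esub> t \<otimes>\<^bsub>AW\<^esub> inv\<^bsub>AW\<^esub> w) (act w z) (act w z') \<longleftrightarrow> sep t z z'"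
proof -
  have "act (w \<otimes>\<^bsub>AW\<^esub> t \<otimes>\<^bsub>AW\<^esub> inv\<^bsub>AW\<^esub> w) (act w z) - act w z = snd w (act t z - z)" for z
  proof -
    have "act (inv\<^bsub>AW\<^esub> w) (act w z) = z"
      using act_mult[of "inv\<^bsub>AW\<^esub> w" w z] AW.inv_closed[OF assms(1)] AW.l_inv[OF assms(1)] act_one
      by simp
    then show ?thesis
      using assms act_mult AW.m_closed[OF assms] act_diff[OF assms(1)] by simp
  qed
  moreover have "snd w \<in> weyl" using assms(1) by auto
  ultimately show ?thesis by (simp add: sep_def form_weyl)
qed

text \<open>\<open>k\<close> and \<open>d\<close> name the hyperplane on which the pairing with
  \<open>d\<close> is \<open>6 * k\<close>, in the scaled lattice.\<close>

definition affine_refls :: "(coroot_lattice \<times> (coroot_lattice \<Rightarrow> coroot_lattice)) set" where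
  "affine_refls = {(smul k d, coroot_refl d) | k d. d \<in> pos_coroots}"

lemma affine_refls_act:
  "act (smul k d, coroot_refl d) z - z = smul (6 * k - cpair z d) d"
  by (simp add: act_def coroot_refl_cpair smul_simps) (simp add: smul_def algebra_simps prod_eq_iff)

lemma coroot_refl_simps' [simp]:
  "coroot_refl (1, 1) (a, b) = (2 * a - 3 * b, a - 2 * b)"
  "coroot_refl (3, 1) (a, b) = (3 * b - 2 * a, 2 * b - a)"
  "coroot_refl (3, 2) (a, b) = (a - 3 * b, - b)"
  by (simp_all add: coroot_refl_cpair smul_def)

lemma affine_refls_conj_simple:
  assumes "t \<in> affine_refls" "\<sigma> = coroot_refl alpha_ch \<or> \<sigma> = coroot_refl beta_ch"
  shows "(0, \<sigma>) \<otimes>\<^bsub>AW\<^esub> t \<otimes>\<^bsub>AW\<^esub> (0, \<sigma>) \<in> affine_refls"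
proof -
  obtain k d where t: "t = (smul k d, coroot_refl d)" "d \<in> pos_coroots"
    using assms(1) by (auto simp: affine_refls_def)
  have "\<exists>l e. e \<in> pos_coroots \<and> \<sigma> (smul k d) = smul l e \<and> \<sigma> \<circ> coroot_refl d \<circ> \<sigma> = coroot_refl e"
    (is "\<exists>l e. ?P l e")
    using assms(2)
  proof
    assume "\<sigma> = coroot_refl alpha_ch"
    \<comment> \<open>A simple reflection permutes the positive coroots other than its own, which it
      negates; in that case the sign goes to \<open>k\<close>.\<close>
    moreover define e where "e = (if d = (1, 0) then (1, 0) else coroot_refl alpha_ch d)"
    ultimately have "?P (if d = (1, 0) then - k else k) e"
      using t(2) unfolding pos_coroots_def by (auto simp: smul_def fun_eq_iff)
    then show ?thesis by blast
  next
    assume "\<sigma> = coroot_refl beta_ch"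
    moreover define e where "e = (if d = (0, 1) then (0, 1) else coroot_refl beta_ch d)"
    ultimately have "?P (if d = (0, 1) then - k else k) e"
      using t(2) unfolding pos_coroots_def by (auto simp: smul_def fun_eq_iff)
    then show ?thesis by blast
  qed
  moreover have "\<sigma> \<in> weyl" using assms(2) weyl_gens by auto
  moreover from this have "(0, \<sigma>) \<otimes>\<^bsub>AW\<^esub> t \<otimes>\<^bsub>AW\<^esub> (0, \<sigma>) = (\<sigma> (smul k d), \<sigma> \<circ> coroot_refl d \<circ> \<sigma>)"
    using t by (simp add: coroot_refl_cpair[of d] cpair_0 weyl_zero smul_simps smul_0 comp_assoc)
  ultimately show ?thesis unfolding affine_refls_def by auto
qed

lemma affine_refls_conj_transl:
  assumes "t \<in> affine_refls"
  shows "(x, id) \<otimes>\<^bsub>AW\<^esub> t \<otimes>\<^bsub>AW\<^esub> (- x, id) \<in> affine_refls"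
proof -
  obtain k d where t: "t = (smul k d, coroot_refl d)" "d \<in> pos_coroots"
    using assms(1) by (auto simp: affine_refls_def)
  have "x + smul k d + coroot_refl d (- x) = smul (k + cpair x d) d"
  proof -
    have "cpair (- x) d = - cpair x d"
      using t(2) by (cases x) (auto simp: pos_coroots_def)
    then show ?thesis by (simp add: coroot_refl_cpair smul_simps)
  qed
  then have "(x, id) \<otimes>\<^bsub>AW\<^esub> t \<otimes>\<^bsub>AW\<^esub> (- x, id) = (smul (k + cpair x d) d, coroot_refl d)"
    using t by simp
  then show ?thesis using t(2) unfolding affine_refls_def by blast
qed


lemma affine_refls_carrier: "t \<in> affine_refls \<Longrightarrow> t \<in> carrier AW"
proof -
  have "coroot_refl d \<in> weyl" if "d \<in> pos_coroots" for d
  proof -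
    let ?a = "coroot_refl alpha_ch" and ?b = "coroot_refl beta_ch"
    have "coroot_refl (1, 1) = ?b \<circ> (?a \<circ> ?b)" "coroot_refl (3, 1) = ?a \<circ> (?b \<circ> ?a)"
      "coroot_refl (3, 2) = ?b \<circ> (?a \<circ> (?b \<circ> (?a \<circ> ?b)))"
      by (auto simp: fun_eq_iff)
    then have "coroot_refl (1, 1) \<in> weyl" "coroot_refl (3, 1) \<in> weyl" "coroot_refl (3, 2) \<in> weyl"
      by (simp_all only: weyl_comp weyl_gens)
    then show ?thesis using that weyl_gens unfolding pos_coroots_def by blast
  qed
  then show "t \<in> affine_refls \<Longrightarrow> t \<in> carrier AW" by (auto simp: affine_refls_def)
qed

lemma affine_refls_conj:
  assumes t: "t \<in> affine_refls" and g: "g \<in> carrier AW"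
  shows "g \<otimes>\<^bsub>AW\<^esub> t \<otimes>\<^bsub>AW\<^esub> inv\<^bsub>AW\<^esub> g \<in> affine_refls"
proof -
  have conj_mult: "(g \<otimes>\<^bsub>AW\<^esub> h) \<otimes>\<^bsub>AW\<^esub> t \<otimes>\<^bsub>AW\<^esub> inv\<^bsub>AW\<^esub> (g \<otimes>\<^bsub>AW\<^esub> h) =
      g \<otimes>\<^bsub>AW\<^esub> (h \<otimes>\<^bsub>AW\<^esub> t \<otimes>\<^bsub>AW\<^esub> inv\<^bsub>AW\<^esub> h) \<otimes>\<^bsub>AW\<^esub> inv\<^bsub>AW\<^esub> g"
    if "g \<in> carrier AW" "h \<in> carrier AW" "t \<in> carrier AW" for g h t
    using that by (simp only: AW.m_assoc AW.inv_mult_group AW.m_closed AW.inv_closed)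
  have weyl: "(0, u) \<otimes>\<^bsub>AW\<^esub> t \<otimes>\<^bsub>AW\<^esub> inv\<^bsub>AW\<^esub> (0, u) \<in> affine_refls" if "u \<in> weyl" for u
    using that
  proof (induction rule: weyl.induct)
    case weyl_id
    show "(0, id) \<otimes>\<^bsub>AW\<^esub> t \<otimes>\<^bsub>AW\<^esub> inv\<^bsub>AW\<^esub> (0, id) \<in> affine_refls"
      unfolding AW_one[symmetric] using t affine_refls_carrier[OF t] by simp
  next
    case (weyl_alpha w)
    have i: "inv\<^bsub>AW\<^esub> s1 = s1"
      using simple_refls_carrier by (intro AW.inv_equality simple_refls_involution) auto
    have e: "(0, coroot_refl alpha_ch \<circ> w) = s1 \<otimes>\<^bsub>AW\<^esub> (0, w)"
      by (simp add: s1_def weyl_zero weyl_gens)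
    show "(0, coroot_refl alpha_ch \<circ> w) \<otimes>\<^bsub>AW\<^esub> t \<otimes>\<^bsub>AW\<^esub>
        inv\<^bsub>AW\<^esub> (0, coroot_refl alpha_ch \<circ> w) \<in> affine_refls"
      unfolding e
      using conj_mult[of s1 "(0, w)" t] affine_refls_carrier[OF t] weyl_alpha affine_refls_conj_simple
        simple_refls_carrier i
      by (simp add: s1_def del: AW_mult)
  next
    case (weyl_beta w)
    have i: "inv\<^bsub>AW\<^esub> s2 = s2"
      using simple_refls_carrier by (intro AW.inv_equality simple_refls_involution) auto
    have e: "(0, coroot_refl beta_ch \<circ> w) = s2 \<otimes>\<^bsub>AW\<^esub> (0, w)"
      by (simp add: s2_def weyl_zero weyl_gens)
    show "(0, coroot_refl beta_ch \<circ> w) \<otimes>\<^bsub>AW\<^esub> t \<otimes>\<^bsub>AW\<^esub>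
        inv\<^bsub>AW\<^esub> (0, coroot_refl beta_ch \<circ> w) \<in> affine_refls"
      unfolding e
      using conj_mult[of s2 "(0, w)" t] affine_refls_carrier[OF t] weyl_beta affine_refls_conj_simple
        simple_refls_carrier i
      by (simp add: s2_def del: AW_mult)
  qed
  obtain x u where xu: "g = (x, id) \<otimes>\<^bsub>AW\<^esub> (0, u)" "u \<in> weyl" using g by (cases g) auto
  have "inv\<^bsub>AW\<^esub> (x, id) = (- x, id)" using weyl_id by (intro AW.inv_equality) (auto simp: AW_one)
  then show ?thesis
    unfolding xu(1)
    using conj_mult[of "(x, id)" "(0, u)" t] affine_refls_carrier[OF t] xu(2) weyl_id
      affine_refls_conj_transl[OF weyl[OF xu(2)], of x]
    by (simp del: AW_mult)
qed

lemma reflections_affine: "t \<in> reflections AW simple_refls \<Longrightarrow> t \<in> affine_refls"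
proof -
  assume "t \<in> reflections AW simple_refls"
  then obtain g s where g: "g \<in> carrier AW" "s \<in> simple_refls" "t = g \<otimes>\<^bsub>AW\<^esub> s \<otimes>\<^bsub>AW\<^esub> inv\<^bsub>AW\<^esub> g"
    unfolding reflections_def by blast
  have "s0 = (smul 1 theta_ch, coroot_refl theta_ch)" "s1 = (smul 0 alpha_ch, coroot_refl alpha_ch)"
    "s2 = (smul 0 beta_ch, coroot_refl beta_ch)"
    by (simp_all add: s0_def s1_def s2_def smul_def zero_prod_def)
  moreover have "theta_ch \<in> pos_coroots" "alpha_ch \<in> pos_coroots" "beta_ch \<in> pos_coroots"
    by (simp_all add: pos_coroots_def)
  ultimately have "s \<in> affine_refls" using g(2) unfolding affine_refls_def by blast
  then show ?thesis using affine_refls_conj g by simp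
qed

lemma sep_affine_refl:
  assumes "d \<in> pos_coroots"
  shows "sep (smul k d, coroot_refl d) z z' \<longleftrightarrow> (6 * k - cpair z d) * (6 * k - cpair z' d) < 0"
proof -
  have "coroot_form d d > 0" using assms by (auto simp: pos_coroots_def)
  then show ?thesis
    by (simp add: sep_def affine_refls_act form_smul mult_less_0_iff)
qed

section \<open>Regular points and the Coxeter structure\<close>

definition regular :: "coroot_lattice \<Rightarrow> bool" where
  "regular z \<longleftrightarrow> (\<forall>t\<in>affine_refls. act t z \<noteq> z)"

text \<open>\<open>base_pt\<close> is half the sum of the positive coroots. Its pairings with the
  positive roots are their heights 1, 1, 2, 3, 4, 5, none of them divisible by 6.\<close>

lemma regular_base: "regular base_pt"
  unfolding regular_def
proof
  fix t assume "t \<in> affine_refls"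
  then obtain k d where t: "t = (smul k d, coroot_refl d)" "d \<in> pos_coroots"
    by (auto simp: affine_refls_def)
  have "6 * k - cpair base_pt d \<noteq> 0" "d \<noteq> 0"
    using t(2) unfolding pos_coroots_def by (auto simp: zero_prod_def; presburger)+
  then have "smul (6 * k - cpair base_pt d) d \<noteq> 0" by (auto simp: smul_def zero_prod_def prod_eq_iff)
  then show "act t base_pt \<noteq> base_pt" using affine_refls_act[of k d base_pt] t by auto
qed

lemma act_inv: "w \<in> carrier AW \<Longrightarrow> act (inv\<^bsub>AW\<^esub> w) (act w z) = z" "w \<in> carrier AW \<Longrightarrow> act w (act (inv\<^bsub>AW\<^esub> w) z) = z"
  using act_mult[of "inv\<^bsub>AW\<^esub> w" w z] act_mult[of w "inv\<^bsub>AW\<^esub> w" z] AW.inv_closed[of w]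
    AW.l_inv[of w] AW.r_inv[of w] act_one
  by simp_all

lemma regular_act:
  assumes w: "w \<in> carrier AW" and z: "regular z"
  shows "regular (act w z)"
  unfolding regular_def
proof (rule ballI, rule notI)
  fix t assume t: "t \<in> affine_refls" "act t (act w z) = act w z"
  let ?v = "inv\<^bsub>AW\<^esub> w"
  have v: "?v \<in> carrier AW" using w by simp
  have tc: "t \<in> carrier AW" using affine_refls_carrier t by blast
  have "?v \<otimes>\<^bsub>AW\<^esub> t \<otimes>\<^bsub>AW\<^esub> w \<in> affine_refls"
    using affine_refls_conj[OF t(1) v] w by simp
  moreover have "act (?v \<otimes>\<^bsub>AW\<^esub> t \<otimes>\<^bsub>AW\<^esub> w) z = z"
    using act_mult[of "?v \<otimes>\<^bsub>AW\<^esub> t" w z] act_mult[of ?v t "act w z"] v tc w t(2) act_inv(1) by simp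
  ultimately show False using z by (auto simp: regular_def)
qed

lemma sep_transitive:
  assumes "t \<in> affine_refls" "regular x" "regular y" "regular z"
  shows "sep t x z \<longleftrightarrow> sep t x y \<noteq> sep t y z"
proof -
  obtain k d where t: "t = (smul k d, coroot_refl d)" "d \<in> pos_coroots"
    using assms(1) by (auto simp: affine_refls_def)
  have "6 * k - cpair w d \<noteq> 0" if "regular w" for w
    using affine_refls_act[of k d w] that assms(1) t(1) by (auto simp: regular_def smul_0)
  from this[OF assms(2)] this[OF assms(3)] this[OF assms(4)] show ?thesis
    unfolding t(1) sep_affine_refl[OF t(2)] mult_less_0_iff by linarith
qed

lemma act_simple:
  "act s0 (a, b) = (12 - a, 6 + b - a)" "act s1 (a, b) = (3 * b - a, b)" "act s2 (a, b) = (a, a - b)"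
  by (simp_all add: act_def s0_def s1_def s2_def smul_def)

lemma no_wall_between:
  fixes a b k :: int
  assumes "0 < a" "a < 6" "0 < b" "b < 6"
  shows "\<not> (6 * k - a) * (6 * k - b) < 0"
proof (cases "k \<le> 0")
  case True
  then show ?thesis using assms by (simp add: mult_less_0_iff)
next
  case False
  then show ?thesis using assms by (simp add: mult_less_0_iff)
qed

lemma wall_between:
  "(6 * k - 1) * (6 * k + 1) < 0 \<longleftrightarrow> k = (0 :: int)"
  "(6 * k - 5) * (6 * k - 7) < 0 \<longleftrightarrow> k = (1 :: int)"
  by (auto simp: mult_less_0_iff)

text \<open>At \<open>act s base_pt\<close> the pairings with the positive roots again lie strictly
  between 0 and 6, except the one with the root of \<open>s\<close>: it passes from 1 to -1, or from
  5 to 7 for \<open>s0\<close>.\<close>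

lemma sep_base_simple:
  assumes "t \<in> affine_refls" "s \<in> simple_refls"
  shows "sep t base_pt (act s base_pt) \<longleftrightarrow> t = s"
proof
  obtain k d where t: "t = (smul k d, coroot_refl d)" "d \<in> pos_coroots"
    using assms(1) by (auto simp: affine_refls_def)
  assume "sep t base_pt (act s base_pt)"
  then have f: "(6 * k - cpair base_pt d) * (6 * k - cpair (act s base_pt) d) < 0"
    using sep_affine_refl[OF t(2)] t(1) by simp
  from t(2) assms(2) f have "(s = s0 \<and> d = theta_ch \<and> k = 1) \<or> (s = s1 \<and> d = alpha_ch \<and> k = 0) \<or>
      (s = s2 \<and> d = beta_ch \<and> k = 0)"
    unfolding pos_coroots_def
    by (elim insertE emptyE) (simp_all add: act_simple no_wall_between wall_between)
  then show "t = s" using t(1) by (auto simp: s0_def s1_def s2_def smul_def zero_prod_def)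
next
  assume "t = s"
  then show "sep t base_pt (act s base_pt)"
    using assms(2) by (auto simp: sep_def act_simple)
qed

text \<open>Write \<open>p\<close> for the base point and go from \<open>p\<close> to
  \<open>(s w)^-1 p = w^-1 s p\<close> by way of \<open>w^-1 p\<close>. The second leg is the image
  under \<open>w^-1\<close> of the passage from \<open>p\<close> to \<open>s p\<close>, hence
  crosses only the wall of \<open>w^-1 s w\<close>.\<close>

interpretation C: coxeter_cocycle affine_weyl simple_refls aneg
proof unfold_locales
  show "simple_refls \<subseteq> carrier AW" by (rule simple_refls_carrier)
  show "\<exists>ws. word_for AW simple_refls w ws" if "w \<in> carrier AW" for w
    using AW.generate_involutions_word[OF simple_refls_carrier simple_refls_involution]
      generate_AW[OF that] by blast
  show "\<not> aneg \<one>\<^bsub>AW\<^esub> t" if "t \<in> reflections AW simple_refls" for t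
  proof -
    have "t \<in> affine_refls" using reflections_affine that .
    then obtain k d where t: "t = (smul k d, coroot_refl d)" "d \<in> pos_coroots"
      by (auto simp: affine_refls_def)
    show ?thesis unfolding aneg_def t(1) by (simp add: act_one sep_affine_refl[OF t(2)] not_less)
  qed
  show "aneg (s \<otimes>\<^bsub>AW\<^esub> w) t \<longleftrightarrow> aneg w t \<noteq> (w \<otimes>\<^bsub>AW\<^esub> t \<otimes>\<^bsub>AW\<^esub> inv\<^bsub>AW\<^esub> w = s)"
    if s: "s \<in> simple_refls" and w: "w \<in> carrier AW" and t: "t \<in> reflections AW simple_refls" for s w t
  proof -
    let ?v = "inv\<^bsub>AW\<^esub> w" and ?r = "w \<otimes>\<^bsub>AW\<^esub> t \<otimes>\<^bsub>AW\<^esub> inv\<^bsub>AW\<^esub> w"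
    have t': "t \<in> affine_refls" using reflections_affine t .
    have sc: "s \<in> carrier AW" using s simple_refls_carrier by blast
    have v: "?v \<in> carrier AW" using w by simp
    have "inv\<^bsub>AW\<^esub> s = s" using sc simple_refls_involution[OF s] by (intro AW.inv_equality)
    then have sw: "act (inv\<^bsub>AW\<^esub> (s \<otimes>\<^bsub>AW\<^esub> w)) base_pt = act ?v (act s base_pt)"
      using sc w v by (simp add: AW.inv_mult_group act_mult)
    have "aneg (s \<otimes>\<^bsub>AW\<^esub> w) t \<longleftrightarrow> aneg w t \<noteq> sep t (act ?v base_pt) (act ?v (act s base_pt))"
      unfolding aneg_def sw
      by (intro sep_transitive regular_act regular_base t' v sc)
    also have "sep t (act ?v base_pt) (act ?v (act s base_pt)) \<longleftrightarrow> sep ?r base_pt (act s base_pt)"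
      using sep_conj[OF w affine_refls_carrier[OF t'], of "act ?v base_pt" "act ?v (act s base_pt)"]
        act_inv(2)[OF w] by simp
    also have "\<dots> \<longleftrightarrow> ?r = s"
      using sep_base_simple[OF affine_refls_conj[OF t' w] s] .
    finally show ?thesis .
  qed
qed (auto simp: simple_refls_involution)

text \<open>Left descents of \<open>x\<close> can be read off the point
  \<open>act x base_pt\<close>, which turns the combinatorics of the nine elements into arithmetic
  with nine points.\<close>

lemma left_descent_iff:
  assumes s: "s \<in> simple_refls" and x: "x \<in> carrier AW"
  shows "C.len (s \<otimes>\<^bsub>AW\<^esub> x) < C.len x \<longleftrightarrow> sep s (act x base_pt) base_pt"
    and "C.len x < C.len (s \<otimes>\<^bsub>AW\<^esub> x) \<longleftrightarrow> \<not> sep s (act x base_pt) base_pt"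
proof -
  let ?t = "inv\<^bsub>AW\<^esub> x \<otimes>\<^bsub>AW\<^esub> s \<otimes>\<^bsub>AW\<^esub> x"
  have sc: "s \<in> carrier AW" using s simple_refls_carrier by blast
  have t: "?t \<in> reflections AW simple_refls" "x \<otimes>\<^bsub>AW\<^esub> ?t = s \<otimes>\<^bsub>AW\<^esub> x"
    using C.left_as_refl[OF s x] by auto
  have "aneg x ?t \<longleftrightarrow> sep (x \<otimes>\<^bsub>AW\<^esub> ?t \<otimes>\<^bsub>AW\<^esub> inv\<^bsub>AW\<^esub> x) (act x base_pt) base_pt"
    using sep_conj[OF x, of ?t base_pt "act (inv\<^bsub>AW\<^esub> x) base_pt"] x sc
    by (simp add: aneg_def act_inv(2))
  also have "x \<otimes>\<^bsub>AW\<^esub> ?t \<otimes>\<^bsub>AW\<^esub> inv\<^bsub>AW\<^esub> x = s"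
    using C.conj_cancel[OF sc x] .
  finally have "aneg x ?t \<longleftrightarrow> sep s (act x base_pt) base_pt" .
  then show "C.len (s \<otimes>\<^bsub>AW\<^esub> x) < C.len x \<longleftrightarrow> sep s (act x base_pt) base_pt"
    and "C.len x < C.len (s \<otimes>\<^bsub>AW\<^esub> x) \<longleftrightarrow> \<not> sep s (act x base_pt) base_pt"
    using C.neg_iff_len[OF t(1) x] C.not_neg_iff_len[OF t(1) x] t(2) by simp_all
qed

text \<open>An element that fixes the base point has no left descent. Hence points in its orbit name
  group elements unambiguously.\<close>

lemma act_free:
  assumes "x \<in> carrier AW" "act x base_pt = base_pt"
  shows "x = \<one>\<^bsub>AW\<^esub>"
proof (rule ccontr)
  assume "x \<noteq> \<one>\<^bsub>AW\<^esub>"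
  then obtain s where s: "s \<in> simple_refls" "C.len (s \<otimes>\<^bsub>AW\<^esub> x) < C.len x"
    using C.ex_left_descent assms(1) by blast
  then have "sep s base_pt base_pt" using left_descent_iff(1)[OF s(1) assms(1)] assms(2) by simp
  then show False using s(1) by (auto simp: sep_def act_simple)
qed

section \<open>Shortest coset representatives and signs\<close>

lemma w_min_eq: "\<exists>u\<in>weyl. w_min \<gamma> = (\<gamma>, u)"
proof -
  let ?coset = "(\<gamma>, id) <#\<^bsub>AW\<^esub> ({0} \<times> weyl)"
  have coset: "?coset = {\<gamma>} \<times> weyl"
    by (auto simp: l_coset_def)
  define least where "least w \<longleftrightarrow> w \<in> {\<gamma>} \<times> weyl \<and> (\<forall>u\<in>{\<gamma>} \<times> weyl. C.len w \<le> C.len u)" for w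
  have "\<exists>w. w \<in> {\<gamma>} \<times> weyl \<and> (\<forall>u. u \<in> {\<gamma>} \<times> weyl \<longrightarrow> C.len w \<le> C.len u)"
    by (rule ex_has_least_nat[of _ "(\<gamma>, id)"]) (simp add: weyl_id)
  then obtain w where w: "least w" unfolding least_def by blast
  have "w' = w" if w': "least w'" for w'
  proof -
    obtain u u' where u: "w = (\<gamma>, u)" "u \<in> weyl" and u': "w' = (\<gamma>, u')" "u' \<in> weyl"
      using w w' unfolding least_def by blast
    obtain v where v: "v \<in> weyl" "u \<circ> v = id" using inv_AW[OF u(2)] by blast
    obtain ys where ys: "set ys \<subseteq> {s1, s2}" "word_prod AW ys = (0, v \<circ> u')"
      using weyl_word[OF weyl_comp[OF v(1) u'(2)]] by blast
    have "u \<circ> (v \<circ> u') = u'" using v(2) by (simp flip: comp_assoc)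
    then have eq: "w' = w \<otimes>\<^bsub>AW\<^esub> word_prod AW ys" using ys u u' by (simp add: weyl_zero)
    have le: "C.len x \<le> C.len (x \<otimes>\<^bsub>AW\<^esub> word_prod AW zs)" if zs: "set zs \<subseteq> {s1, s2}" and x: "least x" for x zs
    proof -
      have xl: "x \<in> {\<gamma>} \<times> weyl" "\<forall>u\<in>{\<gamma>} \<times> weyl. C.len x \<le> C.len u"
        by (rule conjunct1[OF x[unfolded least_def]], rule conjunct2[OF x[unfolded least_def]])
      from xl(1) obtain a where a: "x = (\<gamma>, a)" "a \<in> weyl" by (cases x) simp
      obtain b where b: "word_prod AW zs = (0, b)" "b \<in> weyl" using word_weyl[OF zs] by (cases "word_prod AW zs") simp
      have "x \<otimes>\<^bsub>AW\<^esub> word_prod AW zs \<in> {\<gamma>} \<times> weyl"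
        using a b by (simp add: weyl_zero weyl_comp)
      with xl(2) show ?thesis by (rule bspec)
    qed
    \<comment> \<open>Both candidates are of minimal length in one coset of the subgroup generated
      by \<open>s1\<close> and \<open>s2\<close>.\<close>
    have "word_prod AW ys = \<one>\<^bsub>AW\<^esub>"
    proof (rule C.min_coset_rep_unique)
      show "{s1, s2} \<subseteq> simple_refls" by blast
      show "w \<in> carrier AW" using u by simp
      show "C.len (w \<otimes>\<^bsub>AW\<^esub> word_prod AW ys) \<le> C.len (w \<otimes>\<^bsub>AW\<^esub> word_prod AW ys \<otimes>\<^bsub>AW\<^esub> word_prod AW zs)"
        if "set zs \<subseteq> {s1, s2}" for zs
        using le[OF that w'] eq by simp
    qed (use ys le[OF _ w] in auto)
    then show ?thesis using eq u by simp
  qed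
  then have "w_min \<gamma> = w"
    unfolding w_min_def coset least_def[symmetric] using w by (rule the_equality[rotated])
  then show ?thesis using w unfolding least_def by auto
qed

definition wdet :: "(coroot_lattice \<Rightarrow> coroot_lattice) \<Rightarrow> int" where
  "wdet u = fst (u (1, 0)) * snd (u (0, 1)) - snd (u (1, 0)) * fst (u (0, 1))"

lemma wdet_simps [simp]:
  "wdet id = 1" "wdet (coroot_refl (1, 0) \<circ> u) = - wdet u"
  "wdet (coroot_refl (0, 1) \<circ> u) = - wdet u" "wdet (coroot_refl (2, 1) \<circ> u) = - wdet u"
  by (cases "u (1, 0)"; cases "u (0, 1)"; simp add: wdet_def algebra_simps)+

lemma cox_sign_AW: "w \<in> carrier AW \<Longrightarrow> cox_sign AW simple_refls w = wdet (snd w)"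
proof (induction rule: C.simple_induct)
  case one
  have "snd \<one>\<^bsub>AW\<^esub> = id" unfolding AW_one by (rule snd_conv)
  then have "wdet (snd \<one>\<^bsub>AW\<^esub>) = 1" by (simp only: wdet_simps)
  then show ?case by (simp add: cox_sign_def)
next
  case (mult s w)
  then have "wdet (snd (s \<otimes>\<^bsub>AW\<^esub> w)) = - wdet (snd w)"
    by (cases w) (auto simp: s0_def s1_def s2_def)
  then show ?case using C.cox_sign_simple_mult[OF mult(1,2)] mult(3) by simp
qed

lemma cox_sign_word: "set ws \<subseteq> simple_refls \<Longrightarrow>
    cox_sign AW simple_refls (word_prod AW ws) = (- 1) ^ length ws"
proof (induction ws)
  case Nil
  then show ?case by (simp add: cox_sign_def)
next
  case (Cons s ws)
  then show ?case using C.cox_sign_simple_mult[of s "word_prod AW ws"] by simp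
qed

subsection \<open>The coefficients as quasi-polynomials\<close>

text \<open>Every coefficient is a quadratic polynomial plus a periodic part; \<open>par\<close> and
  \<open>ndvd3\<close> carry the dependence on residues modulo 2 and 3.\<close>

definition par :: "int \<Rightarrow> real" where "par x = (if even x then 0 else 1)"
definition ndvd3 :: "int \<Rightarrow> real" where "ndvd3 x = (if 3 dvd x then 0 else 1)"

lemma floor_half: "real_of_int \<lfloor>real_of_int x / 2\<rfloor> = (x - par x) / 2"
proof -
  have "\<lfloor>real_of_int x / 2\<rfloor> = x div 2" using floor_divide_of_int_eq[of x 2] by simp
  then show ?thesis by (auto simp: par_def real_of_int_div elim!: oddE)
qed

lemma ceiling_half: "real_of_int \<lceil>real_of_int x / 2\<rceil> = (x + par x) / 2"
  using floor_half[of "- x"] by (simp add: ceiling_def par_def)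

text \<open>With \<open>x = m + r\<close> and remainder \<open>c\<close> of \<open>x\<close> modulo
  3, the definition becomes \<open>(x (x - 3) + c (3 - c)) / 6\<close>, and \<open>c (3 - c)\<close>
  is 0, 2, 2 for \<open>c\<close> = 0, 1, 2.\<close>

lemma N_term_eq: "N_term r m = ((m + r) * (m + r - 3) + 2 * ndvd3 (m + r)) / 6"
proof -
  let ?x = "m + r"
  have f: "\<lfloor>real_of_int ?x / 3\<rfloor> = ?x div 3" using floor_divide_of_int_eq[of ?x 3] by simp
  have e: "real_of_int ?x = 3 * real_of_int (?x div 3) + real_of_int (?x mod 3)"
    by (metis mult_div_mod_eq of_int_add of_int_mult of_int_numeral)
  have "?x mod 3 = 0 \<and> ndvd3 ?x = 0 \<or> ?x mod 3 = 1 \<and> ndvd3 ?x = 1 \<or> ?x mod 3 = 2 \<and> ndvd3 ?x = 1"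
    unfolding ndvd3_def dvd_eq_mod_eq_0 by (auto; presburger)
  then show ?thesis
    using e f by (auto simp: N_term_def field_simps)
qed

lemma ndvd3_simps:
  "ndvd3 (2 - m) = ndvd3 (m + 1)" "ndvd3 (3 - m) = ndvd3 m" "ndvd3 (4 - m) = ndvd3 (m + 2)"
  "ndvd3 (3 * n - m) = ndvd3 m" "ndvd3 (3 * n - m + 1) = ndvd3 (m + 2)"
  "ndvd3 (3 * n - m + 2) = ndvd3 (m + 1)"
  unfolding ndvd3_def by (rule if_cong; presburger)+

lemma ndvd3_sum: "ndvd3 (m + 2) = 2 - ndvd3 m - ndvd3 (m + 1)"
  unfolding ndvd3_def by (auto; presburger)

text \<open>The nine elements \<open>v\<close> of the theorem are listed by the points \<open>v (5, 3)\<close>; the coefficient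
  attached to \<open>v\<close> carries the sign of \<open>v\<close>.\<close>

definition cell_points :: "coroot_lattice set" where
  "cell_points = {(5, 3), (7, 4), (5, 4), (5, 1), (- 2, 1), (14, 9), (- 2, - 3), (- 7, - 3), (19, 10)}"

definition coef :: "coroot_lattice \<Rightarrow> coroot_lattice \<Rightarrow> real" where
  "coef z \<gamma> = (let m = fst \<gamma>; n = snd \<gamma> in
     if z = (5, 3) then 1
     else if z = (7, 4) then - (N_term 0 m + 1 / 2 *
        (n * (n - m) + \<lceil>m / 2\<rceil> - \<lfloor>(n - m) / 2\<rfloor> + \<lceil>n / 2\<rceil>))
     else if z = (5, 4) then \<lceil>m / 2\<rceil> + N_term 0 m + N_term 1 m + n * (n - m)
     else if z = (5, 1) then - (m * (m - 1) / 2 + 1 / 2 *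
        (3 * n * (n - m) + \<lceil>m / 2\<rceil> - \<lfloor>(n - m) / 2\<rfloor> - \<lceil>n / 2\<rceil>))
     else if z = (- 2, 1) then m * (m - 1) / 2 + N_term 2 m + 2 * n * (n - m)
     else if z = (14, 9) then - (N_term 1 m + N_term 2 m + n * (n - m))
     else if z = (- 2, - 3) then - (m * (m - 1) / 2 + 1 / 2 *
        (3 * n * (n - m) + \<lfloor>m / 2\<rfloor> - \<lceil>(n - m) / 2\<rceil> - \<lfloor>n / 2\<rfloor>))
     else if z = (- 7, - 3) then \<lfloor>m / 2\<rfloor> + N_term 0 m + N_term 1 m + n * (n - m)
     else - (N_term 0 m + 1 / 2 *
        (n * (n - m) + \<lfloor>m / 2\<rfloor> - \<lceil>(n - m) / 2\<rceil> + \<lfloor>n / 2\<rfloor>)))"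

lemma coef_eq:
  fixes m n :: int
  defines "x \<equiv> real_of_int m" and "y \<equiv> real_of_int n"
  shows "coef (5, 3) (m, n) = 1"
    "coef (7, 4) (m, n) = - (x * (x - 3) / 6 + ndvd3 m / 3 +
       (2 * y * (y - x) + 2 * x + par m + par (n - m) + par n) / 4)"
    "coef (5, 4) (m, n) = (x + par m) / 2 + x * (x - 3) / 6 + (x + 1) * (x - 2) / 6 +
       (ndvd3 m + ndvd3 (m + 1)) / 3 + y * (y - x)"
    "coef (5, 1) (m, n) = - (x * (x - 1) / 2 +
       (6 * y * (y - x) + 2 * x - 2 * y + par m + par (n - m) - par n) / 4)"
    "coef (- 2, 1) (m, n) = x * (x - 1) / 2 + (x + 2) * (x - 1) / 6 + ndvd3 (m + 2) / 3 + 2 * y * (y - x)"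
    "coef (14, 9) (m, n) = - ((x + 1) * (x - 2) / 6 + (x + 2) * (x - 1) / 6 +
       (ndvd3 (m + 1) + ndvd3 (m + 2)) / 3 + y * (y - x))"
    "coef (- 2, - 3) (m, n) = - (x * (x - 1) / 2 +
       (6 * y * (y - x) + 2 * x - 2 * y - par m - par (n - m) + par n) / 4)"
    "coef (- 7, - 3) (m, n) = (x - par m) / 2 + x * (x - 3) / 6 + (x + 1) * (x - 2) / 6 +
       (ndvd3 m + ndvd3 (m + 1)) / 3 + y * (y - x)"
    "coef (19, 10) (m, n) = - (x * (x - 3) / 6 + ndvd3 m / 3 +
       (2 * y * (y - x) + 2 * x - par m - par (n - m) - par n) / 4)"
  using floor_half[of "n - m"] ceiling_half[of "n - m"]
  unfolding coef_def Let_def x_def y_def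
  by (simp_all add: N_term_eq floor_half ceiling_half) (simp_all add: field_simps)

lemma affine_coords:
  "fst s0 + snd s0 (m, n) = (2 - m, 1 + n - m)" "fst s1 + snd s1 (m, n) = (3 * n - m, n)"
  "fst s2 + snd s2 (m, n) = (m, m - n)"
  by (simp_all add: s0_def s1_def s2_def zero_prod_def)

lemma simple_distinct: "s0 \<noteq> s1" "s0 \<noteq> s2" "s1 \<noteq> s2"
proof -
  have "act s0 (5, 3) \<noteq> act s1 (5, 3)" "act s0 (5, 3) \<noteq> act s2 (5, 3)" "act s1 (5, 3) \<noteq> act s2 (5, 3)"
    by (simp_all add: act_simple)
  then show "s0 \<noteq> s1" "s0 \<noteq> s2" "s1 \<noteq> s2" by auto
qed

text \<open>The orbit coordinate changes sign under an ascent, and so does the determinant contained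
  in it; hence \<open>coef\<close> is invariant.\<close>

lemma coef_ascent:
  assumes "z \<in> cell_points" "s \<in> simple_refls" "\<not> sep s z base_pt"
  shows "coef z (fst s + snd s \<gamma>) = coef z \<gamma>"
proof -
  obtain m n where \<gamma>: "\<gamma> = (m, n)" by (cases \<gamma>)
  show ?thesis
    using assms unfolding \<gamma> cell_points_def
    by (elim insertE emptyE)
       (simp_all add: sep_def act_simple affine_coords coef_eq ndvd3_simps ndvd3_sum,
        (cases "even m"; cases "even n"; simp add: par_def field_simps)+)
qed

definition nbr_sum :: "coroot_lattice \<Rightarrow> coroot_lattice \<Rightarrow> real" where
  "nbr_sum z \<gamma> = (\<Sum>r\<in>simple_refls. if act r z \<in> cell_points then coef (act r z) \<gamma> else 0)"

lemma nbr_sum_eq: "nbr_sum z \<gamma> = (if act s0 z \<in> cell_points then coef (act s0 z) \<gamma> else 0) +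
    (if act s1 z \<in> cell_points then coef (act s1 z) \<gamma> else 0) +
    (if act s2 z \<in> cell_points then coef (act s2 z) \<gamma> else 0)"
  using simple_distinct by (simp add: nbr_sum_def)

text \<open>The rule for descents in the module, divided by the determinant, whose sign changes
  under \<open>s\<close>.\<close>

lemma coef_descent:
  assumes "z \<in> cell_points" "s \<in> simple_refls" "sep s z base_pt"
  shows "coef z (fst s + snd s \<gamma>) = - coef z \<gamma> - nbr_sum z \<gamma>"
proof -
  obtain m n where \<gamma>: "\<gamma> = (m, n)" by (cases \<gamma>)
  show ?thesis
    using assms unfolding \<gamma> cell_points_def
    by (elim insertE emptyE)
       (simp_all add: sep_def act_simple affine_coords nbr_sum_eq cell_points_def coef_eq
          ndvd3_simps ndvd3_sum,
        (cases "even m"; cases "even n"; simp add: par_def field_simps)+)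
qed

lemma N_term_sum:
  assumes "m \<ge> 1" "r \<in> {0, 1, 2}"
  shows "N_term r m = (\<Sum>j | 1 \<le> j \<and> j \<le> m - 1 \<and> j mod 3 = (- r) mod 3. m - j)"
proof -
  define A where "A m = {j. 1 \<le> j \<and> j \<le> m - 1 \<and> j mod 3 = (- r) mod 3}" for m :: int
  have fin: "finite (A m)" for m
    by (rule finite_subset[of _ "{1..m - 1}"]) (auto simp: A_def)
  \<comment> \<open>From \<open>m\<close> to \<open>m + 1\<close> every old summand grows by 1, and
    a new one, at \<open>j = m\<close>, equals 1. So the sum grows by the number of indices up to
    \<open>m\<close>, which the induction has to carry along.\<close>
  have "int (card (A m)) = (m - 1 + r) div 3 \<and> real_of_int (\<Sum>j\<in>A m. m - j) = N_term r m"
    using assms(1)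
  proof (induction m rule: int_ge_induct)
    case base
    have "A 1 = {}" by (auto simp: A_def)
    then show ?case using assms(2) by (auto simp: N_term_eq ndvd3_def)
  next
    case (step i)
    have A: "A (i + 1) = (if 3 dvd i + r then insert i (A i) else A i)"
    proof -
      have "i mod 3 = (- r) mod 3 \<longleftrightarrow> 3 dvd i + r" by presburger
      then show ?thesis using step.hyps by (auto simp: A_def le_less)
    qed
    have notin: "i \<notin> A i" by (simp add: A_def)
    have card: "int (card (A (i + 1))) = (i + r) div 3"
      using step.IH fin[of i] notin by (auto simp: A) presburger+
    have "(\<Sum>j\<in>A (i + 1). i + 1 - j) = (\<Sum>j\<in>A i. i - j) + int (card (A (i + 1)))"
    proof -
      have "(\<Sum>j\<in>A (i + 1). i + 1 - j) = (\<Sum>j\<in>A (i + 1). (i - j) + 1)"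
        by (rule sum.cong) auto
      also have "\<dots> = (\<Sum>j\<in>A (i + 1). i - j) + int (card (A (i + 1)))"
        by (simp add: sum.distrib)
      also have "(\<Sum>j\<in>A (i + 1). i - j) = (\<Sum>j\<in>A i. i - j)"
        using fin[of i] notin by (simp add: A)
      finally show ?thesis .
    qed
    then have "real_of_int (\<Sum>j\<in>A (i + 1). i + 1 - j) = N_term r i + real_of_int ((i + r) div 3)"
      using step.IH card by simp
    also have "\<dots> = N_term r (i + 1)"
    proof -
      let ?x = "i + r"
      have "real_of_int ?x = 3 * real_of_int (?x div 3) + real_of_int (?x mod 3)"
        by (metis mult_div_mod_eq of_int_add of_int_mult of_int_numeral)
      moreover have "?x mod 3 = 0 \<and> ndvd3 ?x = 0 \<and> ndvd3 (?x + 1) = 1 \<or>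
          ?x mod 3 = 1 \<and> ndvd3 ?x = 1 \<and> ndvd3 (?x + 1) = 1 \<or> ?x mod 3 = 2 \<and> ndvd3 ?x = 1 \<and> ndvd3 (?x + 1) = 0"
        unfolding ndvd3_def by (auto; presburger)
      moreover have "i + 1 + r = ?x + 1" by simp
      ultimately show ?thesis unfolding N_term_eq by (auto simp: field_simps)
    qed
    finally show ?case using card by simp
  qed
  then show ?thesis by (simp add: A_def)
qed

section \<open>Duality for the nine elements\<close>

definition cell :: "(coroot_lattice \<times> (coroot_lattice \<Rightarrow> coroot_lattice)) set" where
  "cell = {x \<in> carrier AW. act x base_pt \<in> cell_points}"

definition orbit_coord where
  "orbit_coord w x = wdet (snd w) * coef (act x base_pt) (fst w)"

lemma simple_mult:
  assumes "s \<in> simple_refls" "w \<in> carrier AW"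
  shows "fst (s \<otimes>\<^bsub>AW\<^esub> w) = fst s + snd s (fst w)" "wdet (snd (s \<otimes>\<^bsub>AW\<^esub> w)) = - wdet (snd w)"
    "act (s \<otimes>\<^bsub>AW\<^esub> w) z = act s (act w z)"
proof -
  show "fst (s \<otimes>\<^bsub>AW\<^esub> w) = fst s + snd s (fst w)"
    by (cases s; cases w) simp
  show "wdet (snd (s \<otimes>\<^bsub>AW\<^esub> w)) = - wdet (snd w)"
    using assms(1) by (cases w) (auto simp: s0_def s1_def s2_def)
  show "act (s \<otimes>\<^bsub>AW\<^esub> w) z = act s (act w z)"
    using assms simple_refls_carrier by (intro act_mult) blast
qed

text \<open>Initial value: the orbit starts at the basis vector of 1.\<close>

lemma coef_0: "z \<in> cell_points \<Longrightarrow> z \<noteq> base_pt \<Longrightarrow> coef z 0 = 0"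
  unfolding cell_points_def zero_prod_def by (auto simp: coef_eq par_def ndvd3_def)

lemma cell_single_descent:
  "z \<in> cell_points \<Longrightarrow> s \<in> simple_refls \<Longrightarrow> t \<in> simple_refls \<Longrightarrow> sep s z base_pt \<Longrightarrow> sep t z base_pt \<Longrightarrow> s = t"
  unfolding cell_points_def by (elim insertE emptyE) (simp_all add: sep_def act_simple)

lemma cell_down: "z \<in> cell_points \<Longrightarrow> s \<in> simple_refls \<Longrightarrow> sep s z base_pt \<Longrightarrow> act s z \<in> cell_points"
  unfolding cell_points_def by (elim insertE emptyE) (simp_all add: sep_def act_simple)

text \<open>An upper neighbour outside the nine shares the descent \<open>s\<close> of the element
  below it, so it never occurs as a \<open>v\<close> with \<open>s v\<close> longer than
  \<open>v\<close>.\<close>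

lemma cell_up:
  "z \<in> cell_points \<Longrightarrow> s \<in> simple_refls \<Longrightarrow> t \<in> simple_refls \<Longrightarrow> sep s z base_pt \<Longrightarrow>
    \<not> sep t z base_pt \<Longrightarrow> \<not> sep s (act t z) base_pt \<Longrightarrow> act t z \<in> cell_points"
  unfolding cell_points_def by (elim insertE emptyE) (simp_all add: sep_def act_simple)

lemma lpairing_orbit_coord:
  assumes "u \<in> carrier AW" "x \<in> cell"
  shows "lpairing (\<lambda>w. orbit_coord w x) (C.kl_basis u) = (if x = u then 1 else 0)"
proof (rule C.lpairing_kl_basis[OF _ _ _ _ _ _ _ assms])
  show "cell \<subseteq> carrier AW" by (auto simp: cell_def)
  have cellD: "x \<in> carrier AW" "act x base_pt \<in> cell_points" if "x \<in> cell" for x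
    using that by (simp_all add: cell_def)
  have cell_mult: "s \<otimes>\<^bsub>AW\<^esub> x \<in> cell \<longleftrightarrow> act s (act x base_pt) \<in> cell_points"
    if "s \<in> simple_refls" "x \<in> cell" for s x
    using that simple_refls_carrier cellD(1)[OF that(2)] simple_mult(3)[OF that(1)]
    by (auto simp: cell_def)
  note desc = left_descent_iff[OF _ cellD(1)]
  show "orbit_coord \<one>\<^bsub>AW\<^esub> x = (if x = \<one>\<^bsub>AW\<^esub> then 1 else 0)" if "x \<in> cell" for x
  proof -
    have "fst \<one>\<^bsub>AW\<^esub> = (0 :: coroot_lattice)" "snd \<one>\<^bsub>AW\<^esub> = (id :: coroot_lattice \<Rightarrow> coroot_lattice)"
      unfolding AW_one by simp_all
    then have "orbit_coord \<one>\<^bsub>AW\<^esub> x = coef (act x base_pt) 0"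
      unfolding orbit_coord_def by (simp only: wdet_simps of_int_1 mult_1)
    moreover have "coef base_pt 0 = 1" by (simp add: coef_def)
    moreover have "coef (act x base_pt) 0 = 0" if "x \<noteq> \<one>\<^bsub>AW\<^esub>"
      using that coef_0[OF cellD(2)[OF \<open>x \<in> cell\<close>]] act_free[OF cellD(1)[OF \<open>x \<in> cell\<close>]] by blast
    ultimately show ?thesis by (cases "x = \<one>\<^bsub>AW\<^esub>") (simp_all add: act_one)
  qed
  show "orbit_coord (s \<otimes>\<^bsub>AW\<^esub> w) x = - orbit_coord w x"
    if "s \<in> simple_refls" "x \<in> cell" "w \<in> carrier AW" "C.len x < C.len (s \<otimes>\<^bsub>AW\<^esub> x)" for s x w
    using that coef_ascent[OF cellD(2)[OF that(2)] that(1)]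
    by (simp add: orbit_coord_def simple_mult desc(2))
  show "orbit_coord (s \<otimes>\<^bsub>AW\<^esub> w) x = orbit_coord w x +
      (\<Sum>r | r \<in> simple_refls \<and> r \<otimes>\<^bsub>AW\<^esub> x \<in> cell. orbit_coord w (r \<otimes>\<^bsub>AW\<^esub> x))"
    if "s \<in> simple_refls" "x \<in> cell" "w \<in> carrier AW" "C.len (s \<otimes>\<^bsub>AW\<^esub> x) < C.len x" for s x w
  proof -
    have "(\<Sum>r | r \<in> simple_refls \<and> r \<otimes>\<^bsub>AW\<^esub> x \<in> cell. orbit_coord w (r \<otimes>\<^bsub>AW\<^esub> x)) =
        (\<Sum>r\<in>simple_refls. if r \<otimes>\<^bsub>AW\<^esub> x \<in> cell then orbit_coord w (r \<otimes>\<^bsub>AW\<^esub> x) else 0)"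
      by (rule sum.inter_filter) simp
    also have "\<dots> = (\<Sum>r\<in>simple_refls. wdet (snd w) *
        (if act r (act x base_pt) \<in> cell_points then coef (act r (act x base_pt)) (fst w) else 0))"
      using cell_mult[OF _ that(2)] simple_mult(3)[OF _ cellD(1)[OF that(2)]]
      by (intro sum.cong) (simp_all only: orbit_coord_def if_distrib mult_zero_right split: if_splits, auto)
    also have "\<dots> = wdet (snd w) * nbr_sum (act x base_pt) (fst w)"
      unfolding nbr_sum_def by (rule sum_distrib_left[symmetric])
    finally have sum: "(\<Sum>r | r \<in> simple_refls \<and> r \<otimes>\<^bsub>AW\<^esub> x \<in> cell. orbit_coord w (r \<otimes>\<^bsub>AW\<^esub> x)) =
        wdet (snd w) * nbr_sum (act x base_pt) (fst w)" .
    have "sep s (act x base_pt) base_pt" using that(4) desc(1)[OF that(1,2)] by blast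
    then show ?thesis
      unfolding sum using coef_descent[OF cellD(2)[OF that(2)] that(1), of "fst w"]
      by (simp add: orbit_coord_def simple_mult[OF that(1,3)] right_diff_distrib)
  qed
  show "s = t" if "s \<in> simple_refls" "t \<in> simple_refls" "x \<in> cell"
    "C.len (s \<otimes>\<^bsub>AW\<^esub> x) < C.len x" "C.len (t \<otimes>\<^bsub>AW\<^esub> x) < C.len x" for s t x
    using cell_single_descent[OF cellD(2)[OF that(3)] that(1,2)] that(4,5)
    unfolding desc(1)[OF that(1,3)] desc(1)[OF that(2,3)] by blast
  show "s \<otimes>\<^bsub>AW\<^esub> x \<in> cell" if "s \<in> simple_refls" "x \<in> cell" "C.len (s \<otimes>\<^bsub>AW\<^esub> x) < C.len x" for s x
    using cell_down[OF cellD(2)[OF that(2)] that(1)] that(3)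
    unfolding desc(1)[OF that(1,2)] cell_mult[OF that(1,2)] by blast
  show "t \<otimes>\<^bsub>AW\<^esub> x \<in> cell" if "s \<in> simple_refls" "t \<in> simple_refls" "x \<in> cell"
    "C.len (s \<otimes>\<^bsub>AW\<^esub> x) < C.len x" "C.len x < C.len (t \<otimes>\<^bsub>AW\<^esub> x)"
    "C.len (t \<otimes>\<^bsub>AW\<^esub> x) < C.len (s \<otimes>\<^bsub>AW\<^esub> (t \<otimes>\<^bsub>AW\<^esub> x))" for s t x
  proof -
    have tx: "t \<otimes>\<^bsub>AW\<^esub> x \<in> carrier AW"
      using that(2) cellD(1)[OF that(3)] simple_refls_carrier by (intro AW.m_closed) auto
    show ?thesis
      using cell_up[OF cellD(2)[OF that(3)] that(1,2)] that(4-6)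
      unfolding desc(1)[OF that(1,3)] desc(2)[OF that(2,3)] left_descent_iff(2)[OF that(1) tx]
        cell_mult[OF that(2,3)] simple_mult(3)[OF that(2) cellD(1)[OF that(3)]] by blast
  qed
qed

lemma m_coeff_eq:
  assumes ws: "set ws \<subseteq> simple_refls" and z: "act (word_prod AW ws) base_pt = z" "z \<in> cell_points"
  shows "real_of_int (m_coeff ws \<gamma>) = (- 1) ^ length ws * coef z \<gamma>"
proof -
  let ?x = "word_prod AW ws" and ?\<epsilon> = "cox_sign AW simple_refls"
  obtain u where u: "u \<in> weyl" "w_min \<gamma> = (\<gamma>, u)" using w_min_eq by blast
  have x: "?x \<in> carrier AW" using C.word_prod_closed[OF ws] .
  then have xc: "?x \<in> cell" using z by (simp add: cell_def)
  have w: "(\<gamma>, u) \<in> carrier AW" using u by simp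
  have "real_of_int (m_coeff ws \<gamma>) = ?\<epsilon> (\<gamma>, u) * ?\<epsilon> ?x * orbit_coord (\<gamma>, u) ?x"
    using C.inv_kl_dual[OF lpairing_orbit_coord[OF _ xc] w x] u(2) by simp
  \<comment> \<open>The determinant of \<open>u\<close> inside the orbit coordinate is the sign of
    \<open>(\<gamma>, u)\<close>, so this sign occurs twice.\<close>
  also have "\<dots> = real_of_int (?\<epsilon> (\<gamma>, u) * ?\<epsilon> (\<gamma>, u)) * ((- 1) ^ length ws * coef z \<gamma>)"
    using cox_sign_AW[OF w] cox_sign_word[OF ws] z(1) by (simp add: orbit_coord_def)
  finally show ?thesis by (simp add: C.cox_sign_square)
qed

lemma act_word: "set ws \<subseteq> simple_refls \<Longrightarrow> act (word_prod AW ws) z = foldr act ws z"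
proof (induction ws)
  case (Cons s ws)
  then show ?case using simple_mult(3)[of s "word_prod AW ws"] C.word_prod_closed[of ws] by simp
qed (simp add: act_one)

theorem theorem7p19:
  fixes m n :: int
  shows "m_coeff [] (m, n) = 1
    \<and> m_coeff [s0] (m, n) = N_term 0 m + 1 / 2 *
        (n * (n - m) + \<lceil>m / 2\<rceil> - \<lfloor>(n - m) / 2\<rfloor> + \<lceil>n / 2\<rceil>)
    \<and> m_coeff [s1, s0] (m, n) = \<lceil>m / 2\<rceil> + N_term 0 m + N_term 1 m + n * (n - m)
    \<and> m_coeff [s2, s1, s0] (m, n) = m * (m - 1) / 2 + 1 / 2 *
        (3 * n * (n - m) + \<lceil>m / 2\<rceil> - \<lfloor>(n - m) / 2\<rfloor> - \<lceil>n / 2\<rceil>)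
    \<and> m_coeff [s1, s2, s1, s0] (m, n) = m * (m - 1) / 2 + N_term 2 m + 2 * n * (n - m)
    \<and> m_coeff [s0, s1, s2, s1, s0] (m, n) = N_term 1 m + N_term 2 m + n * (n - m)
    \<and> m_coeff [s2, s1, s2, s1, s0] (m, n) = m * (m - 1) / 2 + 1 / 2 *
        (3 * n * (n - m) + \<lfloor>m / 2\<rfloor> - \<lceil>(n - m) / 2\<rceil> - \<lfloor>n / 2\<rfloor>)
    \<and> m_coeff [s1, s2, s1, s2, s1, s0] (m, n) = \<lfloor>m / 2\<rfloor> + N_term 0 m + N_term 1 m + n * (n - m)
    \<and> m_coeff [s0, s1, s2, s1, s2, s1, s0] (m, n) = N_term 0 m + 1 / 2 *
        (n * (n - m) + \<lfloor>m / 2\<rfloor> - \<lceil>(n - m) / 2\<rceil> + \<lfloor>n / 2\<rfloor>)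
    \<and> (m \<ge> 1 \<longrightarrow> (\<forall>r\<in>{0, 1, 2}.
        N_term r m = (\<Sum>j | 1 \<le> j \<and> j \<le> m - 1 \<and> j mod 3 = (- r) mod 3. m - j)))"
proof -
  \<comment> \<open>Each word is identified by its image of the base point; the power of -1 cancels
    the sign built into \<open>coef\<close>.\<close>
  have M: "real_of_int (m_coeff ws (m, n)) = (- 1) ^ length ws * coef z (m, n)"
    if "set ws \<subseteq> simple_refls" "foldr act ws base_pt = z" "z \<in> cell_points" for ws z
    using m_coeff_eq[OF that(1) _ that(3)] act_word[OF that(1)] that(2) by simp
  have "m_coeff [] (m, n) = 1"
    using M[of "[]" "(5, 3)"] by (simp add: cell_points_def coef_eq)
  moreover note M[of "[s0]" "(7, 4)"] M[of "[s1, s0]" "(5, 4)"] M[of "[s2, s1, s0]" "(5, 1)"]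
    M[of "[s1, s2, s1, s0]" "(- 2, 1)"] M[of "[s0, s1, s2, s1, s0]" "(14, 9)"]
    M[of "[s2, s1, s2, s1, s0]" "(- 2, - 3)"] M[of "[s1, s2, s1, s2, s1, s0]" "(- 7, - 3)"]
    M[of "[s0, s1, s2, s1, s2, s1, s0]" "(19, 10)"]
  ultimately show ?thesis
    using N_term_sum[of m] by (simp add: act_simple cell_points_def coef_def)
qed

end
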